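(* Let $\alpha>0$, $R>0$ and $\gamma\in(0,1/2]$ be fixed constants, and put $\epsilon_n=n^{-\alpha/(2\alpha+1)}\sqrt{\log n}$. Consider the white noise model, the prior, the posterior distribution $\Pi_\alpha(\cdot\mid D_n)$, the posterior mean $\hat f$ and the class $B(\alpha,R)$ described in the context. Let $h_n$ be determined by $$\Pi_\alpha\bigl(f:\ \|f-\hat f\|_\infty\le h_n \,\big|\, D_n\bigr)=1-\gamma .$$ Then: (1) For any sequence $M_n\to\infty$, $$\mathrm{E}_{f_0}\Pi_\alpha\bigl(f:\ \|f-f_0\|_\infty>M_n\epsilon_n\,\big|\,D_n\bigr)\to 0\quad\text{as } n\to\infty,$$ uniformly for all $f_0\in B(\alpha,R)$. (2) For every sufficiently large constant $M>0$ (not depending on $n$ or $f_0$), for $f_0\in B(\alpha,R)$, $$P_{f_0}\bigl\{\|f_0-\hat f\|_\infty\le M h_n\bigr\}\to 1\quad\text{as } n\to\infty .$$ (3) $h_n\lesssim\epsilon_n$, i.e. there is a constant $C>0$ not depending on $n$ such that $h_n\le C\epsilon_n$ for all $n\ge 2$.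
   Context: Basis: on $[0,1]$ let $\phi_1(x)=1$, $\phi_{2i}(x)=\sqrt2\cos(2\pi i x)$, $\phi_{2i+1}(x)=\sqrt2\sin(2\pi i x)$ for $i=1,2,\ldots$ (the Fourier orthonormal basis of $L_2[0,1]$). Model: one observes the white noise model $dY(t)=f(t)\,dt+n^{-1/2}\,dW(t)$, $t\in[0,1]$, with $W$ a standard Brownian motion. Equivalently, one observes the normal sequence $Y_i=\theta_i+n^{-1/2}\varepsilon_i$, $i=1,2,\ldots$, where $Y_i=\int\phi_i(x)\,dY(x)$, $\theta_i=\int\phi_i(x)f(x)\,dx$ and $\varepsilon_i=\int\phi_i(x)\,dW(x)$ are i.i.d. $N(0,1)$. $D_n$ denotes the data (the whole observation). $P_{f_0}$ and $\mathrm{E}_{f_0}$ denote probability and expectation under the true function $f=f_0$, with $f_0=\sum_{i\ge1}\theta_{0i}\phi_i$. Prior: $\Pi_\alpha$ is the law of $f=\sum_{i=1}^\infty\theta_i\phi_i$ with $\theta_i$ independent, $\theta_i\sim N(0,i^{-(2\alpha+1)})$. The posterior distribution $\Pi_\alpha(\cdot\mid D_n)$ is then the law of $f=\sum_{i=1}^\infty\theta_i\phi_i$ where, given $D_n$, the $\theta_i$ are independent and normal with mean $\hat\theta_i=nY_i/(i^{2\alpha+1}+n)$ and variance $(i^{2\alpha+1}+n)^{-1}$. The posterior mean is $\hat f=\mathrm{E}(f\mid D_n)=\sum_{i=1}^\infty\hat\theta_i\phi_i$. The posterior law of $f-\hat f$ does not depend on the data, so $h_n$ is deterministic. Function class: $B(\alpha,R)=\{f=\sum_{i\ge1}\theta_i\phi_i:\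 \sum_{i=1}^\infty i^{\alpha}|\theta_i|\le R\}$. $\|\cdot\|_\infty$ is the supremum norm on $[0,1]$. *)

theory Defs
  imports "HOL-Probability.Probability"
begin

text \<open>Coefficient sequences are functions on \<^typ>\<open>nat\<close> that are only ever used at indices
  \<open>i \<ge> 1\<close>; their laws are product measures over the index set \<open>{1..}\<close>.\<close>

definition fourier_basis :: "nat \<Rightarrow> real \<Rightarrow> real" where
  "fourier_basis i x =
     (if i = 1 then 1
      else if even i then sqrt 2 * cos (2 * pi * real (i div 2) * x)
      else sqrt 2 * sin (2 * pi * real (i div 2) * x))"

definition fourier_coeff :: "(real \<Rightarrow> real) \<Rightarrow> nat \<Rightarrow> real" where
  "fourier_coeff f i = (LINT x:{0..1}|lborel. fourier_basis i x * f x)"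

definition fourier_series :: "(nat \<Rightarrow> real) \<Rightarrow> real \<Rightarrow> real" where
  "fourier_series \<theta> x = (\<Sum>i. \<theta> (Suc i) * fourier_basis (Suc i) x)"

text \<open>Extended-real valued, so that an unbounded function has norm \<open>\<infinity>\<close>.\<close>

definition sup_norm :: "(real \<Rightarrow> real) \<Rightarrow> ereal" where
  "sup_norm f = (SUP x\<in>{0..1}. ereal \<bar>f x\<bar>)"

definition function_class :: "real \<Rightarrow> real \<Rightarrow> (real \<Rightarrow> real) set" where
  "function_class \<alpha> R =
     {f. \<exists>\<theta>. (\<forall>x\<in>{0..1}. f x = fourier_series \<theta> x) \<and>
             summable (\<lambda>i. real (Suc i) powr \<alpha> * \<bar>\<theta> (Suc i)\<bar>) \<and>
             (\<Sum>i. real (Suc i) powr \<alpha> * \<bar>\<theta> (Suc i)\<bar>) \<le> R}"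

definition gaussian_sequence :: "(nat \<Rightarrow> real) \<Rightarrow> (nat \<Rightarrow> real) \<Rightarrow> (nat \<Rightarrow> real) measure" where
  "gaussian_sequence \<mu> \<sigma> = (\<Pi>\<^sub>M i\<in>{1..}. density lborel (normal_density (\<mu> i) (\<sigma> i)))"

text \<open>The law of the data \<open>(Y\<^sub>i)\<close> in the sequence form of the white noise model with true
  function \<open>f\<close>. Measures are completed here and in \<open>posterior_prob\<close> below: supremum-norm
  events involve uncountably many points and a pointwise series that converges only almost
  surely, so they are measurable only up to null sets.\<close>

definition data_law :: "nat \<Rightarrow> (real \<Rightarrow> real) \<Rightarrow> (nat \<Rightarrow> real) measure" where
  "data_law n f = completion (gaussian_sequence (fourier_coeff f) (\<lambda>i. 1 / sqrt (real n)))"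

definition prior_sd :: "real \<Rightarrow> nat \<Rightarrow> real" where
  "prior_sd \<alpha> i = sqrt (real i powr (- (2 * \<alpha> + 1)))"

definition coeff_prior :: "real \<Rightarrow> (nat \<Rightarrow> real) measure" where
  "coeff_prior \<alpha> = gaussian_sequence (\<lambda>i. 0) (prior_sd \<alpha>)"

definition posterior_coeff_mean :: "real \<Rightarrow> nat \<Rightarrow> (nat \<Rightarrow> real) \<Rightarrow> nat \<Rightarrow> real" where
  "posterior_coeff_mean \<alpha> n y i = real n * y i / (real i powr (2 * \<alpha> + 1) + real n)"

definition posterior_coeff_sd :: "real \<Rightarrow> nat \<Rightarrow> nat \<Rightarrow> real" where
  "posterior_coeff_sd \<alpha> n i = 1 / sqrt (real i powr (2 * \<alpha> + 1) + real n)"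

definition coeff_posterior :: "real \<Rightarrow> nat \<Rightarrow> (nat \<Rightarrow> real) \<Rightarrow> (nat \<Rightarrow> real) measure" where
  "coeff_posterior \<alpha> n y = gaussian_sequence (posterior_coeff_mean \<alpha> n y) (posterior_coeff_sd \<alpha> n)"

text \<open>Bayes' rule. Under the prior and in the model the coordinates \<open>(\<theta>\<^sub>i, Y\<^sub>i)\<close> are independent,
  so \<open>coeff_posterior\<close> is the conditional law of \<open>\<theta> \<sim> coeff_prior \<alpha>\<close> given the data as soon as,
  in each coordinate, prior times likelihood factors as marginal times posterior.\<close>

lemma prior_times_likelihood:
  assumes "n \<ge> 1" and "i \<ge> 1"
  shows "normal_density 0 (prior_sd \<alpha> i) t * normal_density t (1 / sqrt (real n)) (y i) =
         normal_density 0 (sqrt ((prior_sd \<alpha> i)\<^sup>2 + 1 / real n)) (y i) *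
         normal_density (posterior_coeff_mean \<alpha> n y i) (posterior_coeff_sd \<alpha> n i) t"
proof -
  define a where "a = real i powr (2 * \<alpha> + 1)"
  define m where "m = real n"
  have a: "a > 0" and m: "m > 0" using assms by (auto simp: a_def m_def)
  have "real i powr (- (2 * \<alpha> + 1)) = 1 / a"
    unfolding a_def powr_minus by (simp add: divide_inverse)
  then have p: "(prior_sd \<alpha> i)\<^sup>2 = 1 / a"
    using a by (simp add: prior_sd_def)
  have q: "(posterior_coeff_sd \<alpha> n i)\<^sup>2 = 1 / (a + m)"
    using a m by (simp add: posterior_coeff_sd_def a_def m_def power_divide)
  have r: "(1 / sqrt m)\<^sup>2 = 1 / m" using m by (simp add: power_divide)
  have s: "(sqrt (1 / a + 1 / m))\<^sup>2 = 1 / a + 1 / m" using a m by simp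
  have e: "- t\<^sup>2 / (2 * (1 / a)) + - (y i - t)\<^sup>2 / (2 * (1 / m)) =
        - (y i)\<^sup>2 / (2 * (1 / a + 1 / m)) + - (t - m * y i / (a + m))\<^sup>2 / (2 * (1 / (a + m)))"
  proof -
    have am: "a + m > 0" using a m by simp
    define z where "z = m * y i / (a + m)"
    have z: "(a + m) * z = m * y i" using am by (simp add: z_def)
    have "a * t\<^sup>2 + m * (y i - t)\<^sup>2 = a * (y i * z) + (a + m) * (t - z)\<^sup>2"
      using z by algebra
    moreover have "- (y i)\<^sup>2 / (2 * (1 / a + 1 / m)) = - (a * (y i * z)) / 2"
      using a m am by (simp add: z_def power2_eq_square field_simps)
    moreover have "- t\<^sup>2 / (2 * (1 / a)) + - (y i - t)\<^sup>2 / (2 * (1 / m)) =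
        - (a * t\<^sup>2 + m * (y i - t)\<^sup>2) / 2"
      by (simp add: field_simps)
    moreover have "- (t - z)\<^sup>2 / (2 * (1 / (a + m))) = - ((a + m) * (t - z)\<^sup>2) / 2"
      by (simp add: field_simps)
    ultimately show ?thesis
      unfolding z_def[symmetric] by (simp only: minus_add_distrib add_divide_distrib)
  qed
  have c: "1 / sqrt (2 * pi * (1 / a)) * (1 / sqrt (2 * pi * (1 / m))) =
           1 / sqrt (2 * pi * (1 / a + 1 / m)) * (1 / sqrt (2 * pi * (1 / (a + m))))"
  proof -
    have "(2 * pi * (1 / a)) * (2 * pi * (1 / m)) = (2 * pi * (1 / a + 1 / m)) * (2 * pi * (1 / (a + m)))"
    proof -
      have "a + m \<noteq> 0" "1 / a + 1 / m = (a + m) / (a * m)"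
        using a m by (simp_all add: add_frac_eq)
      then show ?thesis by simp
    qed
    then show ?thesis by (simp flip: real_sqrt_mult)
  qed
  have "(1 / sqrt (2 * pi * (1 / a)) * (1 / sqrt (2 * pi * (1 / m)))) *
          exp (- t\<^sup>2 / (2 * (1 / a)) + - (y i - t)\<^sup>2 / (2 * (1 / m))) =
        (1 / sqrt (2 * pi * (1 / a + 1 / m)) * (1 / sqrt (2 * pi * (1 / (a + m))))) *
          exp (- (y i)\<^sup>2 / (2 * (1 / a + 1 / m)) + - (t - m * y i / (a + m))\<^sup>2 / (2 * (1 / (a + m))))"
    unfolding c e ..
  moreover have "real n = m" "posterior_coeff_mean \<alpha> n y i = m * y i / (a + m)"
    by (simp_all add: posterior_coeff_mean_def m_def a_def)
  ultimately show ?thesis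
    unfolding normal_density_def by (simp only: p q r s exp_add diff_0_right mult_ac)
qed

text \<open>The posterior probability that the random function lies in \<open>S\<close>, given the data \<open>y\<close>.\<close>

definition posterior_prob :: "real \<Rightarrow> nat \<Rightarrow> (nat \<Rightarrow> real) \<Rightarrow> (real \<Rightarrow> real) set \<Rightarrow> real" where
  "posterior_prob \<alpha> n y S =
     measure (completion (coeff_posterior \<alpha> n y))
       {\<theta> \<in> space (coeff_posterior \<alpha> n y). fourier_series \<theta> \<in> S}"

definition posterior_mean :: "real \<Rightarrow> nat \<Rightarrow> (nat \<Rightarrow> real) \<Rightarrow> real \<Rightarrow> real" where
  "posterior_mean \<alpha> n y = fourier_series (posterior_coeff_mean \<alpha> n y)"

definition rate :: "real \<Rightarrow> nat \<Rightarrow> real" where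
  "rate \<alpha> n = real n powr (- \<alpha> / (2 * \<alpha> + 1)) * sqrt (ln (real n))"

text \<open>The posterior law of \<open>f - posterior_mean \<alpha> n y\<close> is the same for almost all data \<open>y\<close>; for
  exceptional \<open>y\<close> the series defining \<open>posterior_mean\<close> may diverge, whence the almost-everywhere
  quantifier.\<close>

definition credible_radius :: "real \<Rightarrow> real \<Rightarrow> real \<Rightarrow> nat \<Rightarrow> real \<Rightarrow> bool" where
  "credible_radius \<alpha> R \<gamma> n r \<longleftrightarrow>
     (\<forall>f\<^sub>0 \<in> function_class \<alpha> R. AE y in data_law n f\<^sub>0.
        posterior_prob \<alpha> n y
          {f. sup_norm (\<lambda>x. f x - posterior_mean \<alpha> n y x) \<le> ereal r} = 1 - \<gamma>)"

end

theory Submission imports Defs begin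

text \<open>Given the data, \<open>f - posterior_mean\<close> is the Gaussian Fourier series \<open>W\<close> whose coefficients have standard
  deviations \<open>posterior_coeff_sd \<alpha> n i\<close>, the inverse square roots of \<open>i powr (2 * \<alpha> + 1) + n\<close>. Under the true
  function \<open>f\<^sub>0\<close>, the error \<open>f\<^sub>0 - posterior_mean\<close> is a deterministic bias minus a Gaussian Fourier series \<open>V\<close> with smaller
  standard deviations. Write \<open>r = n powr (- \<alpha> / (2 * \<alpha> + 1))\<close>, so that \<open>rate \<alpha> n\<close> is \<open>r\<close> times the square root of \<open>ln n\<close>.
  Everything follows from three estimates.

  \<^item> The bias is at most a constant times \<open>r\<close> in sup norm (\<open>bias_bound\<close>), because in the class the coefficients are
  absolutely summable even after multiplication by \<open>i powr \<alpha>\<close>.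

  \<^item> Both \<open>V\<close> and \<open>W\<close> are at most a constant times the rate, outside an event of probability \<open>O(1 / n)\<close>
  (\<open>gaussian_series_sup\<close>). The coefficients are cut into the block up to the index where \<open>i powr (2 * \<alpha> + 1)\<close> overtakes
  \<open>n\<close>, followed by dyadic blocks. In a block of length \<open>D\<close> a Gaussian tail bound is applied to all partial sums at
  polynomially many grid points; the union bound over polynomially many events costs only a logarithm. Bounding all
  partial sums at once also yields almost sure uniform convergence, so that the pointwise series is a continuous function.

  \<^item> Conversely \<open>W\<close> exceeds a constant times the rate with probability tending to one (\<open>posterior_sup_ge\<close>). For
  long partial sums \<open>S\<close> of \<open>W\<close> and a suitable \<open>z\<close>, the average over the interval of \<open>exp (z * S t - z\<^sup>2 * Var (S t) / 2)\<close> has mean one and a variance that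
  tends to zero, by Parseval's identity for the covariance kernel. So it is at least \<open>1 / 2\<close> with high probability, and then
  \<open>S t\<close> is at least of the order of \<open>z * Var (S t)\<close> at some point \<open>t\<close>. The bound passes to the limit by uniform convergence.

  Contraction follows from the first two estimates and the triangle inequality. The second one, with a threshold depending on
  \<open>\<gamma>\<close>, bounds the credible radius from above. Since the sup-norm ball has posterior mass \<open>1 - \<gamma>\<close>, which is at least
  \<open>1 / 2\<close>, the third one bounds the radius from below by a constant times the rate; a large multiple of it
  then dominates bias and noise, which is the coverage statement.\<close>

section \<open>The Fourier basis\<close>

lemma continuous_fourier_basis: "continuous_on A (fourier_basis i)"
  unfolding fourier_basis_def by (cases "i = 1"; cases "even i") (auto intro!: continuous_intros)

lemma borel_measurable_fourier_basis [measurable]: "fourier_basis i \<in> borel_measurable borel"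
  by (intro borel_measurable_continuous_onI continuous_fourier_basis)

lemma abs_fourier_basis_le: "\<bar>fourier_basis i x\<bar> \<le> sqrt 2"
proof -
  have "\<bar>sqrt 2 * c\<bar> \<le> sqrt 2" if "\<bar>c\<bar> \<le> 1" for c :: real
    using that by (simp add: abs_mult mult_left_le)
  then show ?thesis
    by (auto simp: fourier_basis_def)
qed

lemma fourier_basis_square_le: "(fourier_basis i x)\<^sup>2 \<le> 2"
  using abs_le_square_iff[of "fourier_basis i x" "sqrt 2"] abs_fourier_basis_le[of i x] by simp

lemma abs_sin_diff_le: "\<bar>sin u - sin v\<bar> \<le> \<bar>u - v\<bar>" for u v :: real
proof -
  have "\<bar>sin u - sin v\<bar> = 2 * (\<bar>sin ((u - v) / 2)\<bar> * \<bar>cos ((u + v) / 2)\<bar>)"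
    by (simp add: sin_diff_sin abs_mult)
  also have "\<dots> \<le> 2 * (\<bar>(u - v) / 2\<bar> * 1)"
    by (intro mult_left_mono mult_mono abs_sin_x_le_abs_x) auto
  finally show ?thesis by simp
qed

lemma abs_cos_diff_le: "\<bar>cos u - cos v\<bar> \<le> \<bar>u - v\<bar>" for u v :: real
  using abs_sin_diff_le[of "u + pi / 2" "v + pi / 2"] by (simp add: sin_add)

lemma fourier_basis_Lipschitz: "\<bar>fourier_basis i x - fourier_basis i y\<bar> \<le> 5 * real i * \<bar>x - y\<bar>"
proof (cases "i = 1")
  case False
  define w where "w = 2 * pi * real (i div 2)"
  have "2 * real (i div 2) \<le> real i" by linarith
  then have w: "0 \<le> w" "w \<le> pi * real i"
    using mult_left_mono[of "2 * real (i div 2)" "real i" pi] by (auto simp: w_def mult_ac)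
  have "\<bar>fourier_basis i x - fourier_basis i y\<bar> \<le> sqrt 2 * \<bar>w * x - w * y\<bar>"
    using False abs_sin_diff_le[of "w * x" "w * y"] abs_cos_diff_le[of "w * x" "w * y"]
    by (auto simp: fourier_basis_def w_def abs_mult simp flip: right_diff_distrib)
  also have "\<dots> = (sqrt 2 * w) * \<bar>x - y\<bar>"
    using w by (simp add: abs_mult flip: right_diff_distrib)
  also have "\<dots> \<le> (5 * real i) * \<bar>x - y\<bar>"
  proof (intro mult_right_mono)
    have "sqrt 2 \<le> 3 / 2"
      by (rule real_le_lsqrt) (auto simp: power2_eq_square)
    then have "sqrt 2 * pi \<le> (3/2) * (16/5)"
      using pi_approx by (intro mult_mono) auto
    then have "sqrt 2 * pi * real i \<le> 5 * real i"
      by (intro mult_right_mono) auto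
    moreover have "sqrt 2 * w \<le> sqrt 2 * (pi * real i)"
      using w by (intro mult_left_mono) auto
    ultimately show "sqrt 2 * w \<le> 5 * real i" by (simp only: mult.assoc)
  qed auto
  finally show ?thesis .
qed (simp add: fourier_basis_def)

text \<open>The squared sine and cosine of equal frequency add up to a constant. This makes the pointwise variance of a
  Gaussian Fourier series bounded below uniformly in \<open>x\<close>.\<close>

lemma sum_fourier_basis_square:
  "(\<Sum>i<2 * N + 1. (fourier_basis (Suc i) x)\<^sup>2) = 2 * real N + 1"
proof (induction N)
  case 0
  show ?case by (simp add: fourier_basis_def)
next
  case (Suc N)
  have e: "2 * Suc N + 1 = Suc (Suc (2 * N + 1))" by simp
  have "(fourier_basis (Suc (2 * N + 1)) x)\<^sup>2 + (fourier_basis (Suc (Suc (2 * N + 1))) x)\<^sup>2 = 2"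
    by (simp add: fourier_basis_def power_mult_distrib distrib_left[symmetric] del: of_nat_Suc)
  then show ?case
    using Suc.IH unfolding e by (simp del: mult_Suc_right)
qed

lemma integral_cos_int:
  "(LINT x:{0..1}|lborel. cos (2 * pi * of_int k * x)) = (if k = 0 then 1 else 0)"
proof (cases "k = 0")
  case True
  then show ?thesis by (simp add: set_lebesgue_integral_def)
next
  case False
  have "(LINT x:{0..1}|lborel. cos (2 * pi * of_int k * x)) =
      sin (2 * pi * of_int k * 1) / (2 * pi * of_int k) - sin (2 * pi * of_int k * 0) / (2 * pi * of_int k)"
    unfolding set_lebesgue_integral_def using False
    by (intro integral_FTC_Icc)
       (auto intro!: derivative_eq_intros continuous_intros simp: has_real_derivative_iff_has_vector_derivative[symmetric])
  also have "sin (2 * pi * of_int k * 1) = 0"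
    using sin_integer_2pi[of "of_int k"] by simp
  finally show ?thesis using False by simp
qed

lemma integral_sin_int:
  "(LINT x:{0..1}|lborel. sin (2 * pi * of_int k * x)) = 0"
proof (cases "k = 0")
  case True
  then show ?thesis by (simp add: set_lebesgue_integral_def)
next
  case False
  have "(LINT x:{0..1}|lborel. sin (2 * pi * of_int k * x)) =
      - cos (2 * pi * of_int k * 1) / (2 * pi * of_int k) - - cos (2 * pi * of_int k * 0) / (2 * pi * of_int k)"
    unfolding set_lebesgue_integral_def using False
    by (intro integral_FTC_Icc)
       (auto intro!: derivative_eq_intros continuous_intros simp: has_real_derivative_iff_has_vector_derivative[symmetric])
  also have "cos (2 * pi * of_int k * 1) = 1"
    using cos_integer_2pi[of "of_int k"] by simp
  finally show ?thesis using False by simp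
qed

lemma set_integrable_unit_interval:
  "continuous_on {0..1::real} f \<Longrightarrow> set_integrable lborel {0..1} (f :: real \<Rightarrow> real)"
  by (rule borel_integrable_atLeastAtMost')

lemma fourier_basis_orthonormal:
  assumes "i \<ge> 1" "j \<ge> 1"
  shows "(LINT x:{0..1}|lborel. fourier_basis i x * fourier_basis j x) = (if i = j then 1 else 0)"
proof -
  define a b where "a = int (i div 2)" and "b = int (j div 2)"
  have i: "i = 1 \<or> (even i \<and> int i = 2 * a \<and> a > 0) \<or> (odd i \<and> int i = 2 * a + 1 \<and> a > 0)"
    and j: "j = 1 \<or> (even j \<and> int j = 2 * b \<and> b > 0) \<or> (odd j \<and> int j = 2 * b + 1 \<and> b > 0)"
    using assms unfolding a_def b_def by presburger+
  have fb: "fourier_basis i x = (if i = 1 then 1 else if even i then sqrt 2 * cos (2 * pi * of_int a * x)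
      else sqrt 2 * sin (2 * pi * of_int a * x))"
    "fourier_basis j x = (if j = 1 then 1 else if even j then sqrt 2 * cos (2 * pi * of_int b * x)
      else sqrt 2 * sin (2 * pi * of_int b * x))" for x
    by (auto simp: fourier_basis_def a_def b_def)
  have int_cos: "set_integrable lborel {0..1} (\<lambda>x. cos (2 * pi * of_int k * x))"
    and int_sin: "set_integrable lborel {0..1} (\<lambda>x. sin (2 * pi * of_int k * x))" for k
    by (auto intro!: set_integrable_unit_interval continuous_intros)
  have cc: "sqrt 2 * cos (2 * pi * of_int a * x) * (sqrt 2 * cos (2 * pi * of_int b * x)) =
     cos (2 * pi * of_int (a - b) * x) + cos (2 * pi * of_int (a + b) * x)"
    and ss: "sqrt 2 * sin (2 * pi * of_int a * x) * (sqrt 2 * sin (2 * pi * of_int b * x)) =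
     cos (2 * pi * of_int (a - b) * x) - cos (2 * pi * of_int (a + b) * x)"
    and sc: "sqrt 2 * sin (2 * pi * of_int a * x) * (sqrt 2 * cos (2 * pi * of_int b * x)) =
     sin (2 * pi * of_int (a + b) * x) + sin (2 * pi * of_int (a - b) * x)"
    and cs: "sqrt 2 * cos (2 * pi * of_int a * x) * (sqrt 2 * sin (2 * pi * of_int b * x)) =
     sin (2 * pi * of_int (a + b) * x) - sin (2 * pi * of_int (a - b) * x)" for x
    by (simp_all add: sin_add cos_add sin_diff cos_diff algebra_simps)
  have I:
    "(LINT x:{0..1}|lborel. sqrt 2 * cos (2 * pi * of_int a * x) * (sqrt 2 * cos (2 * pi * of_int b * x))) =
       (if a - b = 0 then 1 else 0) + (if a + b = 0 then 1 else 0)"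
    "(LINT x:{0..1}|lborel. sqrt 2 * sin (2 * pi * of_int a * x) * (sqrt 2 * sin (2 * pi * of_int b * x))) =
       (if a - b = 0 then 1 else 0) - (if a + b = 0 then 1 else 0)"
    "(LINT x:{0..1}|lborel. sqrt 2 * sin (2 * pi * of_int a * x) * (sqrt 2 * cos (2 * pi * of_int b * x))) = 0"
    "(LINT x:{0..1}|lborel. sqrt 2 * cos (2 * pi * of_int a * x) * (sqrt 2 * sin (2 * pi * of_int b * x))) = 0"
    unfolding cc ss sc cs
    by (simp_all only: set_integral_add(2) set_integral_diff(2) int_cos int_sin integral_cos_int integral_sin_int
          diff_zero add_0_right diff_self)
  have J:
    "(LINT x:{0..1}|lborel. 1 * (sqrt 2 * cos (2 * pi * of_int k * x))) = (if k = 0 then sqrt 2 else 0)"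
    "(LINT x:{0..1}|lborel. 1 * (sqrt 2 * sin (2 * pi * of_int k * x))) = 0"
    "(LINT x:{0..1}|lborel. sqrt 2 * cos (2 * pi * of_int k * x) * 1) = (if k = 0 then sqrt 2 else 0)"
    "(LINT x:{0..1}|lborel. sqrt 2 * sin (2 * pi * of_int k * x) * 1) = 0"
    "(LINT x:{0..1::real}|lborel. 1 * 1) = (1 :: real)" for k
    using integral_cos_int[of k] integral_sin_int[of k]
    by (simp_all add: set_lebesgue_integral_def)
  consider "i = 1" | "i \<noteq> 1" "even i" "int i = 2 * a" "a > 0" | "i \<noteq> 1" "odd i" "int i = 2 * a + 1" "a > 0"
    using i by fastforce
  then show ?thesis
  proof cases
    case 1
    then show ?thesis using j unfolding fb by (elim disjE conjE; simp only: J if_True if_False refl)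
        (auto simp: integral_cos_int integral_sin_int)
  next
    case 2
    then show ?thesis using j unfolding fb
      by (elim disjE conjE; simp only: J I if_True if_False refl; auto simp: I)
  next
    case 3
    then show ?thesis using j unfolding fb
      by (elim disjE conjE; simp only: J I if_True if_False refl; auto simp: I)
  qed
qed

text \<open>Membership in the function class is expressed by some absolutely summable coefficient sequence, whereas
  the data are centred at integrals. The two agree by orthonormality and dominated convergence.\<close>

lemma fourier_coeff_fourier_series:
  assumes f: "\<And>x. x \<in> {0..1} \<Longrightarrow> f x = fourier_series \<theta> x"
    and \<theta>: "summable (\<lambda>i. \<bar>\<theta> (Suc i)\<bar>)" and j: "j \<ge> 1"
  shows "fourier_coeff f j = \<theta> j"
proof -
  define g where "g i x = indicator {0..1} x *\<^sub>R (\<theta> (Suc i) * (fourier_basis j x * fourier_basis (Suc i) x))" for i x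
  have bound: "\<bar>fourier_basis a x * fourier_basis b x\<bar> \<le> 2" for a b x
    using mult_mono[OF abs_fourier_basis_le abs_fourier_basis_le, of a x b x] by (simp add: abs_mult mult.commute)
  have int: "set_integrable lborel {0..1} (\<lambda>x. fourier_basis j x * fourier_basis (Suc i) x)" for i
    by (intro set_integrable_unit_interval continuous_intros continuous_fourier_basis)
  have g_int: "integrable lborel (g i)" for i
    using set_integrable_mult_right[of "\<theta> (Suc i)", OF int] unfolding g_def set_integrable_def by simp
  have g_le: "norm (g i x) \<le> indicator {0..1} x *\<^sub>R (2 * \<bar>\<theta> (Suc i)\<bar>)" for i x
    using mult_left_mono[OF bound[of j x "Suc i"], of "\<bar>\<theta> (Suc i)\<bar>"]
    by (auto simp: g_def abs_mult mult_ac split: split_indicator)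
  have g_norm: "norm (LINT x|lborel. norm (g i x)) \<le> 2 * \<bar>\<theta> (Suc i)\<bar>" for i
  proof -
    have "norm (LINT x|lborel. norm (g i x)) = (LINT x|lborel. norm (g i x))"
      by (simp add: integral_nonneg_AE)
    also have "\<dots> \<le> (LINT x|lborel. indicator {0..1::real} x *\<^sub>R (2 * \<bar>\<theta> (Suc i)\<bar>))"
      using g_le by (intro integral_mono integrable_norm g_int) (auto intro!: integrable_indicator)
    finally show ?thesis by simp
  qed
  have "fourier_coeff f j = (LINT x|lborel. (\<Sum>i. g i x))"
    unfolding fourier_coeff_def set_lebesgue_integral_def
  proof (intro Bochner_Integration.integral_cong refl)
    fix x :: real
    have "summable (\<lambda>i. \<theta> (Suc i) * fourier_basis (Suc i) x)"
    proof (rule summable_comparison_test')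
      show "norm (\<theta> (Suc i) * fourier_basis (Suc i) x) \<le> sqrt 2 * \<bar>\<theta> (Suc i)\<bar>" for i
        using mult_left_mono[OF abs_fourier_basis_le[of "Suc i" x], of "\<bar>\<theta> (Suc i)\<bar>"]
        by (simp add: abs_mult mult_ac)
    qed (intro summable_mult \<theta>)
    then show "indicator {0..1} x *\<^sub>R (fourier_basis j x * f x) = (\<Sum>i. g i x)"
      unfolding g_def
      by (cases "x \<in> {0..1}") (simp_all add: f fourier_series_def suminf_mult[symmetric] mult_ac)
  qed
  also have "\<dots> = (\<Sum>i. LINT x|lborel. g i x)"
  proof (rule integral_suminf)
    show "AE x in lborel. summable (\<lambda>i. norm (g i x))"
    proof (intro AE_I2)
      fix x :: real
      show "summable (\<lambda>i. norm (g i x))"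
        by (rule summable_comparison_test'[where g = "\<lambda>i. indicator {0..1} x *\<^sub>R (2 * \<bar>\<theta> (Suc i)\<bar>)"])
           (use g_le \<theta> in \<open>auto intro!: summable_mult\<close>)
    qed
    show "summable (\<lambda>i. LINT x|lborel. norm (g i x))"
      by (rule summable_comparison_test'[where g = "\<lambda>i. 2 * \<bar>\<theta> (Suc i)\<bar>"])
         (use g_norm \<theta> in \<open>auto intro!: summable_mult\<close>)
  qed (rule g_int)
  also have "\<dots> = (\<Sum>i. if Suc i = j then \<theta> (Suc i) else 0)"
  proof (rule arg_cong[where f = suminf], rule ext)
    fix i
    have "(LINT x|lborel. g i x) = \<theta> (Suc i) * (LINT x:{0..1}|lborel. fourier_basis j x * fourier_basis (Suc i) x)"
      unfolding g_def by (simp add: set_lebesgue_integral_def flip: integral_mult_right_zero)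
        (simp add: mult_ac)
    also have "\<dots> = (if Suc i = j then \<theta> (Suc i) else 0)"
      using j by (simp add: fourier_basis_orthonormal del: One_nat_def)
    finally show "(LINT x|lborel. g i x) = (if Suc i = j then \<theta> (Suc i) else 0)" .
  qed
  also have "\<dots> = (\<Sum>i\<in>{j - 1}. if Suc i = j then \<theta> (Suc i) else 0)"
    by (rule suminf_finite) auto
  also have "\<dots> = \<theta> j" using j by simp
  finally show ?thesis .
qed

section \<open>Linear combinations of independent Gaussian coordinates\<close>

lemma nn_integral_exp_normal:
  assumes "\<sigma> > 0"
  shows "(\<integral>\<^sup>+x. ennreal (exp (c * (x - \<mu>))) \<partial>density lborel (normal_density \<mu> \<sigma>)) = ennreal (exp (c\<^sup>2 * \<sigma>\<^sup>2 / 2))"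
proof -
  have *: "normal_density \<mu> \<sigma> x * exp (c * (x - \<mu>)) = exp (c\<^sup>2 * \<sigma>\<^sup>2 / 2) * normal_density (\<mu> + c * \<sigma>\<^sup>2) \<sigma> x" for x
  proof -
    have "- (x - \<mu>)\<^sup>2 / (2 * \<sigma>\<^sup>2) + c * (x - \<mu>) = c\<^sup>2 * \<sigma>\<^sup>2 / 2 + - (x - (\<mu> + c * \<sigma>\<^sup>2))\<^sup>2 / (2 * \<sigma>\<^sup>2)"
      using assms by (simp add: field_simps power2_eq_square)
    then show ?thesis
      unfolding normal_density_def by (simp only: mult.assoc mult.left_commute exp_add[symmetric])
  qed
  have "(\<integral>\<^sup>+x. ennreal (exp (c * (x - \<mu>))) \<partial>density lborel (normal_density \<mu> \<sigma>)) =
     (\<integral>\<^sup>+x. ennreal (exp (c\<^sup>2 * \<sigma>\<^sup>2 / 2)) * ennreal (normal_density (\<mu> + c * \<sigma>\<^sup>2) \<sigma> x) \<partial>lborel)"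
    by (subst nn_integral_density) (auto simp: * ennreal_mult'[symmetric])
  also have "\<dots> = ennreal (exp (c\<^sup>2 * \<sigma>\<^sup>2 / 2)) * (\<integral>\<^sup>+x. ennreal (normal_density (\<mu> + c * \<sigma>\<^sup>2) \<sigma> x) \<partial>lborel)"
    by (rule nn_integral_cmult) auto
  also have "(\<integral>\<^sup>+x. ennreal (normal_density (\<mu> + c * \<sigma>\<^sup>2) \<sigma> x) \<partial>lborel) = 1"
    using assms by (subst nn_integral_eq_integral) auto
  finally show ?thesis by simp
qed

lemma prob_space_gaussian_sequence:
  assumes "\<And>i. i \<ge> 1 \<Longrightarrow> \<sigma> i > 0"
  shows "prob_space (gaussian_sequence \<mu> \<sigma>)"
  unfolding gaussian_sequence_def using assms
  by (intro prob_space_PiM prob_space_normal_density) auto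

lemma sets_gaussian_sequence [measurable_cong]:
  "sets (gaussian_sequence \<mu> \<sigma>) = sets (\<Pi>\<^sub>M i\<in>{1..}. borel)"
  unfolding gaussian_sequence_def by (intro sets_PiM_cong) auto

lemma measurable_gaussian_coordinate [measurable]:
  "(\<lambda>\<theta>. \<theta> (Suc i)) \<in> borel_measurable (gaussian_sequence \<mu> \<sigma>)"
  by measurable

lemma nn_integral_exp_gaussian_sum:
  assumes \<sigma>: "\<And>i. i \<ge> 1 \<Longrightarrow> \<sigma> i > 0"
  shows "(\<integral>\<^sup>+\<theta>. ennreal (exp (\<Sum>i\<in>{p..<q}. c i * (\<theta> (Suc i) - \<mu> (Suc i)))) \<partial>gaussian_sequence \<mu> \<sigma>) =
    ennreal (exp ((\<Sum>i\<in>{p..<q}. (c i * \<sigma> (Suc i))\<^sup>2) / 2))"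
proof (cases "p < q")
  case True
  define N where "N i = density lborel (normal_density (\<mu> i) (\<sigma> i))" for i
  have P: "gaussian_sequence \<mu> \<sigma> = (\<Pi>\<^sub>M i\<in>{1..}. N i)"
    by (simp add: gaussian_sequence_def N_def)
  interpret prob_space "gaussian_sequence \<mu> \<sigma>"
    by (rule prob_space_gaussian_sequence[OF \<sigma>])
  have N: "prob_space (N i)" if "i \<in> {1..}" for i
    using that \<sigma> by (auto simp: N_def intro: prob_space_normal_density)
  have ind: "indep_vars N (\<lambda>i \<theta>. \<theta> i) {1..}"
  proof (subst indep_vars_iff_distr_eq_PiM')
    have "distr (gaussian_sequence \<mu> \<sigma>) (Pi\<^sub>M {1..} N) (\<lambda>x. \<lambda>i\<in>{1..}. x i) =
        distr (gaussian_sequence \<mu> \<sigma>) (gaussian_sequence \<mu> \<sigma>) (\<lambda>x. x)"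
      unfolding P by (intro distr_cong refl) (auto simp: space_PiM intro: PiE_restrict)
    then show "distr (gaussian_sequence \<mu> \<sigma>) (Pi\<^sub>M {1..} N) (\<lambda>x. \<lambda>i\<in>{1..}. x i) =
      (\<Pi>\<^sub>M i\<in>{1..}. distr (gaussian_sequence \<mu> \<sigma>) (N i) (\<lambda>\<theta>. \<theta> i))"
      unfolding P using distr_PiM_component[of "{1..}" N, OF N] by (auto intro!: PiM_cong)
  qed (auto simp: P)
  define X where "X i \<theta> = ennreal (exp (c (i - 1) * (\<theta> - \<mu> i)))" for i and \<theta> :: real
  have X_meas [measurable]: "X i \<in> borel_measurable borel" for i
    unfolding X_def by measurable
  have "(\<integral>\<^sup>+\<theta>. ennreal (exp (\<Sum>i\<in>{p..<q}. c i * (\<theta> (Suc i) - \<mu> (Suc i)))) \<partial>gaussian_sequence \<mu> \<sigma>) =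
     (\<integral>\<^sup>+\<theta>. (\<Prod>i\<in>{Suc p..<Suc q}. X i (\<theta> i)) \<partial>gaussian_sequence \<mu> \<sigma>)"
    unfolding X_def prod.shift_bounds_Suc_ivl by (simp add: exp_sum prod_ennreal)
  also have "\<dots> = (\<Prod>i\<in>{Suc p..<Suc q}. \<integral>\<^sup>+\<theta>. X i (\<theta> i) \<partial>gaussian_sequence \<mu> \<sigma>)"
  proof (intro indep_vars_nn_integral)
    show "indep_vars (\<lambda>_. borel) (\<lambda>i \<theta>. X i (\<theta> i)) {Suc p..<Suc q}"
      by (rule indep_vars_compose2[OF indep_vars_subset[OF ind]]) (auto simp: N_def)
  qed auto
  also have "\<dots> = (\<Prod>i\<in>{Suc p..<Suc q}. ennreal (exp ((c (i - 1) * \<sigma> i)\<^sup>2 / 2)))"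
  proof (intro prod.cong refl)
    fix i assume "i \<in> {Suc p..<Suc q}"
    then have i: "i \<in> {1..}" by auto
    have "(\<lambda>\<theta>. \<theta> i) \<in> borel_measurable (gaussian_sequence \<mu> \<sigma>)"
      using measurable_gaussian_coordinate[of "i - 1"] i by (cases i) auto
    then have m: "(\<lambda>\<theta>. \<theta> i) \<in> measurable (gaussian_sequence \<mu> \<sigma>) (N i)"
      by (simp add: N_def)
    have "(\<integral>\<^sup>+\<theta>. X i (\<theta> i) \<partial>gaussian_sequence \<mu> \<sigma>) = (\<integral>\<^sup>+x. X i x \<partial>distr (gaussian_sequence \<mu> \<sigma>) (N i) (\<lambda>\<theta>. \<theta> i))"
      using m by (subst nn_integral_distr) (auto simp: N_def)
    also have "distr (gaussian_sequence \<mu> \<sigma>) (N i) (\<lambda>\<theta>. \<theta> i) = N i"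
      unfolding P using N i by (rule distr_PiM_component)
    also have "(\<integral>\<^sup>+x. X i x \<partial>N i) = ennreal (exp ((c (i - 1) * \<sigma> i)\<^sup>2 / 2))"
      unfolding X_def N_def using i \<sigma>[of i] by (subst nn_integral_exp_normal) (auto simp: power_mult_distrib)
    finally show "(\<integral>\<^sup>+\<theta>. X i (\<theta> i) \<partial>gaussian_sequence \<mu> \<sigma>) = ennreal (exp ((c (i - 1) * \<sigma> i)\<^sup>2 / 2))" .
  qed
  also have "\<dots> = ennreal (exp ((\<Sum>i\<in>{p..<q}. (c i * \<sigma> (Suc i))\<^sup>2) / 2))"
    unfolding prod.shift_bounds_Suc_ivl by (simp add: exp_sum prod_ennreal sum_divide_distrib)
  finally show ?thesis .
qed (use prob_space.emeasure_space_1[OF prob_space_gaussian_sequence[OF \<sigma>]] in simp)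

text \<open>Chernoff's bound from the moment generating function, applied to both signs.\<close>

lemma gaussian_sum_tail:
  assumes \<sigma>: "\<And>i. i \<ge> 1 \<Longrightarrow> \<sigma> i > 0" and s: "s > 0" "(\<Sum>i\<in>{p..<q}. (c i * \<sigma> (Suc i))\<^sup>2) \<le> s\<^sup>2" and u: "u \<ge> 0"
  shows "measure (gaussian_sequence \<mu> \<sigma>) {\<theta> \<in> space (gaussian_sequence \<mu> \<sigma>).
     \<bar>\<Sum>i\<in>{p..<q}. c i * (\<theta> (Suc i) - \<mu> (Suc i))\<bar> > u * s} \<le> 2 * exp (- u\<^sup>2 / 2)"
proof -
  interpret prob_space "gaussian_sequence \<mu> \<sigma>"
    by (rule prob_space_gaussian_sequence[OF \<sigma>])
  define Z where "Z d \<theta> = (\<Sum>i\<in>{p..<q}. d i * (\<theta> (Suc i) - \<mu> (Suc i)))" for d \<theta>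
  have Z_meas [measurable]: "Z d \<in> borel_measurable (gaussian_sequence \<mu> \<sigma>)" for d
    unfolding Z_def by measurable
  have one_sided: "prob {\<theta> \<in> space (gaussian_sequence \<mu> \<sigma>). u * s < Z d \<theta>} \<le> exp (- u\<^sup>2 / 2)"
    if d: "(\<Sum>i\<in>{p..<q}. (d i * \<sigma> (Suc i))\<^sup>2) \<le> s\<^sup>2" for d
  proof -
    define l where "l = u / s"
    have l: "l * (u * s) = u\<^sup>2" "l\<^sup>2 * s\<^sup>2 = u\<^sup>2" "l \<ge> 0"
      using s u by (auto simp: l_def power2_eq_square field_simps)
    have "emeasure (gaussian_sequence \<mu> \<sigma>) {\<theta> \<in> space (gaussian_sequence \<mu> \<sigma>). u * s < Z d \<theta>} \<le>
        emeasure (gaussian_sequence \<mu> \<sigma>)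
          {\<theta> \<in> space (gaussian_sequence \<mu> \<sigma>). 1 \<le> ennreal (exp (- u\<^sup>2)) * ennreal (exp (l * Z d \<theta>))}"
    proof (intro emeasure_mono subsetI CollectI conjI)
      fix \<theta> assume "\<theta> \<in> {\<theta> \<in> space (gaussian_sequence \<mu> \<sigma>). u * s < Z d \<theta>}"
      then have "u\<^sup>2 \<le> l * Z d \<theta>"
        using mult_left_mono[of "u * s" "Z d \<theta>" l] l by simp
      then show "1 \<le> ennreal (exp (- u\<^sup>2)) * ennreal (exp (l * Z d \<theta>))"
        by (simp add: ennreal_mult[symmetric] exp_add[symmetric] del: exp_minus)
    qed auto
    also have "\<dots> \<le> ennreal (exp (- u\<^sup>2)) * (\<integral>\<^sup>+\<theta>. ennreal (exp (l * Z d \<theta>)) * indicator (space (gaussian_sequence \<mu> \<sigma>)) \<theta> \<partial>gaussian_sequence \<mu> \<sigma>)"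
      using nn_integral_Markov_inequality[of "\<lambda>\<theta>. ennreal (exp (l * Z d \<theta>))" "space (gaussian_sequence \<mu> \<sigma>)" "gaussian_sequence \<mu> \<sigma>" "ennreal (exp (- u\<^sup>2))"]
      by simp
    also have "(\<integral>\<^sup>+\<theta>. ennreal (exp (l * Z d \<theta>)) * indicator (space (gaussian_sequence \<mu> \<sigma>)) \<theta> \<partial>gaussian_sequence \<mu> \<sigma>) =
       (\<integral>\<^sup>+\<theta>. ennreal (exp (\<Sum>i\<in>{p..<q}. (l * d i) * (\<theta> (Suc i) - \<mu> (Suc i)))) \<partial>gaussian_sequence \<mu> \<sigma>)"
      by (intro nn_integral_cong) (simp add: Z_def sum_distrib_left mult.assoc)
    also have "\<dots> = ennreal (exp ((\<Sum>i\<in>{p..<q}. (l * d i * \<sigma> (Suc i))\<^sup>2) / 2))"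
      by (rule nn_integral_exp_gaussian_sum[OF \<sigma>])
    also have "ennreal (exp (- u\<^sup>2)) * \<dots> \<le> ennreal (exp (- u\<^sup>2)) * ennreal (exp (u\<^sup>2 / 2))"
    proof (intro mult_left_mono ennreal_leI)
      have "(\<Sum>i\<in>{p..<q}. (l * d i * \<sigma> (Suc i))\<^sup>2) = l\<^sup>2 * (\<Sum>i\<in>{p..<q}. (d i * \<sigma> (Suc i))\<^sup>2)"
        by (simp add: sum_distrib_left power_mult_distrib mult.assoc)
      also have "\<dots> \<le> u\<^sup>2"
        using mult_left_mono[OF d, of "l\<^sup>2"] l by simp
      finally show "exp ((\<Sum>i\<in>{p..<q}. (l * d i * \<sigma> (Suc i))\<^sup>2) / 2) \<le> exp (u\<^sup>2 / 2)" by simp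
    qed auto
    also have "\<dots> = ennreal (exp (- u\<^sup>2 / 2))"
      by (simp add: ennreal_mult[symmetric] exp_add[symmetric] del: exp_minus)
    finally show ?thesis
      by (simp add: emeasure_eq_measure)
  qed
  have "prob {\<theta> \<in> space (gaussian_sequence \<mu> \<sigma>). \<bar>Z c \<theta>\<bar> > u * s} \<le>
     prob ({\<theta> \<in> space (gaussian_sequence \<mu> \<sigma>). u * s < Z c \<theta>} \<union> {\<theta> \<in> space (gaussian_sequence \<mu> \<sigma>). u * s < Z (\<lambda>i. - c i) \<theta>})"
    by (intro finite_measure_mono) (auto simp: Z_def sum_negf)
  also have "\<dots> \<le> prob {\<theta> \<in> space (gaussian_sequence \<mu> \<sigma>). u * s < Z c \<theta>} + prob {\<theta> \<in> space (gaussian_sequence \<mu> \<sigma>). u * s < Z (\<lambda>i. - c i) \<theta>}"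
    by (intro measure_Un_le) auto
  also have "\<dots> \<le> exp (- u\<^sup>2 / 2) + exp (- u\<^sup>2 / 2)"
    using s by (intro add_mono one_sided) auto
  finally show ?thesis by (simp add: Z_def)
qed

section \<open>Suprema of Gaussian Fourier series\<close>

text \<open>Partial sums get a name of their own because \<open>fourier_series\<close> has a value, without any meaning, where
  the series diverges; convergence is always stated for partial sums.\<close>

definition partial_series :: "(nat \<Rightarrow> real) \<Rightarrow> nat \<Rightarrow> real \<Rightarrow> real" where
  "partial_series \<theta> m x = (\<Sum>i<m. \<theta> (Suc i) * fourier_basis (Suc i) x)"

text \<open>A union bound over the partial sums of the block at the points \<open>l / D\<^sup>2\<close> and over the coefficients
  themselves. Off the grid, the crude Lipschitz bound \<open>5 * D\<close> for the basis functions is good enough, since a mesh as fine as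
  \<open>1 / D\<^sup>2\<close> increases only the polynomial number of events. All partial sums are included, and not just the sum of the
  block, because convergence of the series is convergence along every index.\<close>

lemma gaussian_block_sup:
  assumes \<sigma>: "\<And>i. i \<ge> 1 \<Longrightarrow> \<sigma> i > 0"
    and Q: "\<And>i. i \<in> {p..<q} \<Longrightarrow> \<bar>w (Suc i) * \<sigma> (Suc i)\<bar> \<le> Q" "Q > 0"
    and D: "q \<le> D" "D \<ge> 1" and u: "u \<ge> 0"
  shows "\<exists>B\<in>sets (gaussian_sequence \<mu> \<sigma>).
     measure (gaussian_sequence \<mu> \<sigma>) B \<le> 10 * real D ^ 3 * exp (- u\<^sup>2 / 2) \<and>
     (\<forall>\<theta>\<in>space (gaussian_sequence \<mu> \<sigma>) - B. \<forall>m\<in>{p..q}. \<forall>t\<in>{0..1}.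
        \<bar>\<Sum>i\<in>{p..<m}. w (Suc i) * (\<theta> (Suc i) - \<mu> (Suc i)) * fourier_basis (Suc i) t\<bar> \<le> 7 * u * Q * sqrt (real D))"
proof -
  let ?G = "gaussian_sequence \<mu> \<sigma>"
  interpret prob_space ?G
    by (rule prob_space_gaussian_sequence[OF \<sigma>])
  define c where "c \<theta> i = w (Suc i) * (\<theta> (Suc i) - \<mu> (Suc i))" for \<theta> :: "nat \<Rightarrow> real" and i
  define Z where "Z m t \<theta> = (\<Sum>i\<in>{p..<m}. c \<theta> i * fourier_basis (Suc i) t)" for m t \<theta>
  define s where "s = Q * sqrt (2 * real D)"
  define grid where "grid l = real l / real (D\<^sup>2)" for l
  define B1 where "B1 m l = {\<theta> \<in> space ?G. \<bar>Z m (grid l) \<theta>\<bar> > u * s}" for m l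
  define B2 where "B2 i = {\<theta> \<in> space ?G. \<bar>c \<theta> i\<bar> > u * Q}" for i
  have c_meas [measurable]: "(\<lambda>\<theta>. c \<theta> i) \<in> borel_measurable ?G" for i
    unfolding c_def by measurable
  have Z_meas [measurable]: "Z m t \<in> borel_measurable ?G" for m t
    unfolding Z_def by measurable
  have B_sets [measurable]: "B1 m l \<in> sets ?G" "B2 i \<in> sets ?G" for m l i
    unfolding B1_def B2_def by measurable
  have s: "s > 0" using Q D by (simp add: s_def)
  have B1: "prob (B1 m l) \<le> 2 * exp (- u\<^sup>2 / 2)" if "m \<in> {p..q}" for m l
  proof -
    have "(\<Sum>i\<in>{p..<m}. (w (Suc i) * fourier_basis (Suc i) (grid l) * \<sigma> (Suc i))\<^sup>2) \<le> (\<Sum>i\<in>{p..<m}. 2 * Q\<^sup>2)"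
    proof (rule sum_mono)
      fix i assume "i \<in> {p..<m}"
      then have "(w (Suc i) * \<sigma> (Suc i))\<^sup>2 \<le> Q\<^sup>2"
        using Q that by (intro abs_le_square_iff[THEN iffD1]) auto
      then have "(fourier_basis (Suc i) (grid l))\<^sup>2 * (w (Suc i) * \<sigma> (Suc i))\<^sup>2 \<le> 2 * Q\<^sup>2"
        by (intro mult_mono fourier_basis_square_le) auto
      then show "(w (Suc i) * fourier_basis (Suc i) (grid l) * \<sigma> (Suc i))\<^sup>2 \<le> 2 * Q\<^sup>2"
        by (simp add: power_mult_distrib mult_ac)
    qed
    also have "\<dots> \<le> real D * (2 * Q\<^sup>2)"
      using that D by (auto intro!: mult_right_mono)
    also have "\<dots> = s\<^sup>2"
      by (simp add: s_def power_mult_distrib)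
    finally show ?thesis
      using gaussian_sum_tail[where q = m and c = "\<lambda>i. w (Suc i) * fourier_basis (Suc i) (grid l)" and \<mu> = \<mu>, OF \<sigma> s _ u]
      by (simp add: B1_def Z_def c_def mult_ac)
  qed
  have B2: "prob (B2 i) \<le> 2 * exp (- u\<^sup>2 / 2)" if i: "i \<in> {p..<q}" for i
  proof -
    have "(w (Suc i) * \<sigma> (Suc i))\<^sup>2 \<le> Q\<^sup>2"
      using Q that by (intro abs_le_square_iff[THEN iffD1]) auto
    then show ?thesis
      using gaussian_sum_tail[where p = i and q = "Suc i" and c = "\<lambda>i. w (Suc i)" and \<mu> = \<mu>, OF \<sigma> Q(2) _ u]
      by (simp add: B2_def c_def)
  qed
  define B where "B = (\<Union>x\<in>{p..q} \<times> {0..D\<^sup>2}. B1 (fst x) (snd x)) \<union> (\<Union>i\<in>{p..<q}. B2 i)"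
  have "prob B \<le> prob (\<Union>x\<in>{p..q} \<times> {0..D\<^sup>2}. B1 (fst x) (snd x)) + prob (\<Union>i\<in>{p..<q}. B2 i)"
    unfolding B_def by (intro measure_Un_le) auto
  also have "\<dots> \<le> (\<Sum>x\<in>{p..q} \<times> {0..D\<^sup>2}. prob (B1 (fst x) (snd x))) + (\<Sum>i\<in>{p..<q}. prob (B2 i))"
    by (intro add_mono finite_measure_subadditive_finite) auto
  also have "\<dots> \<le> (\<Sum>x\<in>{p..q} \<times> {0..D\<^sup>2}. 2 * exp (- u\<^sup>2 / 2)) + (\<Sum>i\<in>{p..<q}. 2 * exp (- u\<^sup>2 / 2))"
    by (intro add_mono sum_mono B1 B2) auto
  also have "\<dots> = real ((Suc q - p) * Suc (D\<^sup>2) + (q - p)) * (2 * exp (- u\<^sup>2 / 2))"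
    by (simp add: algebra_simps del: of_nat_Suc)
  also have "\<dots> \<le> real (5 * D ^ 3) * (2 * exp (- u\<^sup>2 / 2))"
  proof (intro mult_right_mono of_nat_mono)
    have D2: "D \<le> D ^ 2" "D\<^sup>2 \<le> D ^ 3" "1 \<le> D ^ 3"
      using D by (auto intro: power_increasing[of 1 2 D, simplified] power_increasing)
    have "(Suc q - p) * Suc (D\<^sup>2) + (q - p) \<le> Suc D * Suc (D\<^sup>2) + D"
      using D by (intro add_mono mult_right_mono) auto
    also have "\<dots> = D ^ 3 + D\<^sup>2 + 2 * D + 1"
      by (simp add: power3_eq_cube power2_eq_square algebra_simps)
    also have "\<dots> \<le> 5 * D ^ 3"
      using D2 by linarith
    finally show "(Suc q - p) * Suc (D\<^sup>2) + (q - p) \<le> 5 * D ^ 3" .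
  qed auto
  finally have "prob B \<le> 10 * real D ^ 3 * exp (- u\<^sup>2 / 2)" by simp
  moreover have "\<bar>Z m t \<theta>\<bar> \<le> 7 * u * Q * sqrt (real D)"
    if \<theta>: "\<theta> \<in> space ?G - B" and m: "m \<in> {p..q}" and t: "t \<in> {0..1}" for \<theta> m t
  proof -
    define l where "l = nat \<lfloor>t * real (D\<^sup>2)\<rfloor>"
    have D2: "real (D\<^sup>2) > 0" using D by simp
    have "t * real (D\<^sup>2) \<le> real (D\<^sup>2)"
      using t by (intro mult_left_le_one_le) auto
    from floor_mono[OF this] have l_le: "l \<le> D\<^sup>2"
      unfolding l_def floor_of_nat by (simp add: nat_le_iff)
    have l: "real l = of_int \<lfloor>t * real (D\<^sup>2)\<rfloor>"
      using t unfolding l_def by (intro of_nat_nat) auto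
    have near: "\<bar>t - grid l\<bar> \<le> 1 / real (D\<^sup>2)"
    proof -
      have "\<bar>t * real (D\<^sup>2) - real l\<bar> \<le> 1" unfolding l by linarith
      moreover have "t - grid l = (t * real (D\<^sup>2) - real l) / real (D\<^sup>2)"
        using D2 by (simp add: grid_def diff_divide_distrib)
      ultimately show ?thesis
        using D2 by (simp add: abs_divide divide_right_mono)
    qed
    have 1: "\<bar>Z m (grid l) \<theta>\<bar> \<le> u * s"
      using \<theta> m l_le by (force simp: B_def B1_def not_less)
    have 2: "\<bar>c \<theta> i\<bar> \<le> u * Q" if "i \<in> {p..<m}" for i
      using \<theta> m that by (force simp: B_def B2_def not_less)
    \<comment> \<open>At most \<open>D\<close> coefficients, each of size \<open>u * Q\<close>, with slopes \<open>5 * D\<close>, over a distance \<open>1 / D\<^sup>2\<close>.\<close>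
    have "\<bar>Z m t \<theta> - Z m (grid l) \<theta>\<bar> = \<bar>\<Sum>i\<in>{p..<m}. c \<theta> i * (fourier_basis (Suc i) t - fourier_basis (Suc i) (grid l))\<bar>"
      unfolding Z_def by (simp add: sum_subtractf right_diff_distrib)
    also have "\<dots> \<le> (\<Sum>i\<in>{p..<m}. \<bar>c \<theta> i\<bar> * \<bar>fourier_basis (Suc i) t - fourier_basis (Suc i) (grid l)\<bar>)"
      by (rule order_trans[OF sum_abs]) (simp add: abs_mult)
    also have "\<dots> \<le> (\<Sum>i\<in>{p..<m}. (u * Q) * (5 * real D * (1 / real (D\<^sup>2))))"
    proof (intro sum_mono mult_mono 2)
      fix i assume "i \<in> {p..<m}"
      then have "real (Suc i) \<le> real D" using D m by auto
      then have "5 * real (Suc i) * \<bar>t - grid l\<bar> \<le> 5 * real D * (1 / real (D\<^sup>2))"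
        using near by (intro mult_mono) auto
      then show "\<bar>fourier_basis (Suc i) t - fourier_basis (Suc i) (grid l)\<bar> \<le> 5 * real D * (1 / real (D\<^sup>2))"
        using fourier_basis_Lipschitz[of "Suc i" t "grid l"] by linarith
    qed (use u Q in auto)
    also have "\<dots> = real (m - p) * ((u * Q) * 5 / real D)"
      using D by (simp add: power2_eq_square)
    also have "\<dots> \<le> real D * ((u * Q) * 5 / real D)"
      using u Q D m by (intro mult_right_mono) auto
    also have "\<dots> = 5 * (u * Q) * 1" using D by simp
    also have "\<dots> \<le> 5 * (u * Q) * sqrt (real D)"
      using u Q D by (intro mult_left_mono) auto
    finally have "\<bar>Z m t \<theta>\<bar> \<le> u * s + 5 * (u * Q) * sqrt (real D)"
      using 1 by linarith
    also have "u * s \<le> 2 * (u * Q * sqrt (real D))"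
    proof -
      have "sqrt 2 \<le> 2" by (rule real_le_lsqrt) auto
      from mult_right_mono[OF this, of "u * Q * sqrt (real D)"] show ?thesis
        using u Q by (simp add: s_def real_sqrt_mult mult_ac)
    qed
    finally show ?thesis by (simp add: mult_ac)
  qed
  ultimately show ?thesis
    by (intro bexI[of _ B]) (auto simp: Z_def c_def B_def mult.assoc)
qed

lemma blockwise_uniform_convergence:
  fixes S :: "nat \<Rightarrow> 'a \<Rightarrow> real"
  assumes b: "strict_mono b" "b 0 = 0" and a: "summable a" "\<And>j. a j \<ge> 0"
    and S0: "\<And>t. t \<in> T \<Longrightarrow> S 0 t = 0"
    and S: "\<And>j m t. b j \<le> m \<Longrightarrow> m \<le> b (Suc j) \<Longrightarrow> t \<in> T \<Longrightarrow> \<bar>S m t - S (b j) t\<bar> \<le> a j"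
  shows "uniformly_convergent_on T S" and "\<And>m t. t \<in> T \<Longrightarrow> \<bar>S m t\<bar> \<le> suminf a"
proof -
  have step: "\<bar>S m t - S (b J) t\<bar> \<le> (\<Sum>j\<in>{J..<J + K}. a j)"
    if "t \<in> T" "b J \<le> m" "m \<le> b (J + K)" for J K m t
    using that(2,3)
  proof (induction K arbitrary: m)
    case (Suc K)
    have mono: "b J \<le> b (J + K)"
      using b(1) by (simp add: strict_mono_less_eq)
    show ?case
    proof (cases "m \<le> b (J + K)")
      case True
      then show ?thesis using Suc.IH[OF Suc.prems(1) True] a(2)[of "J + K"] by simp
    next
      case False
      then show ?thesis
        using Suc.IH[OF mono order_refl] S[of "J + K" m t] Suc.prems that(1) by simp
    qed
  qed simp
  have tail: "\<bar>S m t - S (b J) t\<bar> \<le> suminf a - sum a {..<J}" if "t \<in> T" "b J \<le> m" for J m t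
  proof -
    have "m \<le> b (J + m)"
      using strict_mono_imp_increasing[OF b(1), of "J + m"] by simp
    from step[OF that this] have "\<bar>S m t - S (b J) t\<bar> \<le> sum a {J..<J + m}" .
    also have "\<dots> = sum a {..<J + m} - sum a {..<J}"
      by (simp add: lessThan_atLeast0 sum_diff_nat_ivl)
    also have "sum a {..<J + m} \<le> suminf a"
      using a by (intro sum_le_suminf) auto
    finally show ?thesis by simp
  qed
  show "\<bar>S m t\<bar> \<le> suminf a" if "t \<in> T" for m t
    using tail[OF that, of 0 m] b(2) S0[OF that] by simp
  show "uniformly_convergent_on T S"
  proof (intro Cauchy_uniformly_convergent uniformly_Cauchy_onI)
    fix e :: real assume e: "e > 0"
    have "(\<lambda>J. sum a {..<J}) \<longlonglongrightarrow> suminf a"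
      using a(1) by (rule summable_LIMSEQ)
    then have "\<forall>\<^sub>F J in sequentially. dist (sum a {..<J}) (suminf a) < e / 2"
      using e by (intro tendstoD) auto
    then obtain J where J: "\<bar>suminf a - sum a {..<J}\<bar> < e / 2"
      by (auto simp: eventually_sequentially dist_real_def abs_minus_commute)
    show "\<exists>M. \<forall>x\<in>T. \<forall>m\<ge>M. \<forall>n\<ge>M. dist (S m x) (S n x) < e"
    proof (intro exI[of _ "b J"] ballI allI impI)
      fix x m n assume "x \<in> T" "b J \<le> m" "b J \<le> n"
      then show "dist (S m x) (S n x) < e"
        using tail[of x J m] tail[of x J n] J unfolding dist_real_def by linarith
    qed
  qed
qed

text \<open>The effective dimension: up to this index the posterior variances are of order \<open>1 / n\<close>, beyond it they decay
  like \<open>i powr (- (2 * \<alpha> + 1))\<close>.\<close>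

definition cutoff :: "real \<Rightarrow> nat \<Rightarrow> nat" where
  "cutoff \<alpha> n = nat \<lceil>real n powr (1 / (2 * \<alpha> + 1))\<rceil>"

text \<open>The first block reaches up to the cutoff, the later ones double the index. Offsets count from \<open>0\<close> and belong to the
  coefficients \<open>Suc i\<close>.\<close>

definition block_start :: "real \<Rightarrow> nat \<Rightarrow> nat \<Rightarrow> nat" where
  "block_start \<alpha> n j = (case j of 0 \<Rightarrow> 0 | Suc k \<Rightarrow> cutoff \<alpha> n * 2 ^ k)"

lemma cutoff_bounds:
  assumes "\<alpha> > 0" "n \<ge> 1"
  shows "cutoff \<alpha> n \<ge> 1"
    and "real n powr (1 / (2 * \<alpha> + 1)) \<le> real (cutoff \<alpha> n)"
    and "real (cutoff \<alpha> n) / 2 \<le> real n powr (1 / (2 * \<alpha> + 1))"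
proof -
  define z where "z = real n powr (1 / (2 * \<alpha> + 1))"
  have z: "z \<ge> 1" using assms by (auto simp: z_def intro: ge_one_powr_ge_zero)
  have "real (cutoff \<alpha> n) = of_int \<lceil>z\<rceil>"
    using z unfolding cutoff_def z_def[symmetric] by (intro of_nat_nat) linarith
  then show "cutoff \<alpha> n \<ge> 1" "z \<le> real (cutoff \<alpha> n)" "real (cutoff \<alpha> n) / 2 \<le> z"
    using z by linarith+
qed

lemma strict_mono_block_start:
  assumes "\<alpha> > 0" "n \<ge> 1"
  shows "strict_mono (block_start \<alpha> n)"
  using cutoff_bounds(1)[OF assms]
  by (intro strict_mono_Suc_iff[THEN iffD2] allI) (auto simp: block_start_def split: nat.split)

lemma posterior_coeff_sd_pos: "n \<ge> 1 \<Longrightarrow> posterior_coeff_sd \<alpha> n i > 0"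
  by (auto simp: posterior_coeff_sd_def intro!: divide_pos_pos add_nonneg_pos)

lemma posterior_coeff_sd_block:
  assumes \<alpha>: "\<alpha> > 0" and n: "n \<ge> 1" and i: "block_start \<alpha> n j \<le> i"
  shows "posterior_coeff_sd \<alpha> n (Suc i) \<le> (real (cutoff \<alpha> n * 2 ^ j) / 2) powr - (\<alpha> + 1 / 2)"
proof -
  define d where "d = real (cutoff \<alpha> n * 2 ^ j) / 2"
  have d: "d > 0" using cutoff_bounds(1)[OF \<alpha> n] by (simp add: d_def)
  have "d powr (2 * \<alpha> + 1) \<le> real (Suc i) powr (2 * \<alpha> + 1) + real n"
  proof (cases j)
    case 0
    then have "d \<le> real n powr (1 / (2 * \<alpha> + 1))"
      using cutoff_bounds(3)[OF \<alpha> n] by (simp add: d_def)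
    then have "d powr (2 * \<alpha> + 1) \<le> (real n powr (1 / (2 * \<alpha> + 1))) powr (2 * \<alpha> + 1)"
      using d \<alpha> by (intro powr_mono2) auto
    also have "\<dots> = real n" using \<alpha> n by (simp add: powr_powr)
    finally show ?thesis by (simp add: add_increasing)
  next
    case (Suc k)
    then have "d = real (block_start \<alpha> n j)" by (simp add: d_def block_start_def)
    also have "\<dots> \<le> real (Suc i)" using i by simp
    finally have "d powr (2 * \<alpha> + 1) \<le> real (Suc i) powr (2 * \<alpha> + 1)"
      using d \<alpha> by (intro powr_mono2) auto
    then show ?thesis by simp
  qed
  then have "posterior_coeff_sd \<alpha> n (Suc i) \<le> 1 / sqrt (d powr (2 * \<alpha> + 1))"
    unfolding posterior_coeff_sd_def using d n
    by (intro divide_left_mono mult_pos_pos real_sqrt_le_mono) (auto intro!: add_nonneg_pos)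
  also have "sqrt (d powr (2 * \<alpha> + 1)) = d powr (\<alpha> + 1 / 2)"
    using d by (simp add: powr_half_sqrt[symmetric] powr_powr) (simp add: field_simps)
  also have "1 / d powr (\<alpha> + 1 / 2) = d powr - (\<alpha> + 1 / 2)"
    by (rule powr_minus_divide[symmetric])
  finally show ?thesis unfolding d_def .
qed

text \<open>Up to logarithms, a block of length \<open>D\<close> with standard deviations \<open>Q\<close> has a sup norm of order \<open>Q\<close> times
  the square root of \<open>D\<close>. For the first block this is the rate without its logarithm, and it then decays geometrically.\<close>

lemma block_sd_sqrt_length:
  assumes \<alpha>: "\<alpha> > 0" and n: "n \<ge> 1"
  shows "(real (cutoff \<alpha> n * 2 ^ j) / 2) powr - (\<alpha> + 1 / 2) * sqrt (real (cutoff \<alpha> n * 2 ^ j))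
    \<le> 2 powr (\<alpha> + 1 / 2) * real n powr (- \<alpha> / (2 * \<alpha> + 1)) * (2 powr - \<alpha>) ^ j"
proof -
  define N where "N = real (cutoff \<alpha> n)"
  have N: "N > 0" using cutoff_bounds(1)[OF \<alpha> n] by (simp add: N_def)
  have "(y / 2) powr - p * sqrt y = 2 powr p * (y powr - p * y powr (1 / 2))" if "y > 0" for y p :: real
    using that by (simp add: powr_divide powr_minus_divide powr_half_sqrt)
  from this[of "N * 2 ^ j" "\<alpha> + 1 / 2"] N
  have "(N * 2 ^ j / 2) powr - (\<alpha> + 1 / 2) * sqrt (N * 2 ^ j) =
      2 powr (\<alpha> + 1 / 2) * ((N * 2 ^ j) powr - (\<alpha> + 1 / 2) * (N * 2 ^ j) powr (1 / 2))"
    by simp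
  also have "\<dots> = 2 powr (\<alpha> + 1 / 2) * (N * 2 ^ j) powr - \<alpha>"
    by (simp flip: powr_add)
  also have "\<dots> = 2 powr (\<alpha> + 1 / 2) * N powr - \<alpha> * (2 powr - \<alpha>) ^ j"
    using N by (simp add: powr_mult powr_powr powr_realpow[symmetric] mult_ac)
  also have "N powr - \<alpha> \<le> (real n powr (1 / (2 * \<alpha> + 1))) powr - \<alpha>"
    using cutoff_bounds(2)[OF \<alpha> n] \<alpha> n unfolding N_def by (intro powr_mono2') auto
  finally show ?thesis by (simp add: N_def powr_powr)
qed

text \<open>The sum over \<open>j\<close> of \<open>7 * 2 powr (\<alpha> + 1 / 2) * (j + 1) * (2 powr - \<alpha>) ^ j\<close>, where \<open>7\<close> comes from
  \<open>gaussian_block_sup\<close> and \<open>j + 1\<close> from the thresholds chosen in \<open>gaussian_series_sup\<close>.\<close>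

definition sup_const :: "real \<Rightarrow> real" where
  "sup_const \<alpha> = 7 * 2 powr (\<alpha> + 1 / 2) / (1 - 2 powr - \<alpha>)\<^sup>2"

lemma sup_const_pos: "\<alpha> > 0 \<Longrightarrow> sup_const \<alpha> > 0"
  by (auto simp: sup_const_def powr_minus_divide intro!: divide_pos_pos)

lemma rate_nonneg: "n \<ge> 1 \<Longrightarrow> rate \<alpha> n \<ge> 0"
  by (simp add: rate_def)

text \<open>The bound for a single block is applied in block \<open>j\<close> with a threshold proportional to \<open>j + 1\<close>. That growth
  makes the failure probabilities summable although the number of events grows like \<open>8 ^ j\<close>, while the bounds of the blocks
  remain summable by geometric decay. Weights and standard deviations enter through their product only, so that one lemma covers
  the posterior and the noise in the posterior mean.\<close>

lemma gaussian_series_sup: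
  assumes \<alpha>: "\<alpha> > 0" and n: "n \<ge> 2" and x: "x \<ge> 4"
    and \<sigma>: "\<And>i. i \<ge> 1 \<Longrightarrow> \<sigma> i > 0"
    and w: "\<And>i. i \<ge> 1 \<Longrightarrow> \<bar>w i * \<sigma> i\<bar> \<le> posterior_coeff_sd \<alpha> n i"
  shows "\<exists>B\<in>sets (gaussian_sequence \<mu> \<sigma>).
     measure (gaussian_sequence \<mu> \<sigma>) B \<le> 160 * real n powr (3 - x\<^sup>2 / 2) \<and>
     (\<forall>\<theta>\<in>space (gaussian_sequence \<mu> \<sigma>) - B.
        uniformly_convergent_on {0..1} (partial_series (\<lambda>i. w i * (\<theta> i - \<mu> i))) \<and>
        (\<forall>m. \<forall>t\<in>{0..1}. \<bar>partial_series (\<lambda>i. w i * (\<theta> i - \<mu> i)) m t\<bar> \<le> sup_const \<alpha> * x * rate \<alpha> n))"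
proof -
  let ?G = "gaussian_sequence \<mu> \<sigma>"
  interpret prob_space ?G
    by (rule prob_space_gaussian_sequence[OF \<sigma>])
  have n1: "n \<ge> 1" using n by simp
  define D where "D j = cutoff \<alpha> n * 2 ^ j" for j
  define Q where "Q j = (real (D j) / 2) powr - (\<alpha> + 1 / 2)" for j
  define u where "u j = x * sqrt (ln (real n)) * real (Suc j)" for j
  define b where "b = block_start \<alpha> n"
  define a where "a j = 7 * 2 powr (\<alpha> + 1 / 2) * x * rate \<alpha> n * (real (Suc j) * (2 powr - \<alpha>) ^ j)" for j
  have D: "D j \<ge> 1" for j using cutoff_bounds(1)[OF \<alpha> n1] by (simp add: D_def)
  have b_Suc: "b (Suc j) = D j" for j by (simp add: b_def block_start_def D_def)
  have ln_n: "ln (real n) \<ge> ln 2" "ln (real n) > 0" using n by auto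
  have u: "u j \<ge> 0" for j using x ln_n by (simp add: u_def)
  have ex: "\<exists>B\<in>sets ?G. prob B \<le> 10 * real (D j) ^ 3 * exp (- (u j)\<^sup>2 / 2) \<and>
     (\<forall>\<theta>\<in>space ?G - B. \<forall>m\<in>{b j..b (Suc j)}. \<forall>t\<in>{0..1}.
        \<bar>\<Sum>i\<in>{b j..<m}. w (Suc i) * (\<theta> (Suc i) - \<mu> (Suc i)) * fourier_basis (Suc i) t\<bar>
          \<le> 7 * u j * Q j * sqrt (real (D j)))" for j
  proof (rule gaussian_block_sup[OF \<sigma>])
    fix i assume "i \<in> {b j..<b (Suc j)}"
    then show "\<bar>w (Suc i) * \<sigma> (Suc i)\<bar> \<le> Q j"
      using w[of "Suc i"] posterior_coeff_sd_block[OF \<alpha> n1, of j i] by (auto simp: Q_def D_def b_def)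
  qed (use D u in \<open>auto simp: Q_def b_Suc Suc_le_eq\<close>)
  define B where "B j = (SOME B. B \<in> sets ?G \<and> prob B \<le> 10 * real (D j) ^ 3 * exp (- (u j)\<^sup>2 / 2) \<and>
     (\<forall>\<theta>\<in>space ?G - B. \<forall>m\<in>{b j..b (Suc j)}. \<forall>t\<in>{0..1}.
        \<bar>\<Sum>i\<in>{b j..<m}. w (Suc i) * (\<theta> (Suc i) - \<mu> (Suc i)) * fourier_basis (Suc i) t\<bar>
          \<le> 7 * u j * Q j * sqrt (real (D j))))" for j
  note B' = someI_ex[OF ex[unfolded Bex_def], folded B_def]
  have B: "B j \<in> sets ?G" "prob (B j) \<le> 10 * real (D j) ^ 3 * exp (- (u j)\<^sup>2 / 2)" for j
    using B'[of j] by blast+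
  have B_sup: "\<bar>\<Sum>i\<in>{b j..<m}. w (Suc i) * (\<theta> (Suc i) - \<mu> (Suc i)) * fourier_basis (Suc i) t\<bar>
          \<le> 7 * u j * Q j * sqrt (real (D j))"
    if "\<theta> \<in> space ?G - B j" "m \<in> {b j..b (Suc j)}" "t \<in> {0..1}" for j \<theta> m t
    using B'[of j] that by blast
  have B_le: "prob (B j) \<le> 80 * real n powr (3 - x\<^sup>2 / 2) * (1 / 2) ^ j" for j
  proof -
    have "real (cutoff \<alpha> n) \<le> 2 * real n"
    proof -
      have "real n powr (1 / (2 * \<alpha> + 1)) \<le> real n powr 1"
        using n \<alpha> by (intro powr_mono) auto
      then show ?thesis using cutoff_bounds(3)[OF \<alpha> n1] by simp
    qed
    then have "real (cutoff \<alpha> n) ^ 3 \<le> (2 * real n) ^ 3"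
      by (intro power_mono) auto
    then have D3: "real (D j) ^ 3 \<le> 8 * real n ^ 3 * 8 ^ j"
    proof -
      have "((2 :: real) ^ j) ^ 3 = (2 ^ 3) ^ j"
        by (simp only: power_mult[symmetric] mult.commute)
      then have "real (D j) ^ 3 = real (cutoff \<alpha> n) ^ 3 * 8 ^ j"
        by (simp add: D_def power_mult_distrib)
      then show ?thesis
        using \<open>real (cutoff \<alpha> n) ^ 3 \<le> (2 * real n) ^ 3\<close> by (simp add: power_mult_distrib)
    qed
    \<comment> \<open>From \<open>x \<ge> 4\<close>: the exponential contains the factor \<open>(1 / 16) ^ j\<close>, which beats the \<open>8 ^ j\<close> of \<open>D3\<close>.\<close>
    have "x\<^sup>2 \<ge> 4\<^sup>2" using x by (intro power_mono) auto
    then have x2: "x\<^sup>2 / 2 \<ge> 4" by simp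
    have "x\<^sup>2 / 2 * ln (real n) + real j * (4 * ln 2) \<le> x\<^sup>2 / 2 * ln (real n) + real j * (x\<^sup>2 / 2 * ln (real n))"
      using x2 ln_n by (intro add_left_mono mult_left_mono mult_mono) auto
    also have "\<dots> = x\<^sup>2 / 2 * ln (real n) * real (Suc j)" by (simp add: algebra_simps)
    also have "\<dots> \<le> x\<^sup>2 / 2 * ln (real n) * (real (Suc j))\<^sup>2"
      using ln_n by (intro mult_left_mono) (auto simp: power2_eq_square)
    also have "\<dots> = (u j)\<^sup>2 / 2"
      using ln_n by (simp add: u_def power_mult_distrib)
    finally have "exp (- (u j)\<^sup>2 / 2) \<le> exp (- (x\<^sup>2 / 2) * ln (real n) + real j * (- 4 * ln 2))"
      by (subst exp_le_cancel_iff) linarith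
    also have "\<dots> = real n powr - (x\<^sup>2 / 2) * exp (- 4 * ln 2) ^ j"
      using n by (simp only: exp_add exp_of_nat_mult) (simp add: powr_def)
    also have "exp (- 4 * ln 2) = (1 / 16 :: real)"
      using exp_of_nat_mult[of 4 "ln (2 :: real)"] by (simp add: exp_minus inverse_eq_divide)
    finally have "exp (- (u j)\<^sup>2 / 2) \<le> real n powr - (x\<^sup>2 / 2) * (1 / 16) ^ j" .
    then have "10 * real (D j) ^ 3 * exp (- (u j)\<^sup>2 / 2) \<le>
        10 * (8 * real n ^ 3 * 8 ^ j) * (real n powr - (x\<^sup>2 / 2) * (1 / 16) ^ j)"
      using D3 by (intro mult_mono) auto
    also have "\<dots> = 80 * (real n ^ 3 * real n powr - (x\<^sup>2 / 2)) * (8 * (1 / 16)) ^ j"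
      unfolding power_mult_distrib by (simp only: mult_ac)
    also have "real n ^ 3 * real n powr - (x\<^sup>2 / 2) = real n powr (3 - x\<^sup>2 / 2)"
      using n powr_add[of "real n" 3 "- (x\<^sup>2 / 2)"] by simp
    also have "8 * (1 / 16) = (1 / 2 :: real)" by simp
    finally show ?thesis by (rule order_trans[OF B(2)])
  qed
  have geo: "(\<lambda>j. 80 * real n powr (3 - x\<^sup>2 / 2) * (1 / 2) ^ j) sums (80 * real n powr (3 - x\<^sup>2 / 2) * 2)"
    using geometric_sums[of "1 / 2 :: real"] by (intro sums_mult) auto
  have B_summable: "summable (\<lambda>j. prob (B j))"
    by (rule summable_comparison_test'[OF sums_summable[OF geo]]) (use B_le in auto)
  have "prob (\<Union>j. B j) \<le> (\<Sum>j. prob (B j))"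
    using B(1) B_summable by (intro finite_measure_subadditive_countably) auto
  also have "\<dots> \<le> 80 * real n powr (3 - x\<^sup>2 / 2) * 2"
    using suminf_le[OF B_le B_summable sums_summable[OF geo]] sums_unique[OF geo] by simp
  finally have "prob (\<Union>j. B j) \<le> 160 * real n powr (3 - x\<^sup>2 / 2)" by simp
  moreover
  have a_sums: "a sums (sup_const \<alpha> * x * rate \<alpha> n)"
  proof -
    have "norm (2 powr - \<alpha>) < (1 :: real)" using \<alpha> by (simp add: powr_minus_divide)
    from sums_mult[OF geometric_deriv_sums[OF this], of "7 * 2 powr (\<alpha> + 1 / 2) * x * rate \<alpha> n"] show ?thesis
      by (simp add: a_def[abs_def] sup_const_def mult_ac)
  qed
  have a_nonneg: "a j \<ge> 0" for j
    using x rate_nonneg[OF n1] by (simp add: a_def)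
  have a_ge: "7 * u j * Q j * sqrt (real (D j)) \<le> a j" for j
  proof -
    have "7 * u j * (Q j * sqrt (real (D j))) \<le>
        7 * u j * (2 powr (\<alpha> + 1 / 2) * real n powr (- \<alpha> / (2 * \<alpha> + 1)) * (2 powr - \<alpha>) ^ j)"
      using u unfolding Q_def D_def by (intro mult_left_mono block_sd_sqrt_length[OF \<alpha> n1]) auto
    then show ?thesis by (simp add: a_def u_def rate_def mult_ac)
  qed
  have "uniformly_convergent_on {0..1} (partial_series (\<lambda>i. w i * (\<theta> i - \<mu> i)))" (is "?conv \<theta>")
     "\<forall>m. \<forall>t\<in>{0..1}. \<bar>partial_series (\<lambda>i. w i * (\<theta> i - \<mu> i)) m t\<bar> \<le> sup_const \<alpha> * x * rate \<alpha> n" (is "?bound \<theta>")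
    if \<theta>: "\<theta> \<in> space ?G - (\<Union>j. B j)" for \<theta>
  proof -
    let ?S = "partial_series (\<lambda>i. w i * (\<theta> i - \<mu> i))"
    have block: "\<bar>?S m t - ?S (b j) t\<bar> \<le> a j" if "b j \<le> m" "m \<le> b (Suc j)" "t \<in> {0..1}" for j m t
    proof -
      have "?S m t - ?S (b j) t = (\<Sum>i\<in>{b j..<m}. w (Suc i) * (\<theta> (Suc i) - \<mu> (Suc i)) * fourier_basis (Suc i) t)"
        unfolding partial_series_def using that by (simp add: lessThan_atLeast0 sum_diff_nat_ivl)
      then show ?thesis
        using B_sup[of \<theta> j m t] \<theta> that a_ge[of j] by fastforce
    qed
    have S0: "?S 0 t = 0" for t by (simp add: partial_series_def)
    note conv = blockwise_uniform_convergence[of b a "{0..1}" ?S, OF strict_mono_block_start[OF \<alpha> n1, folded b_def] _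
        sums_summable[OF a_sums] a_nonneg S0 block]
    show "?conv \<theta>" using conv(1) by (simp add: b_def block_start_def)
    show "?bound \<theta>" using conv(2) sums_unique[OF a_sums] by (simp add: b_def block_start_def)
  qed
  ultimately show ?thesis
    using B(1) by (intro bexI[of _ "\<Union>j. B j"]) auto
qed

section \<open>Lower bounds by the second moment method\<close>

text \<open>Chebyshev's inequality for the average \<open>X\<close> of \<open>Y \<theta>\<close> over \<open>U\<close>, which has mean one and variance at
  most \<open>v\<close>; if \<open>X\<close> is at least \<open>1 / 2\<close>, then so is \<open>Y \<theta> t\<close> for some \<open>t\<close>.\<close>

lemma second_moment_existence:
  fixes Y :: "'a \<Rightarrow> 'b \<Rightarrow> real"
  assumes P: "prob_space P" and U: "prob_space U"
    and Y [measurable]: "(\<lambda>(\<theta>, t). Y \<theta> t) \<in> borel_measurable (P \<Otimes>\<^sub>M U)"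
    and Y_nonneg: "\<And>\<theta> t. Y \<theta> t \<ge> 0"
    and first: "\<And>t. t \<in> space U \<Longrightarrow> (\<integral>\<^sup>+\<theta>. ennreal (Y \<theta> t) \<partial>P) = 1"
    and second: "(\<integral>\<^sup>+t. \<integral>\<^sup>+t'. (\<integral>\<^sup>+\<theta>. ennreal (Y \<theta> t * Y \<theta> t') \<partial>P) \<partial>U \<partial>U) \<le> ennreal (1 + v)"
    and v: "v \<ge> 0"
  shows "\<exists>B\<in>sets P. measure P B \<le> 4 * v \<and> (\<forall>\<theta>\<in>space P - B. \<exists>t\<in>space U. Y \<theta> t \<ge> 1 / 2)"
proof -
  interpret P: prob_space P by fact
  interpret U: prob_space U by fact
  interpret PU: pair_sigma_finite P U ..
  define X where "X \<theta> = (\<integral>\<^sup>+t. ennreal (Y \<theta> t) \<partial>U)" for \<theta>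
  define x where "x \<theta> = enn2real (X \<theta>)" for \<theta>
  have X_meas [measurable]: "X \<in> borel_measurable P"
    unfolding X_def by measurable
  have x_meas [measurable]: "x \<in> borel_measurable P"
    unfolding x_def by measurable
  have X1: "(\<integral>\<^sup>+\<theta>. X \<theta> \<partial>P) = 1"
  proof -
    have "(\<integral>\<^sup>+\<theta>. X \<theta> \<partial>P) = (\<integral>\<^sup>+t. \<integral>\<^sup>+\<theta>. ennreal (Y \<theta> t) \<partial>P \<partial>U)"
      unfolding X_def by (rule PU.Fubini'[symmetric]) measurable
    also have "\<dots> = (\<integral>\<^sup>+t. 1 \<partial>U)"
      by (intro nn_integral_cong first)
    finally show ?thesis by (simp add: U.emeasure_space_1)
  qed
  have X2: "(\<integral>\<^sup>+\<theta>. X \<theta> * X \<theta> \<partial>P) \<le> ennreal (1 + v)"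
  proof -
    have "(\<integral>\<^sup>+\<theta>. X \<theta> * X \<theta> \<partial>P) = (\<integral>\<^sup>+\<theta>. (\<integral>\<^sup>+t. \<integral>\<^sup>+t'. ennreal (Y \<theta> t * Y \<theta> t') \<partial>U \<partial>U) \<partial>P)"
    proof (intro nn_integral_cong)
      fix \<theta> assume [measurable]: "\<theta> \<in> space P"
      have [measurable]: "Y \<theta> \<in> borel_measurable U"
        using measurable_compose_Pair1[OF \<open>\<theta> \<in> space P\<close> Y] by simp
      have "X \<theta> * X \<theta> = (\<integral>\<^sup>+t. ennreal (Y \<theta> t) * X \<theta> \<partial>U)"
        unfolding X_def by (rule nn_integral_multc[symmetric]) measurable
      also have "\<dots> = (\<integral>\<^sup>+t. \<integral>\<^sup>+t'. ennreal (Y \<theta> t) * ennreal (Y \<theta> t') \<partial>U \<partial>U)"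
        unfolding X_def by (intro nn_integral_cong nn_integral_cmult[symmetric]) measurable
      finally show "X \<theta> * X \<theta> = (\<integral>\<^sup>+t. \<integral>\<^sup>+t'. ennreal (Y \<theta> t * Y \<theta> t') \<partial>U \<partial>U)"
        by (simp add: ennreal_mult Y_nonneg)
    qed
    also have "\<dots> = (\<integral>\<^sup>+t. \<integral>\<^sup>+\<theta>. (\<integral>\<^sup>+t'. ennreal (Y \<theta> t * Y \<theta> t') \<partial>U) \<partial>P \<partial>U)"
      by (rule PU.Fubini'[symmetric]) measurable
    also have "\<dots> = (\<integral>\<^sup>+t. \<integral>\<^sup>+t'. (\<integral>\<^sup>+\<theta>. ennreal (Y \<theta> t * Y \<theta> t') \<partial>P) \<partial>U \<partial>U)"
    proof (intro nn_integral_cong)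
      fix t assume [measurable]: "t \<in> space U"
      have "(\<lambda>\<theta>. (\<lambda>(\<theta>, t). Y \<theta> t) (\<theta>, t)) \<in> borel_measurable P"
        using Y by measurable
      then have [measurable]: "(\<lambda>\<theta>. Y \<theta> t) \<in> borel_measurable P" by simp
      show "(\<integral>\<^sup>+\<theta>. (\<integral>\<^sup>+t'. ennreal (Y \<theta> t * Y \<theta> t') \<partial>U) \<partial>P) = (\<integral>\<^sup>+t'. (\<integral>\<^sup>+\<theta>. ennreal (Y \<theta> t * Y \<theta> t') \<partial>P) \<partial>U)"
        by (rule PU.Fubini'[symmetric]) measurable
    qed
    finally show ?thesis using second by simp
  qed
  have X_fin: "AE \<theta> in P. ennreal (x \<theta>) = X \<theta>"
  proof -
    have "AE \<theta> in P. X \<theta> \<noteq> \<infinity>"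
      using X1 by (intro nn_integral_noteq_infinite) auto
    then show ?thesis
      by eventually_elim (simp add: x_def ennreal_enn2real top.not_eq_extremum)
  qed
  have x_nonneg: "x \<theta> \<ge> 0" for \<theta> by (simp add: x_def)
  have "(\<integral>\<^sup>+\<theta>. ennreal (x \<theta>) \<partial>P) = 1"
    using nn_integral_cong_AE[OF X_fin] X1 by simp
  then have E1: "P.expectation x = 1"
    by (intro integral_eq_nn_integral[THEN trans]) (auto simp: x_nonneg)
  have "(\<integral>\<^sup>+\<theta>. ennreal ((x \<theta>)\<^sup>2) \<partial>P) = (\<integral>\<^sup>+\<theta>. X \<theta> * X \<theta> \<partial>P)"
  proof (rule nn_integral_cong_AE)
    show "AE \<theta> in P. ennreal ((x \<theta>)\<^sup>2) = X \<theta> * X \<theta>"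
      using X_fin by eventually_elim (metis power2_eq_square ennreal_mult x_nonneg)
  qed
  then have x2: "(\<integral>\<^sup>+\<theta>. ennreal ((x \<theta>)\<^sup>2) \<partial>P) \<le> ennreal (1 + v)"
    using X2 by simp
  have int2: "integrable P (\<lambda>\<theta>. (x \<theta>)\<^sup>2)"
    by (rule integrableI_nonneg) (use x2 in \<open>auto intro: le_less_trans\<close>)
  have E2: "P.expectation (\<lambda>\<theta>. (x \<theta>)\<^sup>2) \<le> 1 + v"
    using x2 v by (subst integral_eq_nn_integral) (auto intro!: enn2real_leI)
  have int1: "integrable P x"
    by (rule P.square_integrable_imp_integrable[OF x_meas int2])
  define B where "B = {\<theta> \<in> space P. 1 / 2 \<le> \<bar>x \<theta> - P.expectation x\<bar>}"
  have "P.prob B \<le> P.variance x / (1 / 2)\<^sup>2"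
    unfolding B_def by (rule P.Chebyshev_inequality[OF x_meas int2]) simp
  also have "P.variance x = P.expectation (\<lambda>\<theta>. (x \<theta>)\<^sup>2) - 1"
    using P.variance_eq[OF int1 int2] E1 by simp
  also have "(P.expectation (\<lambda>\<theta>. (x \<theta>)\<^sup>2) - 1) / (1 / 2)\<^sup>2 \<le> 4 * v"
    using E2 by (simp add: power2_eq_square)
  finally have "P.prob B \<le> 4 * v" .
  moreover have "\<exists>t\<in>space U. Y \<theta> t \<ge> 1 / 2" if "\<theta> \<in> space P - B" for \<theta>
  proof (rule ccontr)
    assume "\<not> ?thesis"
    then have "X \<theta> \<le> (\<integral>\<^sup>+t. ennreal (1 / 2) \<partial>U)"
      unfolding X_def by (intro nn_integral_mono ennreal_leI) (auto simp: not_le less_imp_le)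
    then have "X \<theta> \<le> ennreal (1 / 2)" by (simp add: U.emeasure_space_1)
    then have "x \<theta> \<le> 1 / 2" unfolding x_def by (intro enn2real_leI) auto
    then show False using that by (auto simp: B_def E1)
  qed
  moreover have "B \<in> sets P" unfolding B_def by measurable
  ultimately show ?thesis by blast
qed

lemma exp_le_one_plus: "exp x \<le> 1 + \<bar>x\<bar> * exp \<bar>x\<bar>" for x :: real
proof (cases "x \<le> 0")
  case False
  have "1 - x \<le> exp (- x)" using exp_ge_add_one_self[of "- x"] by simp
  then have "(1 - x) * exp x \<le> exp (- x) * exp x" by (intro mult_right_mono) auto
  then show ?thesis using False by (simp add: exp_add[symmetric] algebra_simps)
next
  case True
  then show ?thesis
    using order_trans[of "exp x" 1 "1 + \<bar>x\<bar> * exp \<bar>x\<bar>"] by (simp add: mult_nonpos_nonneg)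
qed

lemma set_integral_sum:
  fixes f :: "'i \<Rightarrow> 'a \<Rightarrow> real"
  assumes "\<And>i. i \<in> I \<Longrightarrow> set_integrable M A (f i)"
  shows "(LINT x:A|M. (\<Sum>i\<in>I. f i x)) = (\<Sum>i\<in>I. LINT x:A|M. f i x)"
  using assms unfolding set_lebesgue_integral_def set_integrable_def
  by (simp add: sum_distrib_left)

lemma kernel_square_integral:
  fixes d :: "nat \<Rightarrow> real"
  shows "(LINT t:{0..1}|lborel. (\<Sum>i<m. d i * fourier_basis (Suc i) t)\<^sup>2) = (\<Sum>i<m. (d i)\<^sup>2)"
proof -
  have "(LINT t:{0..1}|lborel. (\<Sum>i<m. d i * fourier_basis (Suc i) t)\<^sup>2) =
     (LINT t:{0..1}|lborel. (\<Sum>i<m. \<Sum>j<m. (d i * d j) * (fourier_basis (Suc i) t * fourier_basis (Suc j) t)))"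
    by (simp add: power2_eq_square sum_product mult_ac)
  also have "\<dots> = (\<Sum>i<m. LINT t:{0..1}|lborel. (\<Sum>j<m. (d i * d j) * (fourier_basis (Suc i) t * fourier_basis (Suc j) t)))"
    by (intro set_integral_sum set_integrable_unit_interval continuous_intros continuous_fourier_basis)
  also have "\<dots> = (\<Sum>i<m. \<Sum>j<m. LINT t:{0..1}|lborel. (d i * d j) * (fourier_basis (Suc i) t * fourier_basis (Suc j) t))"
    by (intro sum.cong set_integral_sum set_integrable_unit_interval continuous_intros continuous_fourier_basis refl)
  also have "\<dots> = (\<Sum>i<m. \<Sum>j<m. (d i * d j) * (if i = j then 1 else 0))"
    by (intro sum.cong refl) (simp add: fourier_basis_orthonormal)
  also have "\<dots> = (\<Sum>i<m. (d i)\<^sup>2)"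
    by (simp add: power2_eq_square if_distrib cong: if_cong)
  finally show ?thesis .
qed

text \<open>The second moment argument is applied to \<open>Y \<theta> t = exp (z * X t - z\<^sup>2 * K t t / 2)\<close>, where \<open>X t\<close> is the
  partial sum and \<open>K\<close> its covariance kernel. Then \<open>Y \<theta> t\<close> and \<open>Y \<theta> t'\<close> have the mixed moment \<open>exp (z\<^sup>2 * K t t')\<close>,
  whose average exceeds one by at most \<open>z\<^sup>2 * exp (2 * z\<^sup>2 * S)\<close> times the average of \<open>\<bar>K\<bar>\<close>, with the variance bound \<open>S\<close> of the statement. That average is bounded through
  Parseval's identity, which turns the integral of \<open>K\<^sup>2\<close> into the sum of the fourth powers of the standard deviations. When many
  standard deviations are of similar size, this is much smaller than the variance \<open>K t t\<close>: values of the series at distant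
  points are almost uncorrelated.\<close>

lemma gaussian_series_large_values:
  assumes \<sigma>: "\<And>i. i \<ge> 1 \<Longrightarrow> \<sigma> i > 0"
    and S: "(\<Sum>i<m. (\<sigma> (Suc i))\<^sup>2) \<le> S" and \<eta>: "\<eta> > 0" "(\<Sum>i<m. ((\<sigma> (Suc i))\<^sup>2)\<^sup>2) \<le> \<eta>\<^sup>2"
  shows "\<exists>B\<in>sets (gaussian_sequence \<mu> \<sigma>).
     measure (gaussian_sequence \<mu> \<sigma>) B \<le> 4 * (z\<^sup>2 * exp (2 * z\<^sup>2 * S) * \<eta>) \<and>
     (\<forall>\<theta>\<in>space (gaussian_sequence \<mu> \<sigma>) - B. \<exists>t\<in>{0..1}.
        z * partial_series (\<lambda>i. \<theta> i - \<mu> i) m t \<ge>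
          z\<^sup>2 / 2 * (\<Sum>i<m. (\<sigma> (Suc i) * fourier_basis (Suc i) t)\<^sup>2) - ln 2)"
proof -
  let ?G = "gaussian_sequence \<mu> \<sigma>"
  define U where "U = restrict_space lborel {0..1::real}"
  define K where "K t t' = (\<Sum>i<m. ((\<sigma> (Suc i))\<^sup>2 * fourier_basis (Suc i) t) * fourier_basis (Suc i) t')" for t t'
  define Y where "Y \<theta> t = exp (z * (\<Sum>i<m. (\<theta> (Suc i) - \<mu> (Suc i)) * fourier_basis (Suc i) t) - z\<^sup>2 * K t t / 2)" for \<theta> t
  define \<kappa> where "\<kappa> = z\<^sup>2 * exp (2 * z\<^sup>2 * S)"
  have \<kappa>: "\<kappa> \<ge> 0" by (simp add: \<kappa>_def)
  have space_U: "space U = {0..1}" by (simp add: U_def space_restrict_space)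
  have U: "prob_space U"
    by (intro prob_spaceI) (simp add: U_def emeasure_restrict_space space_restrict_space)
  have P: "prob_space ?G"
    by (rule prob_space_gaussian_sequence[OF \<sigma>])
  have [measurable]: "fourier_basis i \<in> borel_measurable U" for i
    unfolding U_def by (intro measurable_restrict_space1) simp
  have coord [measurable]: "(\<lambda>x. fst x (Suc i)) \<in> borel_measurable (?G \<Otimes>\<^sub>M U)" for i
    by (rule measurable_compose[OF measurable_fst measurable_gaussian_coordinate])
  have U_integral: "(\<integral>\<^sup>+t. ennreal (f t) \<partial>U) = ennreal (LINT t:{0..1}|lborel. f t)"
    if "continuous_on {0..1} f" "\<And>t. f t \<ge> 0" for f :: "real \<Rightarrow> real"
  proof -
    have "(\<integral>\<^sup>+t. ennreal (f t) \<partial>U) = (\<integral>\<^sup>+t. ennreal (indicator {0..1} t *\<^sub>R f t) \<partial>lborel)"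
      unfolding U_def by (subst nn_integral_restrict_space) (auto intro!: nn_integral_cong split: split_indicator)
    also have "\<dots> = ennreal (LINT t:{0..1}|lborel. f t)"
      unfolding set_lebesgue_integral_def
      using set_integrable_unit_interval[OF that(1)] that(2)
      by (intro nn_integral_eq_integral) (auto simp: set_integrable_def)
    finally show ?thesis .
  qed
  have K_le: "\<bar>K t t'\<bar> \<le> 2 * S" for t t'
  proof -
    have "\<bar>K t t'\<bar> \<le> (\<Sum>i<m. (\<sigma> (Suc i))\<^sup>2 * (\<bar>fourier_basis (Suc i) t\<bar> * \<bar>fourier_basis (Suc i) t'\<bar>))"
      unfolding K_def by (rule order_trans[OF sum_abs]) (simp add: abs_mult mult_ac)
    also have "\<dots> \<le> (\<Sum>i<m. (\<sigma> (Suc i))\<^sup>2 * (sqrt 2 * sqrt 2))"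
      by (intro sum_mono mult_left_mono mult_mono abs_fourier_basis_le) auto
    also have "\<dots> \<le> 2 * S" using S by (simp add: sum_distrib_right[symmetric])
    finally show ?thesis .
  qed
  have exp_K: "exp (z\<^sup>2 * K t t') \<le> 1 + \<kappa> * \<eta> / 2 + \<kappa> / (2 * \<eta>) * (K t t')\<^sup>2" for t t'
  proof -
    have "exp (z\<^sup>2 * K t t') \<le> 1 + \<bar>z\<^sup>2 * K t t'\<bar> * exp \<bar>z\<^sup>2 * K t t'\<bar>"
      by (rule exp_le_one_plus)
    also have "\<bar>z\<^sup>2 * K t t'\<bar> * exp \<bar>z\<^sup>2 * K t t'\<bar> \<le> (z\<^sup>2 * \<bar>K t t'\<bar>) * exp (2 * z\<^sup>2 * S)"
      using mult_left_mono[OF K_le, of "z\<^sup>2"] by (intro mult_mono) (auto simp: abs_mult mult_ac)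
    also have "\<dots> = \<kappa> * \<bar>K t t'\<bar>" by (simp add: \<kappa>_def)
    \<comment> \<open>Weighted AM-GM replaces \<open>\<bar>K\<bar>\<close> by its square, for which Parseval's identity is available.\<close>
    also have "\<dots> \<le> \<kappa> * ((\<eta> + (K t t')\<^sup>2 / \<eta>) / 2)"
    proof (intro mult_left_mono \<kappa>)
      have "0 \<le> (\<eta> - \<bar>K t t'\<bar>)\<^sup>2 / \<eta>" using \<eta> by simp
      also have "\<dots> = \<eta> + (K t t')\<^sup>2 / \<eta> - 2 * \<bar>K t t'\<bar>"
        using \<eta> by (simp add: power2_diff field_simps power2_eq_square)
      finally show "\<bar>K t t'\<bar> \<le> (\<eta> + (K t t')\<^sup>2 / \<eta>) / 2" by simp
    qed
    finally show ?thesis using \<eta> by (simp add: field_simps)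
  qed
  have lin: "z * (\<Sum>i<m. (\<theta> (Suc i) - \<mu> (Suc i)) * fourier_basis (Suc i) t) =
      (\<Sum>i\<in>{0..<m}. (z * fourier_basis (Suc i) t) * (\<theta> (Suc i) - \<mu> (Suc i)))" for \<theta> :: "nat \<Rightarrow> real" and t
    by (simp add: sum_distrib_left mult_ac lessThan_atLeast0)
  have first: "(\<integral>\<^sup>+\<theta>. ennreal (Y \<theta> t) \<partial>?G) = 1" for t
  proof -
    have "(\<integral>\<^sup>+\<theta>. ennreal (Y \<theta> t) \<partial>?G) =
       (\<integral>\<^sup>+\<theta>. ennreal (exp (- (z\<^sup>2 * K t t / 2))) *
          ennreal (exp (\<Sum>i\<in>{0..<m}. (z * fourier_basis (Suc i) t) * (\<theta> (Suc i) - \<mu> (Suc i)))) \<partial>?G)"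
      unfolding Y_def lin by (simp add: ennreal_mult[symmetric] exp_add[symmetric])
    also have "\<dots> = ennreal (exp (- (z\<^sup>2 * K t t / 2))) * ennreal (exp ((\<Sum>i\<in>{0..<m}. (z * fourier_basis (Suc i) t * \<sigma> (Suc i))\<^sup>2) / 2))"
      by (subst nn_integral_cmult, measurable) (rule arg_cong2[where f = "(*)", OF refl nn_integral_exp_gaussian_sum[OF \<sigma>]])
    also have "(\<Sum>i\<in>{0..<m}. (z * fourier_basis (Suc i) t * \<sigma> (Suc i))\<^sup>2) = z\<^sup>2 * K t t"
      unfolding K_def by (simp add: sum_distrib_left power_mult_distrib power2_eq_square mult_ac lessThan_atLeast0)
    finally show ?thesis by (simp add: ennreal_mult[symmetric] exp_add[symmetric])
  qed
  have second: "(\<integral>\<^sup>+\<theta>. ennreal (Y \<theta> t * Y \<theta> t') \<partial>?G) = ennreal (exp (z\<^sup>2 * K t t'))" for t t'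
  proof -
    define e where "e = - (z\<^sup>2 * K t t / 2) - (z\<^sup>2 * K t' t' / 2)"
    have YY: "Y \<theta> t * Y \<theta> t' = exp e * exp (\<Sum>i\<in>{0..<m}. (z * (fourier_basis (Suc i) t + fourier_basis (Suc i) t')) * (\<theta> (Suc i) - \<mu> (Suc i)))" for \<theta>
      unfolding Y_def lin e_def exp_add[symmetric] by (simp add: sum.distrib sum_subtractf ring_distribs)
    have "(\<integral>\<^sup>+\<theta>. ennreal (Y \<theta> t * Y \<theta> t') \<partial>?G) =
       (\<integral>\<^sup>+\<theta>. ennreal (exp e) * ennreal (exp (\<Sum>i\<in>{0..<m}. (z * (fourier_basis (Suc i) t + fourier_basis (Suc i) t')) * (\<theta> (Suc i) - \<mu> (Suc i)))) \<partial>?G)"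
      unfolding YY by (simp add: ennreal_mult)
    also have "\<dots> = ennreal (exp e) * ennreal (exp ((\<Sum>i\<in>{0..<m}. (z * (fourier_basis (Suc i) t + fourier_basis (Suc i) t') * \<sigma> (Suc i))\<^sup>2) / 2))"
      by (subst nn_integral_cmult, measurable) (rule arg_cong2[where f = "(*)", OF refl nn_integral_exp_gaussian_sum[OF \<sigma>]])
    also have "(\<Sum>i\<in>{0..<m}. (z * (fourier_basis (Suc i) t + fourier_basis (Suc i) t') * \<sigma> (Suc i))\<^sup>2) =
        z\<^sup>2 * (K t t + K t' t' + 2 * K t t')"
      unfolding K_def lessThan_atLeast0 sum_distrib_left sum.distrib[symmetric]
      by (intro sum.cong refl) (simp add: power2_eq_square algebra_simps)
    finally show ?thesis
      by (simp add: ennreal_mult[symmetric] exp_add[symmetric] e_def algebra_simps add_divide_distrib)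
  qed
  have cont: "continuous_on {0..1} (\<lambda>t'. K t t')" for t
    unfolding K_def by (intro continuous_intros continuous_fourier_basis)
  have inner: "(LINT t':{0..1}|lborel. (K t t')\<^sup>2) = (\<Sum>i<m. ((\<sigma> (Suc i))\<^sup>2 * fourier_basis (Suc i) t)\<^sup>2)" for t
    unfolding K_def by (rule kernel_square_integral)
  have affine: "(LINT t:{0..1}|lborel. a + c * f t) = a + c * (LINT t:{0..1}|lborel. f t)"
    if "continuous_on {0..1} f" for a c and f :: "real \<Rightarrow> real"
  proof -
    have "(LINT t:{0..1}|lborel. a + c * f t) = (LINT t:{0..1::real}|lborel. a) + (LINT t:{0..1}|lborel. c * f t)"
      by (subst set_integral_add(2)) (auto intro!: set_integrable_unit_interval continuous_intros that)
    then show ?thesis by (simp add: set_lebesgue_integral_def)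
  qed
  have "(\<integral>\<^sup>+t. \<integral>\<^sup>+t'. (\<integral>\<^sup>+\<theta>. ennreal (Y \<theta> t * Y \<theta> t') \<partial>?G) \<partial>U \<partial>U) \<le>
     (\<integral>\<^sup>+t. \<integral>\<^sup>+t'. ennreal (1 + \<kappa> * \<eta> / 2 + \<kappa> / (2 * \<eta>) * (K t t')\<^sup>2) \<partial>U \<partial>U)"
    unfolding second by (intro nn_integral_mono ennreal_leI exp_K)
  also have "\<dots> = (\<integral>\<^sup>+t. ennreal (1 + \<kappa> * \<eta> / 2 + \<kappa> / (2 * \<eta>) * (\<Sum>i<m. ((\<sigma> (Suc i))\<^sup>2 * fourier_basis (Suc i) t)\<^sup>2)) \<partial>U)"
  proof (intro nn_integral_cong)
    fix t
    have "(\<integral>\<^sup>+t'. ennreal (1 + \<kappa> * \<eta> / 2 + \<kappa> / (2 * \<eta>) * (K t t')\<^sup>2) \<partial>U) =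
      ennreal (LINT t':{0..1}|lborel. 1 + \<kappa> * \<eta> / 2 + \<kappa> / (2 * \<eta>) * (K t t')\<^sup>2)"
      using \<kappa> \<eta> by (intro U_integral continuous_intros cont) auto
    also have "(LINT t':{0..1}|lborel. 1 + \<kappa> * \<eta> / 2 + \<kappa> / (2 * \<eta>) * (K t t')\<^sup>2) =
       1 + \<kappa> * \<eta> / 2 + \<kappa> / (2 * \<eta>) * (\<Sum>i<m. ((\<sigma> (Suc i))\<^sup>2 * fourier_basis (Suc i) t)\<^sup>2)"
      by (subst affine) (simp_all only: inner, intro continuous_intros cont)
    finally show "(\<integral>\<^sup>+t'. ennreal (1 + \<kappa> * \<eta> / 2 + \<kappa> / (2 * \<eta>) * (K t t')\<^sup>2) \<partial>U) =
      ennreal (1 + \<kappa> * \<eta> / 2 + \<kappa> / (2 * \<eta>) * (\<Sum>i<m. ((\<sigma> (Suc i))\<^sup>2 * fourier_basis (Suc i) t)\<^sup>2))" .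
  qed
  also have "\<dots> = ennreal (LINT t:{0..1}|lborel. 1 + \<kappa> * \<eta> / 2 + \<kappa> / (2 * \<eta>) * (\<Sum>i<m. ((\<sigma> (Suc i))\<^sup>2 * fourier_basis (Suc i) t)\<^sup>2))"
    using \<kappa> \<eta> by (intro U_integral continuous_intros continuous_fourier_basis) (auto intro!: add_nonneg_nonneg sum_nonneg mult_nonneg_nonneg divide_nonneg_nonneg)
  also have "(LINT t:{0..1}|lborel. 1 + \<kappa> * \<eta> / 2 + \<kappa> / (2 * \<eta>) * (\<Sum>i<m. ((\<sigma> (Suc i))\<^sup>2 * fourier_basis (Suc i) t)\<^sup>2)) =
     1 + \<kappa> * \<eta> / 2 + \<kappa> / (2 * \<eta>) * (LINT t:{0..1}|lborel. (\<Sum>i<m. ((\<sigma> (Suc i))\<^sup>2 * fourier_basis (Suc i) t)\<^sup>2))"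
    by (intro affine continuous_intros continuous_fourier_basis)
  also have "(LINT t:{0..1}|lborel. (\<Sum>i<m. ((\<sigma> (Suc i))\<^sup>2 * fourier_basis (Suc i) t)\<^sup>2)) =
     (\<Sum>i<m. LINT t:{0..1}|lborel. ((\<sigma> (Suc i))\<^sup>2 * fourier_basis (Suc i) t)\<^sup>2)"
    by (intro set_integral_sum set_integrable_unit_interval continuous_intros continuous_fourier_basis)
  also have "\<dots> = (\<Sum>i<m. ((\<sigma> (Suc i))\<^sup>2)\<^sup>2)"
  proof (intro sum.cong refl)
    fix i
    have "(LINT t:{0..1}|lborel. ((\<sigma> (Suc i))\<^sup>2 * fourier_basis (Suc i) t)\<^sup>2) =
       (LINT t:{0..1}|lborel. ((\<sigma> (Suc i))\<^sup>2)\<^sup>2 * (fourier_basis (Suc i) t * fourier_basis (Suc i) t))"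
      by (simp add: power2_eq_square mult_ac)
    then show "(LINT t:{0..1}|lborel. ((\<sigma> (Suc i))\<^sup>2 * fourier_basis (Suc i) t)\<^sup>2) = ((\<sigma> (Suc i))\<^sup>2)\<^sup>2"
      by (simp add: fourier_basis_orthonormal)
  qed
  also have "ennreal (1 + \<kappa> * \<eta> / 2 + \<kappa> / (2 * \<eta>) * (\<Sum>i<m. ((\<sigma> (Suc i))\<^sup>2)\<^sup>2)) \<le> ennreal (1 + \<kappa> * \<eta>)"
  proof (rule ennreal_leI)
    have "\<kappa> / (2 * \<eta>) * (\<Sum>i<m. ((\<sigma> (Suc i))\<^sup>2)\<^sup>2) \<le> \<kappa> / (2 * \<eta>) * \<eta>\<^sup>2"
      using \<kappa> \<eta> by (intro mult_left_mono) auto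
    also have "\<dots> = \<kappa> * \<eta> / 2" using \<eta> by (simp add: power2_eq_square)
    finally show "1 + \<kappa> * \<eta> / 2 + \<kappa> / (2 * \<eta>) * (\<Sum>i<m. ((\<sigma> (Suc i))\<^sup>2)\<^sup>2) \<le> 1 + \<kappa> * \<eta>" by simp
  qed
  finally have int2: "(\<integral>\<^sup>+t. \<integral>\<^sup>+t'. (\<integral>\<^sup>+\<theta>. ennreal (Y \<theta> t * Y \<theta> t') \<partial>?G) \<partial>U \<partial>U) \<le> ennreal (1 + \<kappa> * \<eta>)" .
  have Y_meas: "(\<lambda>(\<theta>, t). Y \<theta> t) \<in> borel_measurable (?G \<Otimes>\<^sub>M U)"
    unfolding Y_def K_def case_prod_beta by measurable
  have "\<exists>B\<in>sets ?G. measure ?G B \<le> 4 * (\<kappa> * \<eta>) \<and> (\<forall>\<theta>\<in>space ?G - B. \<exists>t\<in>space U. Y \<theta> t \<ge> 1 / 2)"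
    using \<kappa> \<eta> by (intro second_moment_existence[OF P U Y_meas _ first int2]) (auto simp: Y_def)
  then obtain B where B: "B \<in> sets ?G" "measure ?G B \<le> 4 * (\<kappa> * \<eta>)"
    "\<And>\<theta>. \<theta> \<in> space ?G - B \<Longrightarrow> \<exists>t\<in>{0..1}. Y \<theta> t \<ge> 1 / 2"
    unfolding space_U by blast
  have "\<exists>t\<in>{0..1}. z * partial_series (\<lambda>i. \<theta> i - \<mu> i) m t \<ge>
          z\<^sup>2 / 2 * (\<Sum>i<m. (\<sigma> (Suc i) * fourier_basis (Suc i) t)\<^sup>2) - ln 2" if \<theta>: "\<theta> \<in> space ?G - B" for \<theta>
  proof -
    obtain t where t: "t \<in> {0..1}" "Y \<theta> t \<ge> 1 / 2" using B(3)[OF \<theta>] by blast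
    have "ln (1 / 2) \<le> ln (Y \<theta> t)" using t(2) by (subst ln_le_cancel_iff) (auto simp: Y_def)
    also have "ln (Y \<theta> t) = z * partial_series (\<lambda>i. \<theta> i - \<mu> i) m t - z\<^sup>2 * K t t / 2"
      by (simp add: Y_def partial_series_def)
    also have "K t t = (\<Sum>i<m. (\<sigma> (Suc i) * fourier_basis (Suc i) t)\<^sup>2)"
      unfolding K_def by (simp add: power2_eq_square mult_ac)
    finally show ?thesis using t(1) by (intro bexI[of _ t]) (auto simp: ln_div)
  qed
  with B(1,2) show ?thesis by (intro bexI[of _ B]) (auto simp: \<kappa>_def)
qed

lemma twice_rate_exponent:
  assumes "\<alpha> > 0"
  shows "- \<alpha> / (2 * \<alpha> + 1) + - \<alpha> / (2 * \<alpha> + 1) = 1 / (2 * \<alpha> + 1) - (1 :: real)"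
proof -
  have "- \<alpha> / (2 * \<alpha> + 1) + - \<alpha> / (2 * \<alpha> + 1) + (2 * \<alpha> + 1) / (2 * \<alpha> + 1) = 1 / (2 * \<alpha> + 1)"
    by (simp only: add_divide_distrib[symmetric]) simp
  then show ?thesis using assms by simp
qed

text \<open>The variances are summed over the blocks that control the sup norm: the contribution of a block is its length times the
  square of its largest standard deviation.\<close>

lemma sum_posterior_variance_le:
  assumes \<alpha>: "\<alpha> > 0" and n: "n \<ge> 1"
  shows "(\<Sum>i<m. (posterior_coeff_sd \<alpha> n (Suc i))\<^sup>2)
    \<le> (2 powr (\<alpha> + 1 / 2))\<^sup>2 / (1 - (2 powr - \<alpha>)\<^sup>2) * (real n powr (- \<alpha> / (2 * \<alpha> + 1)))\<^sup>2"
proof -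
  let ?s = "\<lambda>i. posterior_coeff_sd \<alpha> n (Suc i)"
  define b where "b = block_start \<alpha> n"
  define D where "D j = cutoff \<alpha> n * 2 ^ j" for j
  define a where "a j = (2 powr (\<alpha> + 1 / 2) * real n powr (- \<alpha> / (2 * \<alpha> + 1)))\<^sup>2 * ((2 powr - \<alpha>)\<^sup>2) ^ j" for j
  have "norm ((2 powr - \<alpha>)\<^sup>2) < (1 :: real)"
    using \<alpha> by (simp add: powr_minus_divide power_less_one_iff abs_square_less_1)
  from sums_mult[OF geometric_sums[OF this]]
  have a_sums: "a sums ((2 powr (\<alpha> + 1 / 2) * real n powr (- \<alpha> / (2 * \<alpha> + 1)))\<^sup>2 * (1 / (1 - (2 powr - \<alpha>)\<^sup>2)))"
    unfolding a_def by blast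
  have block: "\<bar>(\<Sum>i<m. (?s i)\<^sup>2) - (\<Sum>i<b j. (?s i)\<^sup>2)\<bar> \<le> a j" if m: "b j \<le> m" "m \<le> b (Suc j)" for j m
  proof -
    let ?Q = "(real (D j) / 2) powr - (\<alpha> + 1 / 2)"
    have "(\<Sum>i<m. (?s i)\<^sup>2) - (\<Sum>i<b j. (?s i)\<^sup>2) = (\<Sum>i\<in>{b j..<m}. (?s i)\<^sup>2)"
      using m by (simp add: lessThan_atLeast0 sum_diff_nat_ivl)
    moreover have "(\<Sum>i\<in>{b j..<m}. (?s i)\<^sup>2) \<le> (\<Sum>i\<in>{b j..<m}. ?Q\<^sup>2)"
      using posterior_coeff_sd_block[OF \<alpha> n, of j] posterior_coeff_sd_pos[OF n]
      by (intro sum_mono power_mono) (auto simp: b_def D_def less_imp_le)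
    moreover have "(\<Sum>i\<in>{b j..<m}. ?Q\<^sup>2) \<le> real (D j) * ?Q\<^sup>2"
    proof -
      have "m - b j \<le> D j" using m by (simp add: b_def block_start_def D_def)
      then show ?thesis
        by (subst sum_constant) (intro mult_right_mono of_nat_mono, auto)
    qed
    moreover have "real (D j) * ?Q\<^sup>2 = (?Q * sqrt (real (D j)))\<^sup>2"
      by (simp add: power_mult_distrib)
    moreover have "(?Q * sqrt (real (D j)))\<^sup>2 \<le> (2 powr (\<alpha> + 1 / 2) * real n powr (- \<alpha> / (2 * \<alpha> + 1)) * (2 powr - \<alpha>) ^ j)\<^sup>2"
      unfolding D_def by (intro power_mono block_sd_sqrt_length[OF \<alpha> n]) auto
    moreover have "\<dots> = a j"
      by (simp add: a_def power_mult_distrib power_mult[symmetric] mult.commute[of 2])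
    moreover have "(\<Sum>i\<in>{b j..<m}. (?s i)\<^sup>2) \<ge> 0" by (intro sum_nonneg) auto
    ultimately show ?thesis by linarith
  qed
  have "\<bar>\<Sum>i<m. (?s i)\<^sup>2\<bar> \<le> suminf a"
    by (rule blockwise_uniform_convergence(2)[where b = b and T = "UNIV :: unit set" and S = "\<lambda>m _. \<Sum>i<m. (?s i)\<^sup>2"])
       (use strict_mono_block_start[OF \<alpha> n] a_sums block in \<open>auto simp: b_def block_start_def a_def sums_summable\<close>)
  also have "suminf a = (2 powr (\<alpha> + 1 / 2) * real n powr (- \<alpha> / (2 * \<alpha> + 1)))\<^sup>2 * (1 / (1 - (2 powr - \<alpha>)\<^sup>2))"
    using a_sums by (rule sums_unique[symmetric])
  finally show ?thesis by (simp add: power_mult_distrib)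
qed

lemma posterior_coeff_sd_square: "n \<ge> 1 \<Longrightarrow> (posterior_coeff_sd \<alpha> n i)\<^sup>2 = 1 / (real i powr (2 * \<alpha> + 1) + real n)"
  by (simp add: posterior_coeff_sd_def power_divide)

text \<open>In the first \<open>2 * cutoff \<alpha> n + 1\<close> coordinates the posterior variance is still of order \<open>1 / n\<close>, and
  their squared basis functions add up to a constant function.\<close>

lemma posterior_pointwise_variance_ge:
  assumes \<alpha>: "\<alpha> > 0" and n: "n \<ge> 1" and m: "m \<ge> 2 * cutoff \<alpha> n + 1"
  shows "(\<Sum>i<m. (posterior_coeff_sd \<alpha> n (Suc i) * fourier_basis (Suc i) t)\<^sup>2)
    \<ge> 2 / (6 powr (2 * \<alpha> + 1) + 1) * (real n powr (- \<alpha> / (2 * \<alpha> + 1)))\<^sup>2"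
proof -
  let ?s = "\<lambda>i. posterior_coeff_sd \<alpha> n (Suc i)"
  define p where "p = real n powr (1 / (2 * \<alpha> + 1))"
  define C where "C = 6 powr (2 * \<alpha> + 1) + (1 :: real)"
  have C: "C > 0" by (simp add: C_def add_nonneg_pos)
  have p: "p powr (2 * \<alpha> + 1) = real n" using \<alpha> n by (simp add: p_def powr_powr)
  have r: "(real n powr (- \<alpha> / (2 * \<alpha> + 1)))\<^sup>2 = p / real n"
  proof -
    have e: "- \<alpha> / (2 * \<alpha> + 1) + - \<alpha> / (2 * \<alpha> + 1) + 1 = 1 / (2 * \<alpha> + 1)"
      unfolding twice_rate_exponent[OF \<alpha>] by simp
    have "(real n powr (- \<alpha> / (2 * \<alpha> + 1)))\<^sup>2 * real n powr 1 = p"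
      unfolding power2_eq_square powr_add[symmetric] p_def e ..
    then show ?thesis using n by (simp add: field_simps)
  qed
  have "2 / C * (p / real n) \<le> (2 * real (cutoff \<alpha> n) + 1) / (C * real n)"
    using cutoff_bounds(2)[OF \<alpha> n] C n by (simp add: p_def[symmetric] divide_right_mono)
  also have "\<dots> = (\<Sum>i<2 * cutoff \<alpha> n + 1. 1 / (C * real n) * (fourier_basis (Suc i) t)\<^sup>2)"
    by (simp only: sum_distrib_left[symmetric] sum_fourier_basis_square) simp
  also have "\<dots> \<le> (\<Sum>i<2 * cutoff \<alpha> n + 1. (?s i * fourier_basis (Suc i) t)\<^sup>2)"
  proof (rule sum_mono)
    fix i assume i: "i \<in> {..<2 * cutoff \<alpha> n + 1}"
    have "real (Suc i) \<le> 3 * real (cutoff \<alpha> n)"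
      using i cutoff_bounds(1)[OF \<alpha> n] by auto
    then have "real (Suc i) \<le> 6 * p"
      using cutoff_bounds(3)[OF \<alpha> n] by (simp add: p_def[symmetric])
    then have "real (Suc i) powr (2 * \<alpha> + 1) \<le> (6 * p) powr (2 * \<alpha> + 1)"
      using \<alpha> by (intro powr_mono2) auto
    also have "\<dots> = 6 powr (2 * \<alpha> + 1) * real n"
      using p by (simp add: powr_mult p_def)
    finally have "real (Suc i) powr (2 * \<alpha> + 1) + real n \<le> C * real n"
      by (simp add: C_def algebra_simps)
    then have "1 / (C * real n) \<le> (?s i)\<^sup>2"
      unfolding posterior_coeff_sd_square[OF n] using n C
      by (intro divide_left_mono mult_pos_pos add_nonneg_pos) auto
    then show "1 / (C * real n) * (fourier_basis (Suc i) t)\<^sup>2 \<le> (?s i * fourier_basis (Suc i) t)\<^sup>2"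
      unfolding power_mult_distrib by (intro mult_right_mono) auto
  qed
  also have "\<dots> \<le> (\<Sum>i<m. (?s i * fourier_basis (Suc i) t)\<^sup>2)"
    using m by (intro sum_mono2) auto
  finally show ?thesis unfolding r C_def .
qed

text \<open>Here \<open>z\<close> is chosen such that \<open>z\<^sup>2\<close> times the pointwise variance is a small multiple of \<open>ln n\<close>. It has to be small:
  the bound for the second moment loses a power of \<open>n\<close> proportional to that multiple, and this must stay below the power of
  \<open>n\<close> gained from the decay of correlations.\<close>

lemma posterior_partial_sup_ge:
  assumes \<alpha>: "\<alpha> > 0"
  shows "\<exists>c>0. \<exists>\<psi>. \<psi> \<longlonglongrightarrow> 0 \<and> (\<forall>\<^sub>F n in sequentially. \<forall>\<mu>. \<forall>m\<ge>2 * cutoff \<alpha> n + 1.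
     \<exists>B\<in>sets (gaussian_sequence \<mu> (posterior_coeff_sd \<alpha> n)).
       measure (gaussian_sequence \<mu> (posterior_coeff_sd \<alpha> n)) B \<le> \<psi> n \<and>
       (\<forall>\<theta>\<in>space (gaussian_sequence \<mu> (posterior_coeff_sd \<alpha> n)) - B. \<exists>t\<in>{0..1}.
          partial_series (\<lambda>i. \<theta> i - \<mu> i) m t \<ge> c * rate \<alpha> n))"
proof -
  define C where "C = (2 powr (\<alpha> + 1 / 2))\<^sup>2 / (1 - (2 powr - \<alpha>)\<^sup>2)"
  define c1 where "c1 = 2 / (6 powr (2 * \<alpha> + 1) + (1 :: real))"
  \<comment> \<open>Decorrelation gains the factor \<open>n powr (- 2 * q)\<close>; the choice of \<open>\<delta>\<close> makes the loss exactly \<open>n powr q\<close>.\<close>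
  define q where "q = 1 / (4 * (2 * \<alpha> + 1))"
  define \<delta> where "\<delta> = q / (2 * C)"
  have "2 powr - \<alpha> < (1 :: real)" using \<alpha> by (simp add: powr_minus_divide)
  then have "(2 powr - \<alpha>)\<^sup>2 < (1 :: real)" by (simp add: abs_square_less_1)
  then have C: "C > 0" by (simp add: C_def)
  have c1: "c1 > 0" by (simp add: c1_def add_nonneg_pos)
  have q: "q > 0" using \<alpha> by (simp add: q_def)
  have "4 * q = (4 * 1) / (4 * (2 * \<alpha> + 1))" by (simp only: q_def times_divide_eq_right)
  also have "\<dots> = 1 / (2 * \<alpha> + 1)" by (rule mult_divide_mult_cancel_left) simp
  finally have q4: "4 * q = 1 / (2 * \<alpha> + 1)" .
  have \<delta>: "\<delta> > 0" using C q by (simp add: \<delta>_def)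
  define \<psi> where "\<psi> n = 4 * \<delta> * sqrt C * (ln (real n) * real n powr - q)" for n
  have "(\<lambda>n. ln (real n) * real n powr - q) \<longlonglongrightarrow> 0"
    using lim_ln_over_power[OF q] by (simp add: powr_minus_divide)
  then have \<psi>: "\<psi> \<longlonglongrightarrow> 0"
    unfolding \<psi>_def by (rule tendsto_mult_right_zero)
  have "filterlim (\<lambda>n. ln (real n)) at_top sequentially"
    by (rule filterlim_compose[OF ln_at_top filterlim_real_sequentially])
  then have "\<forall>\<^sub>F n in sequentially. ln (real n) \<ge> 4 * ln 2 / (\<delta> * c1)"
    by (simp add: filterlim_at_top)
  then have main: "\<forall>\<^sub>F n in sequentially. \<forall>\<mu>. \<forall>m\<ge>2 * cutoff \<alpha> n + 1.
     \<exists>B\<in>sets (gaussian_sequence \<mu> (posterior_coeff_sd \<alpha> n)).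
       measure (gaussian_sequence \<mu> (posterior_coeff_sd \<alpha> n)) B \<le> \<psi> n \<and>
       (\<forall>\<theta>\<in>space (gaussian_sequence \<mu> (posterior_coeff_sd \<alpha> n)) - B. \<exists>t\<in>{0..1}.
          partial_series (\<lambda>i. \<theta> i - \<mu> i) m t \<ge> sqrt \<delta> * c1 / 4 * rate \<alpha> n)"
    using eventually_ge_at_top[of 2]
  proof eventually_elim
    case (elim n)
    have n: "n \<ge> 1" "real n > 0" using elim by auto
    define L where "L = ln (real n)"
    have L: "L > 0" using elim by (simp add: L_def)
    define r where "r = real n powr (- \<alpha> / (2 * \<alpha> + 1))"
    have r: "r > 0" using n by (simp add: r_def)
    have rn: "r\<^sup>2 / real n = r ^ 4 * (real n powr (- 2 * q))\<^sup>2"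
    proof -
      have e: "- \<alpha> / (2 * \<alpha> + 1) + - \<alpha> / (2 * \<alpha> + 1) + (- 2 * q + - 2 * q) = - 1"
        unfolding twice_rate_exponent[OF \<alpha>] q4[symmetric] by simp
      have "r\<^sup>2 * (real n powr (- 2 * q))\<^sup>2 = 1 / real n"
        unfolding r_def power2_eq_square powr_add[symmetric] e using n by (simp add: powr_minus_divide)
      then have "r\<^sup>2 * (r\<^sup>2 * (real n powr (- 2 * q))\<^sup>2) = r\<^sup>2 * (1 / real n)" by simp
      then show ?thesis by (simp add: power_mult_distrib mult.assoc[symmetric] flip: power_add)
    qed
    define z where "z = sqrt (\<delta> * L) / r"
    have z: "z > 0" using \<delta> L r by (simp add: z_def)
    have z2: "z\<^sup>2 * r\<^sup>2 = \<delta> * L" using \<delta> L r by (simp add: z_def power_divide)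
    define \<eta> where "\<eta> = sqrt C * r\<^sup>2 * real n powr (- 2 * q)"
    have \<eta>: "\<eta> > 0" using C r n by (simp add: \<eta>_def)
    have \<eta>2: "\<eta>\<^sup>2 = C * (r\<^sup>2 / real n)"
      unfolding rn \<eta>_def using C by (simp add: power_mult_distrib flip: power_mult)
    show ?case
    proof (intro allI impI)
      fix \<mu> m assume m: "2 * cutoff \<alpha> n + 1 \<le> m"
      let ?s = "\<lambda>i. posterior_coeff_sd \<alpha> n (Suc i)"
      have S: "(\<Sum>i<m. (?s i)\<^sup>2) \<le> C * r\<^sup>2"
        unfolding C_def r_def by (rule sum_posterior_variance_le[OF \<alpha> n(1)])
      have "(\<Sum>i<m. ((?s i)\<^sup>2)\<^sup>2) \<le> (\<Sum>i<m. (?s i)\<^sup>2 * (1 / real n))"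
      proof (rule sum_mono)
        fix i
        have "(?s i)\<^sup>2 \<le> 1 / real n"
          unfolding posterior_coeff_sd_square[OF n(1)] using n
            by (intro divide_left_mono mult_pos_pos add_nonneg_pos) auto
        then show "((?s i)\<^sup>2)\<^sup>2 \<le> (?s i)\<^sup>2 * (1 / real n)"
          unfolding power2_eq_square[of "(?s i)\<^sup>2"] by (intro mult_left_mono) auto
      qed
      also have "\<dots> = (\<Sum>i<m. (?s i)\<^sup>2) / real n" by (simp add: sum_divide_distrib)
      also have "\<dots> \<le> C * r\<^sup>2 / real n" using S n by (intro divide_right_mono) auto
      finally have Q: "(\<Sum>i<m. ((?s i)\<^sup>2)\<^sup>2) \<le> \<eta>\<^sup>2" unfolding \<eta>2 by simp
      have \<psi>_eq: "4 * (z\<^sup>2 * exp (2 * z\<^sup>2 * (C * r\<^sup>2)) * \<eta>) = \<psi> n"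
      proof -
        have "2 * z\<^sup>2 * (C * r\<^sup>2) = 2 * C * (z\<^sup>2 * r\<^sup>2)" by simp
        also have "\<dots> = q * L" unfolding z2 using C by (simp add: \<delta>_def)
        finally have "exp (2 * z\<^sup>2 * (C * r\<^sup>2)) = real n powr q"
          using n by (simp add: powr_def L_def)
        then have "4 * (z\<^sup>2 * exp (2 * z\<^sup>2 * (C * r\<^sup>2)) * \<eta>) =
            4 * (z\<^sup>2 * r\<^sup>2) * sqrt C * (real n powr q * real n powr (- 2 * q))"
          by (simp add: \<eta>_def)
        also have "real n powr q * real n powr (- 2 * q) = real n powr - q"
          by (simp flip: powr_add)
        finally show ?thesis unfolding z2 by (simp add: \<psi>_def L_def)
      qed
      obtain B where B: "B \<in> sets (gaussian_sequence \<mu> (posterior_coeff_sd \<alpha> n))"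
        "measure (gaussian_sequence \<mu> (posterior_coeff_sd \<alpha> n)) B \<le> \<psi> n"
        and large: "\<And>\<theta>. \<theta> \<in> space (gaussian_sequence \<mu> (posterior_coeff_sd \<alpha> n)) - B \<Longrightarrow> \<exists>t\<in>{0..1}.
           z * partial_series (\<lambda>i. \<theta> i - \<mu> i) m t \<ge> z\<^sup>2 / 2 * (\<Sum>i<m. (?s i * fourier_basis (Suc i) t)\<^sup>2) - ln 2"
        using gaussian_series_large_values[OF posterior_coeff_sd_pos[OF n(1)] S \<eta> Q, where z = z and \<mu> = \<mu>]
        unfolding \<psi>_eq by blast
      have "\<exists>t\<in>{0..1}. partial_series (\<lambda>i. \<theta> i - \<mu> i) m t \<ge> sqrt \<delta> * c1 / 4 * rate \<alpha> n"
        if \<theta>: "\<theta> \<in> space (gaussian_sequence \<mu> (posterior_coeff_sd \<alpha> n)) - B" for \<theta>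
      proof -
        obtain t where t: "t \<in> {0..1}"
          "z * partial_series (\<lambda>i. \<theta> i - \<mu> i) m t \<ge> z\<^sup>2 / 2 * (\<Sum>i<m. (?s i * fourier_basis (Suc i) t)\<^sup>2) - ln 2"
          using large[OF \<theta>] by blast
        have "z * (sqrt \<delta> * c1 / 4 * rate \<alpha> n) = c1 * ((z * r) * sqrt (\<delta> * L)) / 4"
          using \<delta> L by (simp add: rate_def r_def L_def real_sqrt_mult)
        also have "(z * r) * sqrt (\<delta> * L) = \<delta> * L"
          using r \<delta> L by (simp add: z_def)
        also have "c1 * (\<delta> * L) / 4 \<le> \<delta> * L * c1 / 2 - ln 2"
          using elim(1) \<delta> c1 by (simp add: L_def field_simps)
        also have "\<delta> * L * c1 / 2 = z\<^sup>2 / 2 * (c1 * r\<^sup>2)"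
          unfolding z2[symmetric] by simp
        also have "\<dots> \<le> z\<^sup>2 / 2 * (\<Sum>i<m. (?s i * fourier_basis (Suc i) t)\<^sup>2)"
          unfolding c1_def r_def by (intro mult_left_mono posterior_pointwise_variance_ge[OF \<alpha> n(1) m]) auto
        finally have "z * (sqrt \<delta> * c1 / 4 * rate \<alpha> n) \<le> z * partial_series (\<lambda>i. \<theta> i - \<mu> i) m t"
          using t(2) by simp
        then show ?thesis using z t(1) by (intro bexI[of _ t]) auto
      qed
      then show "\<exists>B\<in>sets (gaussian_sequence \<mu> (posterior_coeff_sd \<alpha> n)).
       measure (gaussian_sequence \<mu> (posterior_coeff_sd \<alpha> n)) B \<le> \<psi> n \<and>
       (\<forall>\<theta>\<in>space (gaussian_sequence \<mu> (posterior_coeff_sd \<alpha> n)) - B. \<exists>t\<in>{0..1}.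
          partial_series (\<lambda>i. \<theta> i - \<mu> i) m t \<ge> sqrt \<delta> * c1 / 4 * rate \<alpha> n)"
        using B by (intro bexI[of _ B]) auto
    qed
  qed
  have "sqrt \<delta> * c1 / 4 > 0" using \<delta> c1 by simp
  then show ?thesis using \<psi> main by blast
qed

lemma uniform_limit_fourier_series:
  assumes "uniformly_convergent_on X (partial_series \<theta>)"
  shows "uniform_limit X (partial_series \<theta>) (fourier_series \<theta>) sequentially"
proof -
  obtain l where l: "uniform_limit X (partial_series \<theta>) l sequentially"
    using assms by (auto simp: uniformly_convergent_on_def)
  have "fourier_series \<theta> x = l x" if "x \<in> X" for x
  proof -
    have "(\<lambda>i. \<theta> (Suc i) * fourier_basis (Suc i) x) sums l x"
      using tendsto_uniform_limitI[OF l that] unfolding sums_def partial_series_def .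
    then show ?thesis by (simp add: fourier_series_def sums_iff)
  qed
  then show ?thesis
    using l by (simp cong: uniform_limit_cong')
qed

text \<open>If the limit stays small everywhere, then by uniform convergence so do all late partial sums. The event that all
  partial sums from the index \<open>k\<close> on stay small is no more likely than for the \<open>k\<close>-th one alone, and these events increase with \<open>k\<close>.\<close>

lemma posterior_sup_ge:
  assumes \<alpha>: "\<alpha> > 0"
  shows "\<exists>c>0. \<exists>\<psi>. \<psi> \<longlonglongrightarrow> 0 \<and> (\<forall>\<^sub>F n in sequentially. \<forall>\<mu>.
     \<exists>B\<in>sets (gaussian_sequence \<mu> (posterior_coeff_sd \<alpha> n)).
       measure (gaussian_sequence \<mu> (posterior_coeff_sd \<alpha> n)) B \<le> \<psi> n \<and>
       (\<forall>\<theta>\<in>space (gaussian_sequence \<mu> (posterior_coeff_sd \<alpha> n)) - B.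
          uniformly_convergent_on {0..1} (partial_series (\<lambda>i. \<theta> i - \<mu> i)) \<longrightarrow>
          (\<exists>t\<in>{0..1}. fourier_series (\<lambda>i. \<theta> i - \<mu> i) t > c * rate \<alpha> n)))"
proof -
  obtain c \<psi> where c: "c > 0" and \<psi>: "\<psi> \<longlonglongrightarrow> 0" and
    ev: "\<forall>\<^sub>F n in sequentially. \<forall>\<mu>. \<forall>m\<ge>2 * cutoff \<alpha> n + 1.
     \<exists>B\<in>sets (gaussian_sequence \<mu> (posterior_coeff_sd \<alpha> n)).
       measure (gaussian_sequence \<mu> (posterior_coeff_sd \<alpha> n)) B \<le> \<psi> n \<and>
       (\<forall>\<theta>\<in>space (gaussian_sequence \<mu> (posterior_coeff_sd \<alpha> n)) - B. \<exists>t\<in>{0..1}.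
          partial_series (\<lambda>i. \<theta> i - \<mu> i) m t \<ge> c * rate \<alpha> n)"
    using posterior_partial_sup_ge[OF \<alpha>] by blast
  from ev eventually_ge_at_top[of 2]
  have "\<forall>\<^sub>F n in sequentially. \<forall>\<mu>.
     \<exists>B\<in>sets (gaussian_sequence \<mu> (posterior_coeff_sd \<alpha> n)).
       measure (gaussian_sequence \<mu> (posterior_coeff_sd \<alpha> n)) B \<le> \<psi> n \<and>
       (\<forall>\<theta>\<in>space (gaussian_sequence \<mu> (posterior_coeff_sd \<alpha> n)) - B.
          uniformly_convergent_on {0..1} (partial_series (\<lambda>i. \<theta> i - \<mu> i)) \<longrightarrow>
          (\<exists>t\<in>{0..1}. fourier_series (\<lambda>i. \<theta> i - \<mu> i) t > c / 2 * rate \<alpha> n))"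
  proof eventually_elim
    case (elim n)
    show ?case
    proof
      fix \<mu>
      let ?G = "gaussian_sequence \<mu> (posterior_coeff_sd \<alpha> n)"
      interpret prob_space ?G
        using elim(2) by (intro prob_space_gaussian_sequence posterior_coeff_sd_pos) auto
      define m0 where "m0 = 2 * cutoff \<alpha> n + 1"
      have "\<exists>B. B \<in> sets ?G \<and> prob B \<le> \<psi> n \<and>
         (\<forall>\<theta>\<in>space ?G - B. \<exists>t\<in>{0..1}. partial_series (\<lambda>i. \<theta> i - \<mu> i) (m0 + k) t \<ge> c * rate \<alpha> n)" for k
        using elim(1)[rule_format, of "m0 + k" \<mu>] by (auto simp: m0_def)
      then obtain B where B: "\<And>k. B k \<in> sets ?G" "\<And>k. prob (B k) \<le> \<psi> n"
        "\<And>k \<theta>. \<theta> \<in> space ?G - B k \<Longrightarrow> \<exists>t\<in>{0..1}. partial_series (\<lambda>i. \<theta> i - \<mu> i) (m0 + k) t \<ge> c * rate \<alpha> n"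
        by metis
      define A where "A k = (\<Inter>l\<in>{k..}. B l)" for k
      have A: "A k \<in> sets ?G" for k unfolding A_def using B(1) by (intro sets.countable_INT') auto
      have "incseq A" unfolding A_def incseq_def by (intro allI impI INT_anti_mono) auto
      then have "(\<lambda>k. prob (A k)) \<longlonglongrightarrow> prob (\<Union>k. A k)"
        using A by (intro finite_Lim_measure_incseq) auto
      moreover have "prob (A k) \<le> \<psi> n" for k
        using finite_measure_mono[of "A k" "B k"] B(1)[of k] B(2)[of k] by (force simp: A_def)
      ultimately have "prob (\<Union>k. A k) \<le> \<psi> n"
        by (intro LIMSEQ_le_const2[of _ _ "\<psi> n"]) auto
      moreover have "\<exists>t\<in>{0..1}. fourier_series (\<lambda>i. \<theta> i - \<mu> i) t > c / 2 * rate \<alpha> n"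
        if \<theta>: "\<theta> \<in> space ?G - (\<Union>k. A k)" and conv: "uniformly_convergent_on {0..1} (partial_series (\<lambda>i. \<theta> i - \<mu> i))" for \<theta>
      proof -
        have "rate \<alpha> n > 0" using elim(2) by (simp add: rate_def)
        then have "c / 2 * rate \<alpha> n > 0" using c by simp
        from uniform_limitD[OF uniform_limit_fourier_series[OF conv] this]
        obtain M where M: "\<And>m t. m \<ge> M \<Longrightarrow> t \<in> {0..1} \<Longrightarrow>
            dist (partial_series (\<lambda>i. \<theta> i - \<mu> i) m t) (fourier_series (\<lambda>i. \<theta> i - \<mu> i) t) < c / 2 * rate \<alpha> n"
          unfolding eventually_sequentially by blast
        obtain k where k: "k \<ge> M" "\<theta> \<notin> B k" using \<theta> by (auto simp: A_def)
        then obtain t where t: "t \<in> {0..1}" "partial_series (\<lambda>i. \<theta> i - \<mu> i) (m0 + k) t \<ge> c * rate \<alpha> n"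
          using B(3)[of \<theta> k] \<theta> by blast
        have "dist (partial_series (\<lambda>i. \<theta> i - \<mu> i) (m0 + k) t) (fourier_series (\<lambda>i. \<theta> i - \<mu> i) t) < c / 2 * rate \<alpha> n"
          using k(1) t(1) by (intro M) auto
        then have "fourier_series (\<lambda>i. \<theta> i - \<mu> i) t > c / 2 * rate \<alpha> n"
          using t(2) unfolding dist_real_def by linarith
        then show ?thesis using t(1) by blast
      qed
      ultimately show "\<exists>B\<in>sets ?G. prob B \<le> \<psi> n \<and> (\<forall>\<theta>\<in>space ?G - B.
          uniformly_convergent_on {0..1} (partial_series (\<lambda>i. \<theta> i - \<mu> i)) \<longrightarrow>
          (\<exists>t\<in>{0..1}. fourier_series (\<lambda>i. \<theta> i - \<mu> i) t > c / 2 * rate \<alpha> n))"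
        using A by (intro bexI[of _ "\<Union>k. A k"]) auto
    qed
  qed
  moreover have "c / 2 > 0" using c by simp
  ultimately show ?thesis using \<psi> by blast
qed

section \<open>Uniformly convergent Fourier series\<close>

abbreviation uniformly_summable :: "(nat \<Rightarrow> real) \<Rightarrow> bool" where
  "uniformly_summable \<theta> \<equiv> uniformly_convergent_on {0..1} (partial_series \<theta>)"

lemma uniformly_summable_tendsto:
  "uniformly_summable \<theta> \<Longrightarrow> t \<in> {0..1} \<Longrightarrow> (\<lambda>m. partial_series \<theta> m t) \<longlonglongrightarrow> fourier_series \<theta> t"
  by (rule tendsto_uniform_limitI[OF uniform_limit_fourier_series])

lemma partial_series_add: "partial_series (\<lambda>i. a i + b i) m t = partial_series a m t + partial_series b m t"
  by (simp add: partial_series_def sum.distrib ring_distribs)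

lemma uniformly_summable_add:
  assumes "uniformly_summable a" "uniformly_summable b"
  shows "uniformly_summable (\<lambda>i. a i + b i)"
    and "t \<in> {0..1} \<Longrightarrow> fourier_series (\<lambda>i. a i + b i) t = fourier_series a t + fourier_series b t"
proof -
  have "partial_series (\<lambda>i. a i + b i) = (\<lambda>m t. partial_series a m t + partial_series b m t)"
    by (intro ext partial_series_add)
  then show c: "uniformly_summable (\<lambda>i. a i + b i)"
    using uniformly_convergent_add[OF assms] by simp
  assume t: "t \<in> {0..1}"
  show "fourier_series (\<lambda>i. a i + b i) t = fourier_series a t + fourier_series b t"
    using uniformly_summable_tendsto[OF c t] tendsto_add[OF assms[THEN uniformly_summable_tendsto, OF t]]
    by (intro LIMSEQ_unique) (simp_all add: partial_series_add)
qed

lemma uniformly_summable_diff: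
  assumes "uniformly_summable a" "uniformly_summable b"
  shows "uniformly_summable (\<lambda>i. a i - b i)"
    and "t \<in> {0..1} \<Longrightarrow> fourier_series (\<lambda>i. a i - b i) t = fourier_series a t - fourier_series b t"
proof -
  have *: "partial_series (\<lambda>i. a i - b i) m t = partial_series a m t - partial_series b m t" for m t
    by (simp add: partial_series_def sum_subtractf left_diff_distrib)
  then have "partial_series (\<lambda>i. a i - b i) = (\<lambda>m t. partial_series a m t - partial_series b m t)"
    by (intro ext)
  then show c: "uniformly_summable (\<lambda>i. a i - b i)"
    using uniformly_convergent_minus[OF assms] by simp
  assume t: "t \<in> {0..1}"
  show "fourier_series (\<lambda>i. a i - b i) t = fourier_series a t - fourier_series b t"
    using uniformly_summable_tendsto[OF c t] tendsto_diff[OF assms[THEN uniformly_summable_tendsto, OF t]]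
    by (intro LIMSEQ_unique) (simp_all add: *)
qed

lemma uniformly_summable_abs:
  assumes "summable (\<lambda>i. \<bar>\<theta> (Suc i)\<bar>)"
  shows "uniformly_summable \<theta>"
    and "t \<in> {0..1} \<Longrightarrow> \<bar>fourier_series \<theta> t\<bar> \<le> sqrt 2 * (\<Sum>i. \<bar>\<theta> (Suc i)\<bar>)"
proof -
  have le: "norm (\<theta> (Suc i) * fourier_basis (Suc i) t) \<le> sqrt 2 * \<bar>\<theta> (Suc i)\<bar>" for i t
    using mult_left_mono[OF abs_fourier_basis_le[of "Suc i" t], of "\<bar>\<theta> (Suc i)\<bar>"]
    by (simp add: abs_mult mult_ac)
  have s: "summable (\<lambda>i. sqrt 2 * \<bar>\<theta> (Suc i)\<bar>)" by (intro summable_mult assms)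
  show "uniformly_summable \<theta>"
    unfolding partial_series_def by (rule Weierstrass_m_test'[OF le s])
  have s': "summable (\<lambda>i. norm (\<theta> (Suc i) * fourier_basis (Suc i) t))"
    by (rule summable_comparison_test'[OF s]) (use le in auto)
  have "norm (fourier_series \<theta> t) \<le> (\<Sum>i. norm (\<theta> (Suc i) * fourier_basis (Suc i) t))"
    unfolding fourier_series_def by (rule summable_norm[OF s'])
  also have "\<dots> \<le> (\<Sum>i. sqrt 2 * \<bar>\<theta> (Suc i)\<bar>)"
    by (rule suminf_le[OF le s' s])
  also have "\<dots> = sqrt 2 * (\<Sum>i. \<bar>\<theta> (Suc i)\<bar>)"
    using assms by (rule suminf_mult)
  finally show "\<bar>fourier_series \<theta> t\<bar> \<le> sqrt 2 * (\<Sum>i. \<bar>\<theta> (Suc i)\<bar>)" by simp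
qed

lemma continuous_on_fourier_series:
  assumes "uniformly_summable \<theta>"
  shows "continuous_on {0..1} (fourier_series \<theta>)"
proof (rule uniform_limit_theorem[OF _ uniform_limit_fourier_series[OF assms]])
  show "\<forall>\<^sub>F m in sequentially. continuous_on {0..1} (partial_series \<theta> m)"
    unfolding partial_series_def
    by (intro always_eventually allI continuous_intros continuous_fourier_basis)
qed simp

lemma sup_norm_le_iff: "sup_norm f \<le> ereal r \<longleftrightarrow> (\<forall>t\<in>{0..1}. \<bar>f t\<bar> \<le> r)"
  by (simp add: sup_norm_def SUP_le_iff)

section \<open>Bias of the posterior mean\<close>

definition shrinkage :: "real \<Rightarrow> nat \<Rightarrow> nat \<Rightarrow> real" where
  "shrinkage \<alpha> n i = real n / (real i powr (2 * \<alpha> + 1) + real n)"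

lemma posterior_coeff_mean_shrinkage: "posterior_coeff_mean \<alpha> n y i = shrinkage \<alpha> n i * y i"
  by (simp add: posterior_coeff_mean_def shrinkage_def)

lemma function_classD:
  assumes f: "f \<in> function_class \<alpha> R" and \<alpha>: "\<alpha> > 0"
  shows "\<And>t. t \<in> {0..1} \<Longrightarrow> f t = fourier_series (fourier_coeff f) t"
    and "summable (\<lambda>i. \<bar>fourier_coeff f (Suc i)\<bar>)"
    and "summable (\<lambda>i. real (Suc i) powr \<alpha> * \<bar>fourier_coeff f (Suc i)\<bar>)"
    and "(\<Sum>i. real (Suc i) powr \<alpha> * \<bar>fourier_coeff f (Suc i)\<bar>) \<le> R"
proof -
  obtain \<theta> where \<theta>: "\<And>x. x \<in> {0..1} \<Longrightarrow> f x = fourier_series \<theta> x"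
    "summable (\<lambda>i. real (Suc i) powr \<alpha> * \<bar>\<theta> (Suc i)\<bar>)"
    "(\<Sum>i. real (Suc i) powr \<alpha> * \<bar>\<theta> (Suc i)\<bar>) \<le> R"
    using f unfolding function_class_def by blast
  have sum: "summable (\<lambda>i. \<bar>\<theta> (Suc i)\<bar>)"
  proof (rule summable_comparison_test'[OF \<theta>(2)])
    fix i
    have "1 \<le> real (Suc i) powr \<alpha>" using \<alpha> by (intro ge_one_powr_ge_zero) auto
    then show "norm \<bar>\<theta> (Suc i)\<bar> \<le> real (Suc i) powr \<alpha> * \<bar>\<theta> (Suc i)\<bar>"
      using mult_right_mono[of 1 _ "\<bar>\<theta> (Suc i)\<bar>"] by simp
  qed
  have c: "fourier_coeff f (Suc i) = \<theta> (Suc i)" for i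
    by (rule fourier_coeff_fourier_series[OF \<theta>(1) sum]) auto
  show "summable (\<lambda>i. \<bar>fourier_coeff f (Suc i)\<bar>)"
    "summable (\<lambda>i. real (Suc i) powr \<alpha> * \<bar>fourier_coeff f (Suc i)\<bar>)"
    "(\<Sum>i. real (Suc i) powr \<alpha> * \<bar>fourier_coeff f (Suc i)\<bar>) \<le> R"
    unfolding c by fact+
  show "f t = fourier_series (fourier_coeff f) t" if "t \<in> {0..1}" for t
    using \<theta>(1)[OF that] by (simp add: fourier_series_def c)
qed

text \<open>With \<open>x = i powr (2 * \<alpha> + 1) / n\<close> the left-hand side is \<open>x / (1 + x)\<close>, which is at most \<open>min 1 x\<close> and hence at
  most \<open>x powr p\<close> for every \<open>p\<close> between \<open>0\<close> and \<open>1\<close>; here \<open>p = \<alpha> / (2 * \<alpha> + 1)\<close>.\<close>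

lemma one_minus_shrinkage_le:
  assumes \<alpha>: "\<alpha> > 0" and n: "n \<ge> 1" and i: "i \<ge> 1"
  shows "\<bar>1 - shrinkage \<alpha> n i\<bar> \<le> real n powr (- \<alpha> / (2 * \<alpha> + 1)) * real i powr \<alpha>"
proof -
  define a where "a = real i powr (2 * \<alpha> + 1)"
  define p where "p = \<alpha> / (2 * \<alpha> + 1)"
  have a: "a > 0" using i by (simp add: a_def)
  have p: "0 < p" "p \<le> 1" using \<alpha> by (auto simp: p_def)
  have "shrinkage \<alpha> n i = real n / (a + real n)" by (simp only: shrinkage_def a_def)
  then have eq: "1 - shrinkage \<alpha> n i = a / (a + real n)"
    using a n by (simp add: field_simps)
  have "a / (a + real n) \<le> (a / real n) powr p"
  proof (cases "a \<le> real n")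
    case True
    have "a / (a + real n) \<le> a / real n" using a n by (intro divide_left_mono) auto
    also have "\<dots> = (a / real n) powr 1" using a n by simp
    also have "\<dots> \<le> (a / real n) powr p" using a n p True by (intro powr_mono') auto
    finally show ?thesis .
  next
    case False
    have "a / (a + real n) \<le> 1" using a by simp
    also have "1 \<le> (a / real n) powr p" using False n p by (intro ge_one_powr_ge_zero) auto
    finally show ?thesis .
  qed
  also have "(a / real n) powr p = real n powr - p * a powr p"
    using a n by (simp add: powr_divide powr_minus_divide)
  also have "a powr p = real i powr \<alpha>"
    using \<alpha> by (simp add: a_def p_def powr_powr)
  finally show ?thesis unfolding eq using a by (simp add: p_def)
qed

lemma bias_bound:
  assumes f: "f \<in> function_class \<alpha> R" and \<alpha>: "\<alpha> > 0" and n: "n \<ge> 2"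
  shows "uniformly_summable (\<lambda>i. fourier_coeff f i - shrinkage \<alpha> n i * fourier_coeff f i)"
    and "t \<in> {0..1} \<Longrightarrow> \<bar>fourier_series (\<lambda>i. fourier_coeff f i - shrinkage \<alpha> n i * fourier_coeff f i) t\<bar> \<le> 4 * R * rate \<alpha> n"
proof -
  let ?b = "\<lambda>i. fourier_coeff f i - shrinkage \<alpha> n i * fourier_coeff f i"
  define r where "r = real n powr (- \<alpha> / (2 * \<alpha> + 1))"
  note F = function_classD[OF f \<alpha>]
  have le: "\<bar>?b (Suc i)\<bar> \<le> r * (real (Suc i) powr \<alpha> * \<bar>fourier_coeff f (Suc i)\<bar>)" for i
  proof -
    have "\<bar>?b (Suc i)\<bar> = \<bar>1 - shrinkage \<alpha> n (Suc i)\<bar> * \<bar>fourier_coeff f (Suc i)\<bar>"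
      by (simp add: abs_mult[symmetric] algebra_simps)
    also have "\<dots> \<le> (r * real (Suc i) powr \<alpha>) * \<bar>fourier_coeff f (Suc i)\<bar>"
      unfolding r_def using n by (intro mult_right_mono one_minus_shrinkage_le \<alpha>) auto
    finally show ?thesis by (simp add: mult.assoc)
  qed
  have s: "summable (\<lambda>i. r * (real (Suc i) powr \<alpha> * \<bar>fourier_coeff f (Suc i)\<bar>))"
    by (intro summable_mult F)
  have sb: "summable (\<lambda>i. \<bar>?b (Suc i)\<bar>)"
    by (rule summable_comparison_test'[OF s]) (use le in auto)
  show "uniformly_summable ?b" by (rule uniformly_summable_abs(1)[OF sb])
  assume t: "t \<in> {0..1}"
  have "(\<Sum>i. \<bar>?b (Suc i)\<bar>) \<le> (\<Sum>i. r * (real (Suc i) powr \<alpha> * \<bar>fourier_coeff f (Suc i)\<bar>))"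
    by (intro suminf_le le sb s)
  also have "\<dots> = r * (\<Sum>i. real (Suc i) powr \<alpha> * \<bar>fourier_coeff f (Suc i)\<bar>)"
    by (rule suminf_mult[OF F(3)])
  also have "\<dots> \<le> r * R" using F(4) by (intro mult_left_mono) (auto simp: r_def)
  finally have S: "(\<Sum>i. \<bar>?b (Suc i)\<bar>) \<le> r * R" .
  have "0 \<le> (\<Sum>i. real (Suc i) powr \<alpha> * \<bar>fourier_coeff f (Suc i)\<bar>)"
    by (intro suminf_nonneg F(3)) auto
  then have R: "R \<ge> 0" using F(4) by simp
  have sq: "sqrt 2 \<le> 2" by (rule real_le_lsqrt) auto
  have "ln 2 \<le> ln (real n)" using n by simp
  then have "1 / 4 \<le> ln (real n)" using ln2_ge_two_thirds by linarith
  then have "sqrt (1 / 4) \<le> sqrt (ln (real n))" by (rule real_sqrt_le_mono)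
  then have "1 \<le> 2 * sqrt (ln (real n))" by (simp add: real_sqrt_divide)
  from mult_left_mono[OF this, of r] have r: "r \<le> 2 * rate \<alpha> n"
    by (simp add: rate_def r_def mult_ac)
  have "\<bar>fourier_series ?b t\<bar> \<le> sqrt 2 * (\<Sum>i. \<bar>?b (Suc i)\<bar>)"
    by (rule uniformly_summable_abs(2)[OF sb t])
  also have "\<dots> \<le> 2 * (r * R)"
    using S sq by (intro mult_mono suminf_nonneg sb) auto
  also have "\<dots> \<le> 4 * R * rate \<alpha> n"
    using mult_right_mono[OF r R] by (simp add: mult_ac)
  finally show "\<bar>fourier_series ?b t\<bar> \<le> 4 * R * rate \<alpha> n" .
qed

section \<open>The noise in the posterior and in the posterior mean\<close>

text \<open>One parameter \<open>k\<close> serves two purposes: \<open>k = 0\<close> gives events whose probability vanishes as \<open>n\<close> grows, and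
  large \<open>k\<close> gives small probabilities uniformly in \<open>n\<close>.\<close>

lemma gaussian_series_sup_geometric:
  assumes \<alpha>: "\<alpha> > 0" and n: "n \<ge> 2" and \<sigma>: "\<And>i. i \<ge> 1 \<Longrightarrow> \<sigma> i > 0"
    and w: "\<And>i. i \<ge> 1 \<Longrightarrow> \<bar>w i * \<sigma> i\<bar> \<le> posterior_coeff_sd \<alpha> n i"
  shows "\<exists>B\<in>sets (gaussian_sequence \<mu> \<sigma>).
     measure (gaussian_sequence \<mu> \<sigma>) B \<le> 160 / real n * (1 / 2) ^ k \<and>
     (\<forall>\<theta>\<in>space (gaussian_sequence \<mu> \<sigma>) - B.
        uniformly_summable (\<lambda>i. w i * (\<theta> i - \<mu> i)) \<and>
        (\<forall>t\<in>{0..1}. \<bar>fourier_series (\<lambda>i. w i * (\<theta> i - \<mu> i)) t\<bar> \<le> sup_const \<alpha> * (real k + 4) * rate \<alpha> n))"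
proof -
  obtain B where B: "B \<in> sets (gaussian_sequence \<mu> \<sigma>)"
    "measure (gaussian_sequence \<mu> \<sigma>) B \<le> 160 * real n powr (3 - (real k + 4)\<^sup>2 / 2)"
    "\<And>\<theta>. \<theta> \<in> space (gaussian_sequence \<mu> \<sigma>) - B \<Longrightarrow> uniformly_summable (\<lambda>i. w i * (\<theta> i - \<mu> i))"
    "\<And>\<theta> m t. \<theta> \<in> space (gaussian_sequence \<mu> \<sigma>) - B \<Longrightarrow> t \<in> {0..1} \<Longrightarrow>
        \<bar>partial_series (\<lambda>i. w i * (\<theta> i - \<mu> i)) m t\<bar> \<le> sup_const \<alpha> * (real k + 4) * rate \<alpha> n"
    using gaussian_series_sup[OF \<alpha> n _ \<sigma> w, of "real k + 4" \<mu>] by auto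
  have "real n powr (3 - (real k + 4)\<^sup>2 / 2) \<le> real n powr (- 1 - real k)"
    using n by (intro powr_mono) (auto simp: power2_eq_square algebra_simps)
  also have "\<dots> = 1 / real n * (1 / real n) ^ k"
    using n by (simp add: powr_diff powr_minus_divide powr_realpow power_divide)
  also have "\<dots> \<le> 1 / real n * (1 / 2) ^ k"
    using n by (intro mult_left_mono power_mono divide_left_mono) auto
  finally have "160 * real n powr (3 - (real k + 4)\<^sup>2 / 2) \<le> 160 / real n * (1 / 2) ^ k" by simp
  moreover have "\<bar>fourier_series (\<lambda>i. w i * (\<theta> i - \<mu> i)) t\<bar> \<le> sup_const \<alpha> * (real k + 4) * rate \<alpha> n"
    if "\<theta> \<in> space (gaussian_sequence \<mu> \<sigma>) - B" "t \<in> {0..1}" for \<theta> t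
    by (rule LIMSEQ_le_const2[OF tendsto_rabs[OF uniformly_summable_tendsto[OF B(3)[OF that(1)] that(2)]]])
       (use B(4)[OF that] in auto)
  ultimately show ?thesis
    using B(1-3) by (intro bexI[of _ B]) auto
qed

text \<open>The exceptional sets for all \<open>k\<close> have a null set as their intersection.\<close>

lemma AE_uniformly_summable:
  assumes \<alpha>: "\<alpha> > 0" and n: "n \<ge> 2" and \<sigma>: "\<And>i. i \<ge> 1 \<Longrightarrow> \<sigma> i > 0"
    and w: "\<And>i. i \<ge> 1 \<Longrightarrow> \<bar>w i * \<sigma> i\<bar> \<le> posterior_coeff_sd \<alpha> n i"
  shows "AE \<theta> in gaussian_sequence \<mu> \<sigma>. uniformly_summable (\<lambda>i. w i * (\<theta> i - \<mu> i))"
proof -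
  let ?G = "gaussian_sequence \<mu> \<sigma>"
  interpret prob_space ?G by (rule prob_space_gaussian_sequence[OF \<sigma>])
  have "\<exists>B. B \<in> sets ?G \<and> prob B \<le> 160 / real n * (1 / 2) ^ k \<and>
     (\<forall>\<theta>\<in>space ?G - B. uniformly_summable (\<lambda>i. w i * (\<theta> i - \<mu> i)))" for k
    using gaussian_series_sup_geometric[OF \<alpha> n \<sigma> w, of \<mu> k] by blast
  then obtain B where B: "\<And>k. B k \<in> sets ?G" "\<And>k. prob (B k) \<le> 160 / real n * (1 / 2) ^ k"
     "\<And>k \<theta>. \<theta> \<in> space ?G - B k \<Longrightarrow> uniformly_summable (\<lambda>i. w i * (\<theta> i - \<mu> i))"
    by metis
  have N: "(\<Inter>k. B k) \<in> sets ?G" using B(1) by (intro sets.countable_INT') auto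
  have "prob (\<Inter>k. B k) \<le> 160 / real n * (1 / 2) ^ k" for k
    using finite_measure_mono[of "\<Inter>k. B k" "B k"] B(1)[of k] B(2)[of k] by force
  moreover have "(\<lambda>k. 160 / real n * (1 / 2) ^ k) \<longlonglongrightarrow> 160 / real n * 0"
    by (intro tendsto_intros LIMSEQ_power_zero) auto
  ultimately have "prob (\<Inter>k. B k) \<le> 160 / real n * 0"
    by (intro LIMSEQ_le_const[where x = "160 / real n * 0"]) auto
  then have "prob (\<Inter>k. B k) = 0" by (intro order_antisym measure_nonneg) simp
  then have "(\<Inter>k. B k) \<in> null_sets ?G"
    using N by (auto simp: null_sets_def emeasure_eq_measure)
  then show ?thesis
    by (rule AE_I') (use B(3) in blast)
qed

text \<open>The noise in the posterior mean is dominated by the posterior spread.\<close>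

lemma data_sd_shrinkage_le:
  assumes "n \<ge> 1"
  shows "\<bar>shrinkage \<alpha> n i * (1 / sqrt (real n))\<bar> \<le> posterior_coeff_sd \<alpha> n i"
proof -
  define a where "a = real i powr (2 * \<alpha> + 1)"
  have a: "a \<ge> 0" by (simp add: a_def)
  have n: "real n > 0" using assms by simp
  have "sqrt (real n) * sqrt (a + real n) \<le> sqrt (a + real n) * sqrt (a + real n)"
    using a by (intro mult_right_mono) auto
  also have "\<dots> = a + real n" using a n by simp
  finally have "sqrt (real n) / (a + real n) \<le> 1 / sqrt (a + real n)"
    using a n by (simp add: field_simps)
  moreover have "shrinkage \<alpha> n i * (1 / sqrt (real n)) = sqrt (real n) / (a + real n)"
  proof -
    have "shrinkage \<alpha> n i = real n / (a + real n)" by (simp only: shrinkage_def a_def)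
    then have "shrinkage \<alpha> n i * (1 / sqrt (real n)) = (real n / sqrt (real n)) / (a + real n)" by simp
    then show ?thesis using n by (simp only: real_div_sqrt)
  qed
  ultimately show ?thesis using a n by (simp only: posterior_coeff_sd_def a_def[symmetric]) simp
qed

text \<open>For sets of functions whose measurability is in doubt; a non-measurable set has measure \<open>0\<close>.\<close>

lemma (in finite_measure) measure_le_superset:
  "B \<in> sets M \<Longrightarrow> A \<subseteq> B \<Longrightarrow> measure M A \<le> measure M B"
  by (cases "A \<in> sets M") (auto intro: finite_measure_mono simp: measure_notin_sets)

lemma posterior_noise:
  assumes \<alpha>: "\<alpha> > 0" and n: "n \<ge> 2"
  shows "\<exists>B\<in>sets (coeff_posterior \<alpha> n y).
     measure (coeff_posterior \<alpha> n y) B \<le> 160 / real n * (1 / 2) ^ k \<and>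
     (\<forall>\<theta>\<in>space (coeff_posterior \<alpha> n y) - B.
        uniformly_summable (\<lambda>i. \<theta> i - posterior_coeff_mean \<alpha> n y i) \<and>
        (\<forall>t\<in>{0..1}. \<bar>fourier_series (\<lambda>i. \<theta> i - posterior_coeff_mean \<alpha> n y i) t\<bar> \<le> sup_const \<alpha> * (real k + 4) * rate \<alpha> n))"
proof -
  have "posterior_coeff_sd \<alpha> n i > 0" for i using n by (intro posterior_coeff_sd_pos) auto
  then show ?thesis
    using gaussian_series_sup_geometric[OF \<alpha> n, of "posterior_coeff_sd \<alpha> n" "\<lambda>_. 1" "posterior_coeff_mean \<alpha> n y" k]
    unfolding coeff_posterior_def by (simp add: less_imp_le)
qed

lemma posterior_mean_error:
  assumes f: "f \<in> function_class \<alpha> R" and \<alpha>: "\<alpha> > 0" and n: "n \<ge> 2"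
    and V: "uniformly_summable (\<lambda>i. shrinkage \<alpha> n i * (y i - fourier_coeff f i))"
  shows "uniformly_summable (posterior_coeff_mean \<alpha> n y)"
    and "t \<in> {0..1} \<Longrightarrow> f t - posterior_mean \<alpha> n y t =
       fourier_series (\<lambda>i. fourier_coeff f i - shrinkage \<alpha> n i * fourier_coeff f i) t -
       fourier_series (\<lambda>i. shrinkage \<alpha> n i * (y i - fourier_coeff f i)) t"
proof -
  let ?b = "\<lambda>i. fourier_coeff f i - shrinkage \<alpha> n i * fourier_coeff f i"
  let ?V = "\<lambda>i. shrinkage \<alpha> n i * (y i - fourier_coeff f i)"
  have mean: "posterior_coeff_mean \<alpha> n y = (\<lambda>i. fourier_coeff f i - (?b i - ?V i))"
    by (intro ext) (simp add: posterior_coeff_mean_shrinkage algebra_simps)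
  note F = function_classD[OF f \<alpha>]
  note us = uniformly_summable_abs(1)[OF F(2)] uniformly_summable_diff(1)[OF bias_bound(1)[OF f \<alpha> n] V]
  show "uniformly_summable (posterior_coeff_mean \<alpha> n y)"
    unfolding mean by (rule uniformly_summable_diff(1)[OF us])
  assume t: "t \<in> {0..1}"
  show "f t - posterior_mean \<alpha> n y t = fourier_series ?b t - fourier_series ?V t"
    unfolding posterior_mean_def mean uniformly_summable_diff(2)[OF us t]
      uniformly_summable_diff(2)[OF bias_bound(1)[OF f \<alpha> n] V t] F(1)[OF t] by simp
qed

lemma fourier_series_centered:
  assumes "uniformly_summable (posterior_coeff_mean \<alpha> n y)"
    and "uniformly_summable (\<lambda>i. \<theta> i - posterior_coeff_mean \<alpha> n y i)" and t: "t \<in> {0..1}"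
  shows "fourier_series \<theta> t - posterior_mean \<alpha> n y t = fourier_series (\<lambda>i. \<theta> i - posterior_coeff_mean \<alpha> n y i) t"
  using uniformly_summable_add(2)[OF assms(2,1) t] by (simp add: posterior_mean_def)

lemma prob_space_coeff_posterior: "n \<ge> 1 \<Longrightarrow> prob_space (coeff_posterior \<alpha> n y)"
  unfolding coeff_posterior_def by (intro prob_space_gaussian_sequence posterior_coeff_sd_pos)

lemma prob_space_data:
  "n \<ge> 1 \<Longrightarrow> prob_space (gaussian_sequence (fourier_coeff f) (\<lambda>i. 1 / sqrt (real n)))"
  by (intro prob_space_gaussian_sequence) auto

lemma prob_space_data_law: "n \<ge> 1 \<Longrightarrow> prob_space (data_law n f)"
  unfolding data_law_def by (intro prob_space.prob_space_completion prob_space_data)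

lemma data_noise:
  assumes \<alpha>: "\<alpha> > 0" and n: "n \<ge> 2"
  shows "\<exists>B\<in>sets (data_law n f). measure (data_law n f) B \<le> 160 / real n \<and>
     (\<forall>y\<in>space (data_law n f) - B.
        uniformly_summable (\<lambda>i. shrinkage \<alpha> n i * (y i - fourier_coeff f i)) \<and>
        (\<forall>t\<in>{0..1}. \<bar>fourier_series (\<lambda>i. shrinkage \<alpha> n i * (y i - fourier_coeff f i)) t\<bar> \<le> 4 * sup_const \<alpha> * rate \<alpha> n))"
proof -
  let ?G = "gaussian_sequence (fourier_coeff f) (\<lambda>i. 1 / sqrt (real n))"
  have n1: "n \<ge> 1" using n by simp
  obtain B where "B \<in> sets ?G" "measure ?G B \<le> 160 / real n"
     "\<forall>y\<in>space ?G - B.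
        uniformly_summable (\<lambda>i. shrinkage \<alpha> n i * (y i - fourier_coeff f i)) \<and>
        (\<forall>t\<in>{0..1}. \<bar>fourier_series (\<lambda>i. shrinkage \<alpha> n i * (y i - fourier_coeff f i)) t\<bar> \<le> 4 * sup_const \<alpha> * rate \<alpha> n)"
    using gaussian_series_sup_geometric[OF \<alpha> n _ data_sd_shrinkage_le[OF n1], of "fourier_coeff f" 0] n
    by (auto simp: mult.commute[of 4])
  then show ?thesis
    unfolding data_law_def by (intro bexI[of _ B]) auto
qed

lemma AE_data_uniformly_summable:
  assumes \<alpha>: "\<alpha> > 0" and n: "n \<ge> 2"
  shows "AE y in data_law n f. uniformly_summable (\<lambda>i. shrinkage \<alpha> n i * (y i - fourier_coeff f i))"
  unfolding data_law_def using n
  by (intro AE_completion AE_uniformly_summable[OF \<alpha> n] data_sd_shrinkage_le) auto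

section \<open>Contraction, credible radius and coverage\<close>

text \<open>The radius allows for the posterior spread, the noise in the posterior mean (\<open>4 * sup_const \<alpha>\<close> each) and the
  bias (\<open>4 * R\<close>).\<close>

lemma posterior_prob_le:
  assumes f: "f \<in> function_class \<alpha> R" and \<alpha>: "\<alpha> > 0" and n: "n \<ge> 2"
    and V: "uniformly_summable (\<lambda>i. shrinkage \<alpha> n i * (y i - fourier_coeff f i))"
    and V_le: "\<And>t. t \<in> {0..1} \<Longrightarrow> \<bar>fourier_series (\<lambda>i. shrinkage \<alpha> n i * (y i - fourier_coeff f i)) t\<bar> \<le> 4 * sup_const \<alpha> * rate \<alpha> n"
    and M: "M \<ge> 8 * sup_const \<alpha> + 4 * R"
  shows "posterior_prob \<alpha> n y {g. sup_norm (\<lambda>x. g x - f x) > ereal (M * rate \<alpha> n)} \<le> 160 / real n"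
proof -
  let ?P = "coeff_posterior \<alpha> n y"
  have n1: "n \<ge> 1" using n by simp
  interpret C: prob_space "completion ?P"
    by (intro prob_space.prob_space_completion prob_space_coeff_posterior n1)
  obtain B where B: "B \<in> sets ?P" "measure ?P B \<le> 160 / real n"
    "\<And>\<theta>. \<theta> \<in> space ?P - B \<Longrightarrow> uniformly_summable (\<lambda>i. \<theta> i - posterior_coeff_mean \<alpha> n y i)"
    "\<And>\<theta> t. \<theta> \<in> space ?P - B \<Longrightarrow> t \<in> {0..1} \<Longrightarrow>
        \<bar>fourier_series (\<lambda>i. \<theta> i - posterior_coeff_mean \<alpha> n y i) t\<bar> \<le> 4 * sup_const \<alpha> * rate \<alpha> n"
    using posterior_noise[OF \<alpha> n, of y 0] by (auto simp: mult.commute[of 4])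
  have "sup_norm (\<lambda>x. fourier_series \<theta> x - f x) \<le> ereal (M * rate \<alpha> n)" if \<theta>: "\<theta> \<in> space ?P - B" for \<theta>
    unfolding sup_norm_le_iff
  proof
    fix t :: real assume t: "t \<in> {0..1}"
    note PM = posterior_mean_error[OF f \<alpha> n V]
    have "\<bar>fourier_series \<theta> t - f t\<bar> \<le>
       4 * sup_const \<alpha> * rate \<alpha> n + 4 * sup_const \<alpha> * rate \<alpha> n + 4 * R * rate \<alpha> n"
      using fourier_series_centered[OF PM(1) B(3)[OF \<theta>] t] PM(2)[OF t] B(4)[OF \<theta> t] V_le[OF t]
        bias_bound(2)[OF f \<alpha> n t] by linarith
    also have "\<dots> = (8 * sup_const \<alpha> + 4 * R) * rate \<alpha> n" by (simp add: algebra_simps)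
    also have "\<dots> \<le> M * rate \<alpha> n" using M rate_nonneg[OF n1] by (intro mult_right_mono) auto
    finally show "\<bar>fourier_series \<theta> t - f t\<bar> \<le> M * rate \<alpha> n" .
  qed
  then have "{\<theta> \<in> space ?P. fourier_series \<theta> \<in> {g. sup_norm (\<lambda>x. g x - f x) > ereal (M * rate \<alpha> n)}} \<subseteq> B"
    by (force simp: not_less[symmetric])
  then have "posterior_prob \<alpha> n y {g. sup_norm (\<lambda>x. g x - f x) > ereal (M * rate \<alpha> n)} \<le> measure (completion ?P) B"
    unfolding posterior_prob_def using B(1) by (intro C.measure_le_superset) auto
  then show ?thesis using B(1,2) by simp
qed

text \<open>The posterior probability is small for good data and at most one for the others. If it is not integrable in the
  data, then its integral is \<open>0\<close> by convention.\<close>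

lemma expected_posterior_prob_le:
  assumes f: "f \<in> function_class \<alpha> R" and \<alpha>: "\<alpha> > 0" and n: "n \<ge> 2"
    and M: "M \<ge> 8 * sup_const \<alpha> + 4 * R"
  defines "p \<equiv> \<lambda>y. posterior_prob \<alpha> n y {g. sup_norm (\<lambda>x. g x - f x) > ereal (M * rate \<alpha> n)}"
  shows "(LINT y|data_law n f. p y) \<ge> 0" and "(LINT y|data_law n f. p y) \<le> 320 / real n"
proof -
  have n1: "n \<ge> 1" using n by simp
  interpret Y: prob_space "data_law n f" by (rule prob_space_data_law[OF n1])
  have p: "0 \<le> p y" "p y \<le> 1" for y
  proof -
    interpret C: prob_space "completion (coeff_posterior \<alpha> n y)"
      by (intro prob_space.prob_space_completion prob_space_coeff_posterior n1)
    show "0 \<le> p y" "p y \<le> 1" by (auto simp: p_def posterior_prob_def)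
  qed
  show "(LINT y|data_law n f. p y) \<ge> 0" using p by (intro integral_nonneg_AE) auto
  obtain B where B: "B \<in> sets (data_law n f)" "Y.prob B \<le> 160 / real n"
    "\<And>y. y \<in> space (data_law n f) - B \<Longrightarrow> uniformly_summable (\<lambda>i. shrinkage \<alpha> n i * (y i - fourier_coeff f i))"
    "\<And>y t. y \<in> space (data_law n f) - B \<Longrightarrow> t \<in> {0..1} \<Longrightarrow>
       \<bar>fourier_series (\<lambda>i. shrinkage \<alpha> n i * (y i - fourier_coeff f i)) t\<bar> \<le> 4 * sup_const \<alpha> * rate \<alpha> n"
    using data_noise[OF \<alpha> n, of f] by blast
  show "(LINT y|data_law n f. p y) \<le> 320 / real n"
  proof (cases "integrable (data_law n f) p")
    case True
    have "(LINT y|data_law n f. p y) \<le> (LINT y|data_law n f. 160 / real n + indicator B y)"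
    proof (intro integral_mono True)
      fix y assume y: "y \<in> space (data_law n f)"
      show "p y \<le> 160 / real n + indicator B y"
      proof (cases "y \<in> B")
        case False
        then have yB: "y \<in> space (data_law n f) - B" using y by simp
        show ?thesis
          using posterior_prob_le[OF f \<alpha> n B(3)[OF yB] B(4)[OF yB] M] False by (simp add: p_def)
      next
        case True
        have "p y \<le> 1 + 160 / real n" using p(2)[of y] by (intro order_trans[OF p(2)]) simp
        then show ?thesis using True by simp
      qed
    qed (use B(1) in \<open>auto simp: less_top[symmetric]\<close>)
    also have "\<dots> = 160 / real n + Y.prob B"
      using B(1) by (subst Bochner_Integration.integral_add) (auto simp: Y.prob_space less_top[symmetric])
    finally show ?thesis using B(2) by simp
  qed (simp add: not_integrable_integral_eq)
qed

text \<open>A credible radius is characterised by almost all data; a single observation for which the posterior mean converges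
  suffices to work with it. The ball has positive mass and is therefore measurable.\<close>

lemma credible_radiusE:
  assumes \<alpha>: "\<alpha> > 0" and R: "R > 0" and \<gamma>: "\<gamma> \<le> 1 / 2" and n: "n \<ge> 2"
    and r: "credible_radius \<alpha> R \<gamma> n r"
  obtains y where "{\<theta> \<in> space (coeff_posterior \<alpha> n y). sup_norm (\<lambda>x. fourier_series \<theta> x - posterior_mean \<alpha> n y x) \<le> ereal r}
        \<in> sets (completion (coeff_posterior \<alpha> n y))"
    and "measure (completion (coeff_posterior \<alpha> n y))
       {\<theta> \<in> space (coeff_posterior \<alpha> n y). sup_norm (\<lambda>x. fourier_series \<theta> x - posterior_mean \<alpha> n y x) \<le> ereal r} = 1 - \<gamma>"
    and "uniformly_summable (posterior_coeff_mean \<alpha> n y)"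
proof -
  define f where "f = (\<lambda>x::real. 0::real)"
  have f: "f \<in> function_class \<alpha> R"
    unfolding function_class_def f_def using R
    by (intro CollectI exI[of _ "\<lambda>_. 0"]) (auto simp: fourier_series_def)
  interpret Y: prob_space "data_law n f" using n by (intro prob_space_data_law) auto
  have "AE y in data_law n f. posterior_prob \<alpha> n y {g. sup_norm (\<lambda>x. g x - posterior_mean \<alpha> n y x) \<le> ereal r} = 1 - \<gamma>"
    using r f unfolding credible_radius_def by blast
  with AE_data_uniformly_summable[OF \<alpha> n, of f]
  have "AE y in data_law n f. posterior_prob \<alpha> n y {g. sup_norm (\<lambda>x. g x - posterior_mean \<alpha> n y x) \<le> ereal r} = 1 - \<gamma> \<and>
     uniformly_summable (\<lambda>i. shrinkage \<alpha> n i * (y i - fourier_coeff f i))"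
    by eventually_elim blast
  then obtain y where y: "posterior_prob \<alpha> n y {g. sup_norm (\<lambda>x. g x - posterior_mean \<alpha> n y x) \<le> ereal r} = 1 - \<gamma>"
     "uniformly_summable (\<lambda>i. shrinkage \<alpha> n i * (y i - fourier_coeff f i))"
    using eventually_happens'[OF Y.ae_filter_bot] by blast
  let ?A = "{\<theta> \<in> space (coeff_posterior \<alpha> n y). sup_norm (\<lambda>x. fourier_series \<theta> x - posterior_mean \<alpha> n y x) \<le> ereal r}"
  have A: "measure (completion (coeff_posterior \<alpha> n y)) ?A = 1 - \<gamma>"
    using y(1) by (simp add: posterior_prob_def)
  then have "?A \<in> sets (completion (coeff_posterior \<alpha> n y))"
    using \<gamma> measure_notin_sets[of ?A "completion (coeff_posterior \<alpha> n y)"] by auto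
  then show ?thesis
    using A posterior_mean_error(1)[OF f \<alpha> n y(2)] by (rule that)
qed

text \<open>With a larger radius, the complement of the ball would be too unlikely to have posterior mass \<open>\<gamma>\<close>.\<close>

lemma credible_radius_le:
  assumes \<alpha>: "\<alpha> > 0" and R: "R > 0" and \<gamma>: "\<gamma> \<le> 1 / 2" and n: "n \<ge> 2"
    and r: "credible_radius \<alpha> R \<gamma> n r" and k: "160 * (1 / 2) ^ k < \<gamma>"
  shows "r \<le> sup_const \<alpha> * (real k + 4) * rate \<alpha> n"
proof (rule ccontr)
  assume large: "\<not> ?thesis"
  obtain y where y: "{\<theta> \<in> space (coeff_posterior \<alpha> n y). sup_norm (\<lambda>x. fourier_series \<theta> x - posterior_mean \<alpha> n y x) \<le> ereal r}
        \<in> sets (completion (coeff_posterior \<alpha> n y))"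
    "measure (completion (coeff_posterior \<alpha> n y))
       {\<theta> \<in> space (coeff_posterior \<alpha> n y). sup_norm (\<lambda>x. fourier_series \<theta> x - posterior_mean \<alpha> n y x) \<le> ereal r} = 1 - \<gamma>"
    "uniformly_summable (posterior_coeff_mean \<alpha> n y)"
    by (rule credible_radiusE[OF \<alpha> R \<gamma> n r])
  let ?P = "coeff_posterior \<alpha> n y"
  let ?A = "{\<theta> \<in> space ?P. sup_norm (\<lambda>x. fourier_series \<theta> x - posterior_mean \<alpha> n y x) \<le> ereal r}"
  interpret P: prob_space ?P using n by (intro prob_space_coeff_posterior) auto
  interpret C: prob_space "completion ?P" by (rule P.prob_space_completion)
  obtain B where B: "B \<in> sets ?P" "measure ?P B \<le> 160 / real n * (1 / 2) ^ k"
    "\<And>\<theta>. \<theta> \<in> space ?P - B \<Longrightarrow> uniformly_summable (\<lambda>i. \<theta> i - posterior_coeff_mean \<alpha> n y i)"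
    "\<And>\<theta> t. \<theta> \<in> space ?P - B \<Longrightarrow> t \<in> {0..1} \<Longrightarrow>
        \<bar>fourier_series (\<lambda>i. \<theta> i - posterior_coeff_mean \<alpha> n y i) t\<bar> \<le> sup_const \<alpha> * (real k + 4) * rate \<alpha> n"
    using posterior_noise[OF \<alpha> n, of y k] by blast
  have "space ?P - B \<subseteq> ?A"
  proof
    fix \<theta> assume \<theta>: "\<theta> \<in> space ?P - B"
    have "\<bar>fourier_series \<theta> t - posterior_mean \<alpha> n y t\<bar> \<le> r" if t: "t \<in> {0..1}" for t
      using fourier_series_centered[OF y(3) B(3)[OF \<theta>] t] B(4)[OF \<theta> t] large by linarith
    then show "\<theta> \<in> ?A" using \<theta> by (simp add: sup_norm_le_iff)
  qed
  then have "C.prob (space ?P - B) \<le> 1 - \<gamma>"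
    unfolding y(2)[symmetric] using y(1) by (rule C.finite_measure_mono)
  moreover have "C.prob (space ?P - B) = 1 - P.prob B"
    using B(1) by (simp add: P.prob_compl)
  moreover have "160 / real n * (1 / 2) ^ k \<le> 160 * (1 / 2) ^ k"
    using n by (intro mult_right_mono) (auto simp: divide_le_eq)
  ultimately show False using B(2) k by linarith
qed

text \<open>With a smaller radius, the ball itself would be too unlikely to have posterior mass \<open>1 - \<gamma> \<ge> 1 / 2\<close>.\<close>

lemma credible_radius_ge:
  assumes \<alpha>: "\<alpha> > 0" and R: "R > 0" and \<gamma>: "\<gamma> \<le> 1 / 2"
    and h: "\<And>n. n \<ge> 1 \<Longrightarrow> credible_radius \<alpha> R \<gamma> n (h n)"
  shows "\<exists>c>0. \<forall>\<^sub>F n in sequentially. h n \<ge> c * rate \<alpha> n"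
proof -
  obtain c \<psi> where c: "c > 0" and \<psi>: "\<psi> \<longlonglongrightarrow> 0" and
    ev: "\<forall>\<^sub>F n in sequentially. \<forall>\<mu>.
     \<exists>B\<in>sets (gaussian_sequence \<mu> (posterior_coeff_sd \<alpha> n)).
       measure (gaussian_sequence \<mu> (posterior_coeff_sd \<alpha> n)) B \<le> \<psi> n \<and>
       (\<forall>\<theta>\<in>space (gaussian_sequence \<mu> (posterior_coeff_sd \<alpha> n)) - B.
          uniformly_summable (\<lambda>i. \<theta> i - \<mu> i) \<longrightarrow>
          (\<exists>t\<in>{0..1}. fourier_series (\<lambda>i. \<theta> i - \<mu> i) t > c * rate \<alpha> n))"
    using posterior_sup_ge[OF \<alpha>] by blast
  have "\<forall>\<^sub>F n in sequentially. \<psi> n < 1 / 4" using \<psi> by (rule order_tendstoD) simp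
  with ev eventually_gt_at_top[of 640] have "\<forall>\<^sub>F n in sequentially. h n \<ge> c * rate \<alpha> n"
  proof eventually_elim
    case (elim n)
    have n: "n \<ge> 2" "n \<ge> 1" using elim by auto
    show ?case
    proof (rule ccontr)
      assume small: "\<not> ?thesis"
      obtain y where y: "{\<theta> \<in> space (coeff_posterior \<alpha> n y). sup_norm (\<lambda>x. fourier_series \<theta> x - posterior_mean \<alpha> n y x) \<le> ereal (h n)}
            \<in> sets (completion (coeff_posterior \<alpha> n y))"
        "measure (completion (coeff_posterior \<alpha> n y))
           {\<theta> \<in> space (coeff_posterior \<alpha> n y). sup_norm (\<lambda>x. fourier_series \<theta> x - posterior_mean \<alpha> n y x) \<le> ereal (h n)} = 1 - \<gamma>"
        "uniformly_summable (posterior_coeff_mean \<alpha> n y)"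
        by (rule credible_radiusE[OF \<alpha> R \<gamma> n(1) h[OF n(2)]])
      let ?P = "coeff_posterior \<alpha> n y"
      let ?A = "{\<theta> \<in> space ?P. sup_norm (\<lambda>x. fourier_series \<theta> x - posterior_mean \<alpha> n y x) \<le> ereal (h n)}"
      interpret P: prob_space ?P using n by (intro prob_space_coeff_posterior) auto
      interpret C: prob_space "completion ?P" by (rule P.prob_space_completion)
      obtain B where B: "B \<in> sets ?P" "P.prob B \<le> \<psi> n"
        "\<And>\<theta>. \<theta> \<in> space ?P - B \<Longrightarrow> uniformly_summable (\<lambda>i. \<theta> i - posterior_coeff_mean \<alpha> n y i) \<Longrightarrow>
            \<exists>t\<in>{0..1}. fourier_series (\<lambda>i. \<theta> i - posterior_coeff_mean \<alpha> n y i) t > c * rate \<alpha> n"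
        using elim(1)[rule_format, of "posterior_coeff_mean \<alpha> n y"] unfolding coeff_posterior_def by blast
      obtain N where N: "N \<in> sets ?P" "P.prob N \<le> 160 / real n * (1 / 2) ^ 0"
        "\<And>\<theta>. \<theta> \<in> space ?P - N \<Longrightarrow> uniformly_summable (\<lambda>i. \<theta> i - posterior_coeff_mean \<alpha> n y i)"
        using posterior_noise[OF \<alpha> n(1), of y 0] by blast
      have "?A \<subseteq> B \<union> N"
      proof (rule subsetI, rule ccontr)
        fix \<theta> assume \<theta>: "\<theta> \<in> ?A" "\<theta> \<notin> B \<union> N"
        then have us: "uniformly_summable (\<lambda>i. \<theta> i - posterior_coeff_mean \<alpha> n y i)" using N(3) by blast
        then obtain t where t: "t \<in> {0..1}" "fourier_series (\<lambda>i. \<theta> i - posterior_coeff_mean \<alpha> n y i) t > c * rate \<alpha> n"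
          using B(3) \<theta> by blast
        have "\<bar>fourier_series \<theta> t - posterior_mean \<alpha> n y t\<bar> \<le> h n"
          using \<theta>(1) t(1) by (simp add: sup_norm_le_iff)
        then show False
          using fourier_series_centered[OF y(3) us t(1)] t(2) small by linarith
      qed
      then have "1 - \<gamma> \<le> C.prob (B \<union> N)"
        unfolding y(2)[symmetric] using B(1) N(1) by (intro C.measure_le_superset) auto
      also have "\<dots> = P.prob (B \<union> N)" using B(1) N(1) by simp
      also have "\<dots> \<le> P.prob B + P.prob N" using B(1) N(1) by (intro measure_Un_le) auto
      also have "\<dots> < 1 / 4 + 1 / 4"
      proof (intro add_strict_mono)
        show "P.prob B < 1 / 4" using B(2) elim by linarith
        have "160 / real n < 1 / 4" using elim by (simp add: field_simps)
        then show "P.prob N < 1 / 4" using N(2) by simp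
      qed
      finally show False using \<gamma> by simp
    qed
  qed
  with c show ?thesis by blast
qed

text \<open>For almost all data the difference is continuous, and then its supremum may be taken over a countable dense set. So
  the event differs from a measurable one by a null set.\<close>

lemma sets_sup_norm_ball:
  assumes f: "f \<in> function_class \<alpha> R" and \<alpha>: "\<alpha> > 0" and n: "n \<ge> 2"
  shows "{y \<in> space (data_law n f). sup_norm (\<lambda>x. f x - posterior_mean \<alpha> n y x) \<le> ereal r} \<in> sets (data_law n f)"
proof -
  let ?G = "gaussian_sequence (fourier_coeff f) (\<lambda>i. 1 / sqrt (real n))"
  define V where "V y = (\<lambda>i. shrinkage \<alpha> n i * (y i - fourier_coeff f i))" for y :: "nat \<Rightarrow> real"
  define b where "b = (\<lambda>i. fourier_coeff f i - shrinkage \<alpha> n i * fourier_coeff f i)"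
  define D where "D y t = fourier_series b t - fourier_series (V y) t" for y t
  have b: "uniformly_summable b" unfolding b_def by (rule bias_bound(1)[OF f \<alpha> n])
  obtain T where T: "countable T" "T \<subseteq> {0..1::real}" "{0..1} \<subseteq> closure T" by (rule separable)
  have closure_T: "closure T = {0..1}" using T(2,3) closure_minimal[OF T(2)] by auto
  have [measurable]: "(\<lambda>y. D y t) \<in> borel_measurable ?G" for t
    unfolding D_def fourier_series_def V_def by measurable
  define A where "A = {y \<in> space ?G. \<forall>t\<in>T. \<bar>D y t\<bar> \<le> r}"
  have A: "A \<in> sets ?G"
    unfolding A_def
  proof (intro sets.sets_Collect_countable_All' T(1))
    show "{y \<in> space ?G. \<bar>D y t\<bar> \<le> r} \<in> sets ?G" for t by measurable
  qed
  have ae: "AE y in ?G. uniformly_summable (V y)"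
    using AE_data_uniformly_summable[OF \<alpha> n, of f] unfolding data_law_def AE_completion_iff V_def .
  obtain N where N: "{y \<in> space ?G. \<not> uniformly_summable (V y)} \<subseteq> N" "emeasure ?G N = 0" "N \<in> sets ?G"
    by (rule AE_E[OF ae])
  then have null: "N \<in> null_sets ?G" by (intro null_setsI)
  define S where "S = {y \<in> space ?G. sup_norm (\<lambda>x. f x - posterior_mean \<alpha> n y x) \<le> ereal r}"
  have "y \<in> S \<longleftrightarrow> y \<in> A" if y: "y \<in> space ?G" "y \<notin> N" for y
  proof -
    have V: "uniformly_summable (V y)" using y N(1) by blast
    have eq: "f t - posterior_mean \<alpha> n y t = D y t" if "t \<in> {0..1}" for t
      using posterior_mean_error(2)[OF f \<alpha> n V[unfolded V_def] that] by (simp add: D_def b_def V_def)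
    have cont: "continuous_on (closure T) (\<lambda>t. \<bar>D y t\<bar>)"
      unfolding closure_T D_def by (intro continuous_intros continuous_on_fourier_series b V)
    have "y \<in> S \<longleftrightarrow> (\<forall>t\<in>{0..1}. \<bar>D y t\<bar> \<le> r)"
      using y(1) eq by (simp add: S_def sup_norm_le_iff)
    also have "\<dots> \<longleftrightarrow> (\<forall>t\<in>T. \<bar>D y t\<bar> \<le> r)"
      using continuous_le_on_closure[OF cont] T(2) unfolding closure_T by blast
    also have "\<dots> \<longleftrightarrow> y \<in> A" using y(1) by (simp add: A_def)
    finally show ?thesis .
  qed
  moreover have "S \<subseteq> space ?G" "A \<subseteq> space ?G" by (auto simp: S_def A_def)
  ultimately have "S = (A - N) \<union> (S \<inter> N)" by blast
  then have "S \<in> sets (completion ?G)"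
    using A N(3) null by (intro sets_completionI[of S "A - N" "S \<inter> N" N]) auto
  then show ?thesis by (simp add: S_def data_law_def)
qed

text \<open>Good data have bias and noise within the radius.\<close>

lemma coverage:
  assumes f: "f \<in> function_class \<alpha> R" and \<alpha>: "\<alpha> > 0"
    and h: "\<forall>\<^sub>F n in sequentially. (4 * sup_const \<alpha> + 4 * R) * rate \<alpha> n \<le> h n"
  shows "(\<lambda>n. measure (data_law n f) {y \<in> space (data_law n f). sup_norm (\<lambda>x. f x - posterior_mean \<alpha> n y x) \<le> ereal (h n)}) \<longlonglongrightarrow> 1"
proof (rule tendsto_sandwich)
  let ?p = "\<lambda>n. measure (data_law n f) {y \<in> space (data_law n f). sup_norm (\<lambda>x. f x - posterior_mean \<alpha> n y x) \<le> ereal (h n)}"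
  show "\<forall>\<^sub>F n in sequentially. ?p n \<le> 1"
    using eventually_ge_at_top[of 1]
    by eventually_elim (intro prob_space.prob_le_1 prob_space_data_law)
  show "\<forall>\<^sub>F n in sequentially. 1 - 160 / real n \<le> ?p n"
    using h eventually_ge_at_top[of 2]
  proof eventually_elim
    case (elim n)
    interpret Y: prob_space "data_law n f" using elim by (intro prob_space_data_law) auto
    obtain B where B: "B \<in> sets (data_law n f)" "Y.prob B \<le> 160 / real n"
      "\<And>y. y \<in> space (data_law n f) - B \<Longrightarrow> uniformly_summable (\<lambda>i. shrinkage \<alpha> n i * (y i - fourier_coeff f i))"
      "\<And>y t. y \<in> space (data_law n f) - B \<Longrightarrow> t \<in> {0..1} \<Longrightarrow>
         \<bar>fourier_series (\<lambda>i. shrinkage \<alpha> n i * (y i - fourier_coeff f i)) t\<bar> \<le> 4 * sup_const \<alpha> * rate \<alpha> n"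
      using data_noise[OF \<alpha> elim(2), of f] by blast
    have "space (data_law n f) - B \<subseteq> {y \<in> space (data_law n f). sup_norm (\<lambda>x. f x - posterior_mean \<alpha> n y x) \<le> ereal (h n)}"
    proof
      fix y assume y: "y \<in> space (data_law n f) - B"
      have "\<bar>f t - posterior_mean \<alpha> n y t\<bar> \<le> h n" if t: "t \<in> {0..1}" for t
        using posterior_mean_error(2)[OF f \<alpha> elim(2) B(3)[OF y] t] B(4)[OF y t]
          bias_bound(2)[OF f \<alpha> elim(2) t] elim(1) unfolding distrib_right by linarith
      then show "y \<in> {y \<in> space (data_law n f). sup_norm (\<lambda>x. f x - posterior_mean \<alpha> n y x) \<le> ereal (h n)}"
        using y by (simp add: sup_norm_le_iff)
    qed
    then have "Y.prob (space (data_law n f) - B) \<le> ?p n"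
      by (intro Y.finite_measure_mono sets_sup_norm_ball[OF f \<alpha> elim(2)])
    then show ?case using B(1,2) by (simp add: Y.prob_compl)
  qed
  have "(\<lambda>n. 160 / real n) \<longlonglongrightarrow> 0" by (rule lim_const_over_n)
  then show "(\<lambda>n. 1 - 160 / real n) \<longlonglongrightarrow> 1" using tendsto_diff[OF tendsto_const[of 1]] by fastforce
qed simp

theorem theorem1:
  fixes \<alpha> R \<gamma> :: real and h :: "nat \<Rightarrow> real"
  assumes "\<alpha> > 0" and "R > 0" and "0 < \<gamma>" and "\<gamma> \<le> 1 / 2"
    and "\<And>n. n \<ge> 1 \<Longrightarrow> credible_radius \<alpha> R \<gamma> n (h n)"
  shows "(\<forall>M :: nat \<Rightarrow> real. filterlim M at_top sequentially \<longrightarrow>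
           uniform_limit (function_class \<alpha> R)
             (\<lambda>n f\<^sub>0. LINT y|data_law n f\<^sub>0.
                posterior_prob \<alpha> n y {f. sup_norm (\<lambda>x. f x - f\<^sub>0 x) > ereal (M n * rate \<alpha> n)})
             (\<lambda>f\<^sub>0. 0) sequentially)
       \<and> (\<exists>M\<^sub>0>0. \<forall>M\<ge>M\<^sub>0. \<forall>f\<^sub>0\<in>function_class \<alpha> R.
           (\<lambda>n. measure (data_law n f\<^sub>0)
              {y \<in> space (data_law n f\<^sub>0).
                 sup_norm (\<lambda>x. f\<^sub>0 x - posterior_mean \<alpha> n y x) \<le> ereal (M * h n)})
             \<longlonglongrightarrow> 1)
       \<and> (\<exists>C>0. \<forall>n\<ge>2. h n \<le> C * rate \<alpha> n)"
proof (intro conjI allI impI)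
  fix M :: "nat \<Rightarrow> real" assume M: "filterlim M at_top sequentially"
  show "uniform_limit (function_class \<alpha> R)
             (\<lambda>n f\<^sub>0. LINT y|data_law n f\<^sub>0.
                posterior_prob \<alpha> n y {f. sup_norm (\<lambda>x. f x - f\<^sub>0 x) > ereal (M n * rate \<alpha> n)})
             (\<lambda>f\<^sub>0. 0) sequentially"
  proof (rule uniform_limitI)
    fix e :: real assume e: "e > 0"
    have "(\<lambda>n. 320 / real n) \<longlonglongrightarrow> 0" by (rule lim_const_over_n)
    then have "\<forall>\<^sub>F n in sequentially. 320 / real n < e" using e by (rule order_tendstoD)
    moreover have "\<forall>\<^sub>F n in sequentially. 8 * sup_const \<alpha> + 4 * R \<le> M n"
      using M by (simp add: filterlim_at_top)
    ultimately show "\<forall>\<^sub>F n in sequentially. \<forall>f\<^sub>0\<in>function_class \<alpha> R.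
        dist (LINT y|data_law n f\<^sub>0. posterior_prob \<alpha> n y {f. sup_norm (\<lambda>x. f x - f\<^sub>0 x) > ereal (M n * rate \<alpha> n)}) 0 < e"
      using eventually_ge_at_top[of 2]
    proof eventually_elim
      case (elim n)
      show ?case
      proof
        fix f\<^sub>0 assume "f\<^sub>0 \<in> function_class \<alpha> R"
        from expected_posterior_prob_le[OF this assms(1) elim(3,2)] elim(1)
        show "dist (LINT y|data_law n f\<^sub>0. posterior_prob \<alpha> n y {f. sup_norm (\<lambda>x. f x - f\<^sub>0 x) > ereal (M n * rate \<alpha> n)}) 0 < e"
          by simp
      qed
    qed
  qed
next
  obtain c where c: "c > 0" and h_ge: "\<forall>\<^sub>F n in sequentially. h n \<ge> c * rate \<alpha> n"
    using credible_radius_ge[OF assms(1,2,4,5)] by blast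
  define K where "K = 4 * sup_const \<alpha> + 4 * R"
  have K: "K > 0" using sup_const_pos[OF assms(1)] assms(2) by (simp add: K_def)
  show "\<exists>M\<^sub>0>0. \<forall>M\<ge>M\<^sub>0. \<forall>f\<^sub>0\<in>function_class \<alpha> R.
           (\<lambda>n. measure (data_law n f\<^sub>0)
              {y \<in> space (data_law n f\<^sub>0).
                 sup_norm (\<lambda>x. f\<^sub>0 x - posterior_mean \<alpha> n y x) \<le> ereal (M * h n)})
             \<longlonglongrightarrow> 1"
  proof (intro exI[of _ "K / c"] conjI allI impI ballI)
    show "K / c > 0" using K c by simp
    fix M f\<^sub>0 assume M: "K / c \<le> M" and f: "f\<^sub>0 \<in> function_class \<alpha> R"
    have "\<forall>\<^sub>F n in sequentially. K * rate \<alpha> n \<le> M * h n"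
      using h_ge eventually_ge_at_top[of 1]
    proof eventually_elim
      case (elim n)
      have "K * rate \<alpha> n = K / c * (c * rate \<alpha> n)" using c by simp
      also have "\<dots> \<le> M * h n"
        using elim M K c rate_nonneg[OF elim(2)] order_trans[OF _ M, of 0] by (intro mult_mono) auto
      finally show ?case .
    qed
    then show "(\<lambda>n. measure (data_law n f\<^sub>0)
              {y \<in> space (data_law n f\<^sub>0).
                 sup_norm (\<lambda>x. f\<^sub>0 x - posterior_mean \<alpha> n y x) \<le> ereal (M * h n)}) \<longlonglongrightarrow> 1"
      unfolding K_def by (rule coverage[OF f assms(1)])
  qed
next
  have "(\<lambda>k. 160 * (1 / 2 :: real) ^ k) \<longlonglongrightarrow> 160 * 0"
    by (intro tendsto_intros LIMSEQ_power_zero) auto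
  then have "\<forall>\<^sub>F k in sequentially. 160 * (1 / 2 :: real) ^ k < \<gamma>"
    using assms(3) by (intro order_tendstoD) auto
  then obtain k where k: "160 * (1 / 2 :: real) ^ k < \<gamma>"
    by (auto simp: eventually_sequentially)
  show "\<exists>C>0. \<forall>n\<ge>2. h n \<le> C * rate \<alpha> n"
    using credible_radius_le[OF assms(1,2,4) _ assms(5) k] sup_const_pos[OF assms(1)]
    by (intro exI[of _ "sup_const \<alpha> * (real k + 4)"]) auto
qed

end
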